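(* Let $\mathcal{H}=\mathcal{K}\ltimes\mathbb{R}^8$ be the non-compact holonomy group of $\hat\nabla$ of a 10-dimensional supersymmetric heterotic background, with $\mathcal{K}$ one of $\mathrm{Spin}(7)$, $SU(4)$, $Sp(2)$, $Sp(1)\times Sp(1)$, $Sp(1)$, $U(1)$, $\{1\}$. The Lie algebras $\mathring{\mathfrak{f}}^{\mathcal H}_{\bar\curlywedge}$ of the fundamental forms of $\mathcal{H}$ are, respectively: - $\mathcal{K}=\mathrm{Spin}(7)$: $\mathbb{R}$; - $\mathcal{K}=SU(4)$: $\hat{\mathfrak{e}}(2)$; - $\mathcal{K}=Sp(2)$: $\mathfrak{sp}(1)$; - $\mathcal{K}=Sp(1)\times Sp(1)$: $\mathfrak{sp}(1)\oplus\mathfrak{sp}(1)$; - $\mathcal{K}=Sp(1)$: $\mathfrak{so}(5)$; - $\mathcal{K}=U(1)$: $\mathfrak{u}(4)$; - $\mathcal{K}=\{1\}$: $\mathfrak{so}(8)$. Here $\hat{\mathfrak{e}}(2)$ is the central extension of the Lie algebra of the Euclidean group in two dimensions.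
   Context: Setting: $\mathcal{M}^{10}$ is a smooth, oriented, spin, simply connected, time-oriented Lorentzian manifold with metric $g$, 3-form $H$ and metric connection $\hat\nabla_XY=\nabla_XY+\frac12\vec H(X,Y)$, $g(Z,\vec H(X,Y))=H(Z,X,Y)$, with holonomy group $\mathcal{K}\ltimes\mathbb{R}^8$. There is a $\hat\nabla$-parallel nowhere vanishing null 1-form $\kappa$, with adapted local coframes $(\mathbf{e}^-=\kappa,\mathbf{e}^+,\mathbf{e}^i;\ i=1,\dots,8)$, $g=2\mathbf{e}^-\mathbf{e}^++\delta_{ij}\mathbf{e}^i\mathbf{e}^j$, related on overlaps by $\mathcal{K}\ltimes\mathbb{R}^8$ transformations. Null forms: $\phi$ is null along $\kappa$ iff $\kappa\wedge\phi=0$ and $i_{\vec\kappa}\phi=0$; locally $\phi=\mathbf{e}^-\wedge\breve\phi$ with $\breve\phi=\frac1{\ell!}\phi_{i_1\dots i_\ell}\mathbf{e}^{i_1}\wedge\dots\wedge\mathbf{e}^{i_\ell}$, and $\phi$ is said to be represented by $\breve\phi$. For null forms define $\lambda\,\bar\curlywedge\,\phi:=\mathbf{e}^-\wedge i_{\vec{\breve\lambda}}\breve\phi$ and $\lambda\curlywedge\phi:=\lambda\wedge\breve\phi$ (both globally defined; $\curlywedge^k\omega$ denotes the $\curlywedge$-power). Here for a $p$-form $\breve\lambda$ and $q$-form $\breve\phi$, $i_{\vec{\breve\lambda}}\breve\phi=\frac1{(p-1)!(q-1)!}\breve\lambda^{k}{}_{i_1\dots i_{p-1}}\breve\phi_{k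 j_1\dots j_{q-1}}\mathbf{e}^{i_1}\wedge\dots\wedge\mathbf{e}^{i_{p-1}}\wedge\mathbf{e}^{j_1}\wedge\dots\wedge\mathbf{e}^{j_{q-1}}$ (zero if $p=0$ or $q=0$). Fundamental forms: $\mathfrak{f}^{\mathcal H}$ is a set of $\hat\nabla$-covariantly constant forms whose parallelism implies that the holonomy is $\mathcal{H}$ and which generates the ring of parallel null forms (under $\curlywedge$ for null forms along $\kappa$). Besides $\kappa$ the fundamental forms are: for $\mathrm{Spin}(7)$, the null 5-form represented by the $\mathrm{Spin}(7)$-invariant 4-form; for $SU(4)$, the null 3-form $\omega$ represented by the Hermitian form and the null 5-forms represented by the real and imaginary parts of the $(4,0)$ form; in the other cases, the null 3-forms represented by the $\mathcal{K}$-invariant 2-forms on $\mathbb{R}^8$ (for $Sp(2)$ the three Hermitian forms of the hyper-complex structure). Here $\mathcal{K}$ acts on $\mathbb{R}^8=\mathbb{C}^4=\mathbb{H}^2$ as follows: $\mathrm{Spin}(7)$ by its spin representation; $SU(4)$ and $Sp(2)$ by their standard representations; $Sp(1)\times Sp(1)$ with each factor acting on one copy of $\mathbb{H}$; $Sp(1)$ diagonally on $\mathbb{H}\oplus\mathbb{H}$; $U(1)$ by unit complex scalars on $\mathbb{C}^4$ for a suitable complex structure. All fundamental forms have odd degree, and $\bar\curlywedge$ is a Lie bracket on them. $\mathfrak{f}^{\mathcal H}_{\bar\curlywedge}$ is the closure of the span of $\mathfrak{f}^{\mathcal H}$ under the bracket $\bar\curlywedge$ (possibly including further parallel null forms needed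 for closure). $\kappa$ commutes with all other elements and $\mathring{\mathfrak{f}}^{\mathcal H}_{\bar\curlywedge}$ denotes the algebra with the generator $\kappa$ removed, so that $\mathfrak{f}^{\mathcal H}_{\bar\curlywedge}=\mathring{\mathfrak{f}}^{\mathcal H}_{\bar\curlywedge}\oplus\mathbb{R}\langle\kappa\rangle$. $\hat{\mathfrak{e}}(2)$: basis $J,P_1,P_2,Z$ with $Z$ central, $[J,P_1]=-P_2$, $[J,P_2]=P_1$, $[P_1,P_2]=Z$. *)

theory Defs
  imports "HOL-Analysis.Analysis" "HOL-Library.Function_Algebras"
begin

section \<open>Real vector spaces of functions\<close>

text \<open>Tangent vectors (as derivations), vector fields and differential forms are all functions;
  they are added and scaled pointwise.\<close>

instantiation "fun" :: (type, real_vector) real_vector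
begin
definition scaleR_fun :: "real \<Rightarrow> ('a \<Rightarrow> 'b) \<Rightarrow> 'a \<Rightarrow> 'b"
  where "scaleR_fun r f = (\<lambda>x. r *\<^sub>R f x)"
instance
  by standard (auto simp: scaleR_fun_def plus_fun_def fun_eq_iff scaleR_add_left scaleR_add_right)
end

definition linear_on_set :: "'a::real_vector set \<Rightarrow> ('a \<Rightarrow> 'b::real_vector) \<Rightarrow> bool" where
  "linear_on_set S f \<longleftrightarrow>
     (\<forall>x\<in>S. \<forall>y\<in>S. \<forall>a b. f (a *\<^sub>R x + b *\<^sub>R y) = a *\<^sub>R f x + b *\<^sub>R f y)"


section \<open>Exterior algebra\<close>

text \<open>A form on a vector space \<open>S\<close> is a function on lists of vectors; its restriction to lists of
  length \<open>k\<close> is its component of degree \<open>k\<close>, so sums of forms of different degrees are forms of the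
  same type.  The coefficients are real or complex.\<close>

definition alt_form :: "'a::real_vector set \<Rightarrow> nat \<Rightarrow> ('a list \<Rightarrow> 'c::real_vector) \<Rightarrow> bool" where
  "alt_form S k \<alpha> \<longleftrightarrow>
     (\<forall>xs. length xs \<noteq> k \<or> \<not> set xs \<subseteq> S \<longrightarrow> \<alpha> xs = 0) \<and>
     (\<forall>xs ys x y a b. length xs + Suc (length ys) = k \<longrightarrow> set (x # y # xs @ ys) \<subseteq> S \<longrightarrow>
        \<alpha> (xs @ (a *\<^sub>R x + b *\<^sub>R y) # ys) = a *\<^sub>R \<alpha> (xs @ x # ys) + b *\<^sub>R \<alpha> (xs @ y # ys)) \<and>
     (\<forall>xs. \<not> distinct xs \<longrightarrow> \<alpha> xs = 0)"

definition exterior_algebra :: "'a::real_vector set \<Rightarrow> ('a list \<Rightarrow> real) set" where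
  "exterior_algebra S = span {\<alpha>. \<exists>k. alt_form S k \<alpha>}"

text \<open>Sum over shuffles, normalised so that \<open>e\<^sup>1 \<and> e\<^sup>2\<close> takes the value \<open>1\<close> on \<open>(e\<^sub>1, e\<^sub>2)\<close>.\<close>

definition wedge :: "('a list \<Rightarrow> 'c::comm_ring_1) \<Rightarrow> ('a list \<Rightarrow> 'c) \<Rightarrow> 'a list \<Rightarrow> 'c" where
  "wedge \<alpha> \<beta> xs =
     (\<Sum>A\<in>Pow {..<length xs}.
        (- 1) ^ card {(i, j). i \<in> A \<and> j \<in> {..<length xs} - A \<and> j < i}
          * \<alpha> (nths xs A) * \<beta> (nths xs (- A)))"

definition interior_product :: "'a \<Rightarrow> ('a list \<Rightarrow> 'c) \<Rightarrow> 'a list \<Rightarrow> 'c" where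
  "interior_product v \<alpha> xs = \<alpha> (v # xs)"

definition one_form :: "('a \<Rightarrow> 'c::zero) \<Rightarrow> 'a list \<Rightarrow> 'c" where
  "one_form \<theta> xs = (case xs of [x] \<Rightarrow> \<theta> x | _ \<Rightarrow> 0)"

definition pullback :: "('a \<Rightarrow> 'b) \<Rightarrow> ('b list \<Rightarrow> 'c) \<Rightarrow> 'a list \<Rightarrow> 'c" where
  "pullback f \<alpha> xs = \<alpha> (map f xs)"

text \<open>The form \<open>\<Sum>\<^sub>k (i\<^sub>k \<psi>) \<and> (i\<^sub>k \<phi>)\<close>, i.e. \<open>\<phi>\<close> contracted with the vector-valued form obtained from
  \<open>\<psi>\<close> by raising its first index.  The components of \<open>i\<^sub>k \<psi>\<close> are \<open>\<psi>\<^sub>k\<^sub>I\<close>, which accounts for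
  the factor \<open>1/((p-1)! (q-1)!)\<close> of the component formula.\<close>

definition contraction ::
    "('v::euclidean_space list \<Rightarrow> real) \<Rightarrow> ('v list \<Rightarrow> real) \<Rightarrow> 'v list \<Rightarrow> real" where
  "contraction \<psi> \<phi> = (\<Sum>b\<in>Basis. wedge (interior_product b \<psi>) (interior_product b \<phi>))"

definition invariant_forms :: "('v::real_vector \<Rightarrow> 'v) set \<Rightarrow> nat \<Rightarrow> ('v list \<Rightarrow> real) set" where
  "invariant_forms K k = {\<alpha>. alt_form UNIV k \<alpha> \<and> (\<forall>h\<in>K. pullback h \<alpha> = \<alpha>)}"


section \<open>Lie algebras\<close>

definition lie_closure :: "('a::real_vector \<Rightarrow> 'a \<Rightarrow> 'a) \<Rightarrow> 'a set \<Rightarrow> 'a set" where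
  "lie_closure br F =
     \<Inter>{V. subspace V \<and> F \<subseteq> V \<and> (\<forall>x\<in>V. \<forall>y\<in>V. br x y \<in> V)}"

definition lie_isomorphic ::
    "'a::real_vector set \<Rightarrow> ('a \<Rightarrow> 'a \<Rightarrow> 'a) \<Rightarrow> 'b::real_vector set \<Rightarrow> ('b \<Rightarrow> 'b \<Rightarrow> 'b) \<Rightarrow> bool" where
  "lie_isomorphic V br W br' \<longleftrightarrow>
     (\<exists>f. linear_on_set V f \<and> bij_betw f V W \<and> (\<forall>x\<in>V. \<forall>y\<in>V. f (br x y) = br' (f x) (f y)))"

definition commutator :: "'a::ring_1^'n^'n \<Rightarrow> 'a^'n^'n \<Rightarrow> 'a^'n^'n" where
  "commutator X Y = X ** Y - Y ** X"

definition adjoint_matrix :: "complex^'n^'m \<Rightarrow> complex^'m^'n" where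
  "adjoint_matrix A = (\<chi> i j. cnj (A $ j $ i))"

definition so_algebra :: "(real^'n^'n) set" where
  "so_algebra = {X. transpose X = - X}"

definition u_algebra :: "(complex^'n^'n) set" where
  "u_algebra = {X. adjoint_matrix X = - X}"

text \<open>Coordinates with respect to the basis \<open>J, P\<^sub>1, P\<^sub>2, Z\<close>, in this order.\<close>

definition e2hat_bracket :: "real^4 \<Rightarrow> real^4 \<Rightarrow> real^4" where
  "e2hat_bracket x y = vector
     [0, x$1 * y$3 - x$3 * y$1, x$2 * y$1 - x$1 * y$2, x$2 * y$3 - x$3 * y$2]"

text \<open>The pair \<open>(a, b)\<close> is the quaternion \<open>a + b j\<close>.\<close>

type_synonym quat = "complex \<times> complex"

definition qmult :: "quat \<Rightarrow> quat \<Rightarrow> quat" where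
  "qmult p q = (fst p * fst q - snd p * cnj (snd q), fst p * snd q + snd p * cnj (fst q))"

definition qconj :: "quat \<Rightarrow> quat" where
  "qconj q = (cnj (fst q), - snd q)"

definition qi :: quat where "qi = (\<i>, 0)"
definition qj :: quat where "qj = (0, 1)"
definition qk :: quat where "qk = (0, \<i>)"

text \<open>The skew-Hermitian quaternionic matrices of size one.\<close>

definition sp1_algebra :: "quat set" where
  "sp1_algebra = {q. qconj q = - q}"

definition sp1_bracket :: "quat \<Rightarrow> quat \<Rightarrow> quat" where
  "sp1_bracket p q = qmult p q - qmult q p"

definition sum_bracket ::
    "('a \<Rightarrow> 'a \<Rightarrow> 'a) \<Rightarrow> ('b \<Rightarrow> 'b \<Rightarrow> 'b) \<Rightarrow> 'a \<times> 'b \<Rightarrow> 'a \<times> 'b \<Rightarrow> 'a \<times> 'b" where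
  "sum_bracket br br' x y = (br (fst x) (fst y), br' (snd x) (snd y))"


section \<open>The groups acting on the eight-dimensional space and their invariant forms\<close>

text \<open>The model of \<open>\<real>\<^sup>8\<close> is \<^typ>\<open>real^8\<close>, \<^typ>\<open>complex^4\<close> or \<^typ>\<open>quat \<times> quat\<close>, with its
  standard real inner product.\<close>

text \<open>\<open>\<gamma>\<close> makes \<open>\<real>\<^sup>8\<close> an orthogonal module of the Clifford algebra of \<open>\<real>\<^sup>7\<close>, i.e. the spinor
  module; \<open>Spin(7)\<close> acts by the products of an even number of unit vectors.\<close>

definition spinor_module :: "(real^7 \<Rightarrow> real^8 \<Rightarrow> real^8) \<Rightarrow> bool" where
  "spinor_module \<gamma> \<longleftrightarrow> bilinear \<gamma> \<and>
     (\<forall>u x. \<gamma> u (\<gamma> u x) = - (u \<bullet> u) *\<^sub>R x) \<and> (\<forall>u x y. \<gamma> u x \<bullet> y = - (x \<bullet> \<gamma> u y))"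

inductive_set Spin7 :: "(real^7 \<Rightarrow> real^8 \<Rightarrow> real^8) \<Rightarrow> (real^8 \<Rightarrow> real^8) set"
  for \<gamma> where
  "id \<in> Spin7 \<gamma>"
| "h \<in> Spin7 \<gamma> \<Longrightarrow> norm u = 1 \<Longrightarrow> norm v = 1 \<Longrightarrow> \<gamma> u \<circ> \<gamma> v \<circ> h \<in> Spin7 \<gamma>"

definition SU4 :: "(complex^4 \<Rightarrow> complex^4) set" where
  "SU4 = {(\<lambda>z. U *v z) | U. U ** adjoint_matrix U = mat 1 \<and> det U = 1}"

definition hermitian_form :: "(complex^4) list \<Rightarrow> real" where
  "hermitian_form xs = (case xs of [u, v] \<Rightarrow> u \<bullet> (\<i> *s v) | _ \<Rightarrow> 0)"

definition dz :: "4 \<Rightarrow> (complex^4) list \<Rightarrow> complex" where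
  "dz k = one_form (\<lambda>z. z $ k)"

definition holomorphic_volume :: "(complex^4) list \<Rightarrow> complex" where
  "holomorphic_volume = wedge (dz 1) (wedge (dz 2) (wedge (dz 3) (dz 4)))"

definition U1 :: "(complex^4 \<Rightarrow> complex^4) set" where
  "U1 = {(\<lambda>z. c *s z) | c. norm c = 1}"

text \<open>Quaternions act on \<open>\<bbbH>\<^sup>2\<close> from the right by the hyper-complex structure, and \<open>Sp(2)\<close>, as well as
  its subgroups \<open>Sp(1) \<times> Sp(1)\<close> and \<open>Sp(1)\<close>, from the left.\<close>

definition right_mult :: "quat \<times> quat \<Rightarrow> quat \<Rightarrow> quat \<times> quat" where
  "right_mult x q = (qmult (fst x) q, qmult (snd x) q)"

definition Sp2 :: "(quat \<times> quat \<Rightarrow> quat \<times> quat) set" where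
  "Sp2 = {h. linear h \<and> (\<forall>x q. h (right_mult x q) = right_mult (h x) q) \<and>
             (\<forall>x. norm (h x) = norm x)}"

definition Sp1_Sp1 :: "(quat \<times> quat \<Rightarrow> quat \<times> quat) set" where
  "Sp1_Sp1 = {(\<lambda>x. (qmult p (fst x), qmult q (snd x))) | p q. norm p = 1 \<and> norm q = 1}"

definition Sp1 :: "(quat \<times> quat \<Rightarrow> quat \<times> quat) set" where
  "Sp1 = {(\<lambda>x. (qmult q (fst x), qmult q (snd x))) | q. norm q = 1}"

definition quaternionic_form :: "quat \<Rightarrow> (quat \<times> quat) list \<Rightarrow> real" where
  "quaternionic_form q xs = (case xs of [u, v] \<Rightarrow> u \<bullet> right_mult v q | _ \<Rightarrow> 0)"


section \<open>Smooth manifolds\<close>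

fun Ck_on :: "nat \<Rightarrow> 'a::euclidean_space set \<Rightarrow> ('a \<Rightarrow> 'b::real_normed_vector) \<Rightarrow> bool" where
  "Ck_on 0 S f = continuous_on S f"
| "Ck_on (Suc k) S f = ((\<forall>x\<in>S. f differentiable (at x)) \<and>
     (\<forall>b\<in>Basis. Ck_on k S (\<lambda>x. frechet_derivative f (at x) b)))"

definition smooth_on :: "'a::euclidean_space set \<Rightarrow> ('a \<Rightarrow> 'b::real_normed_vector) \<Rightarrow> bool" where
  "smooth_on S f \<longleftrightarrow> (\<forall>k. Ck_on k S f)"

type_synonym 'm atlas = "('m set \<times> ('m \<Rightarrow> real^10)) set"

definition oriented_smooth_atlas :: "'m::topological_space atlas \<Rightarrow> bool" where
  "oriented_smooth_atlas A \<longleftrightarrow>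
     (\<Union>(U, c)\<in>A. U) = UNIV \<and>
     (\<forall>(U, c)\<in>A. open U \<and> open (c ` U) \<and> homeomorphism U (c ` U) c (inv_into U c)) \<and>
     (\<forall>(U, c)\<in>A. \<forall>(V, d)\<in>A.
        smooth_on (c ` (U \<inter> V)) (d \<circ> inv_into U c) \<and>
        (\<forall>x\<in>U \<inter> V. det (matrix (frechet_derivative (d \<circ> inv_into U c) (at (c x)))) > 0))"

definition smooth_map_on :: "'m atlas \<Rightarrow> 'm set \<Rightarrow> ('m \<Rightarrow> 'b::real_normed_vector) \<Rightarrow> bool" where
  "smooth_map_on A U f \<longleftrightarrow> (\<forall>(V, c)\<in>A. smooth_on (c ` (U \<inter> V)) (f \<circ> inv_into V c))"

definition smooth_functions :: "'m atlas \<Rightarrow> ('m \<Rightarrow> real) set" where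
  "smooth_functions A = {f. smooth_map_on A UNIV f}"

text \<open>Tangent vectors at \<open>q\<close> are the derivations at \<open>q\<close> of the algebra of smooth functions.  They are
  extended by zero to all functions, so that equality of tangent vectors is equality in HOL.\<close>

type_synonym 'm tangent = "('m \<Rightarrow> real) \<Rightarrow> real"

definition tangent_space :: "'m atlas \<Rightarrow> 'm \<Rightarrow> 'm tangent set" where
  "tangent_space A q = {X. linear_on_set (smooth_functions A) X \<and>
     (\<forall>f\<in>smooth_functions A. \<forall>h\<in>smooth_functions A. X (f * h) = f q * X h + h q * X f) \<and>
     (\<forall>f. f \<notin> smooth_functions A \<longrightarrow> X f = 0)}"

type_synonym 'm vector_field = "'m \<Rightarrow> 'm tangent"

definition vector_fields :: "'m atlas \<Rightarrow> 'm vector_field set" where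
  "vector_fields A = {X. (\<forall>q. X q \<in> tangent_space A q) \<and>
     (\<forall>f\<in>smooth_functions A. (\<lambda>q. X q f) \<in> smooth_functions A)}"

definition fun_scale :: "('m \<Rightarrow> real) \<Rightarrow> 'm vector_field \<Rightarrow> 'm vector_field" where
  "fun_scale f X = (\<lambda>q. f q *\<^sub>R X q)"

definition vf_bracket :: "'m vector_field \<Rightarrow> 'm vector_field \<Rightarrow> 'm vector_field" where
  "vf_bracket X Y = (\<lambda>q f. X q (\<lambda>x. Y x f) - Y q (\<lambda>x. X x f))"

type_synonym 'm dform = "'m \<Rightarrow> 'm tangent list \<Rightarrow> real"

definition diff_form :: "'m atlas \<Rightarrow> nat \<Rightarrow> 'm dform \<Rightarrow> bool" where
  "diff_form A k \<phi> \<longleftrightarrow> (\<forall>q. alt_form (tangent_space A q) k (\<phi> q)) \<and>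
     (\<forall>Xs. set Xs \<subseteq> vector_fields A \<longrightarrow>
        (\<lambda>q. \<phi> q (map (\<lambda>X. X q) Xs)) \<in> smooth_functions A)"

text \<open>A coframe at \<open>q\<close> is given by the isomorphism of the tangent space with a model space \<open>'w\<close> of
  which its members are the components.  It is extended by zero to all functions.\<close>

definition coframe :: "'m atlas \<Rightarrow> 'm \<Rightarrow> ('m tangent \<Rightarrow> 'w::real_vector) \<Rightarrow> bool" where
  "coframe A q e \<longleftrightarrow> linear_on_set (tangent_space A q) e \<and>
     bij_betw e (tangent_space A q) UNIV \<and> (\<forall>X. X \<notin> tangent_space A q \<longrightarrow> e X = 0)"

definition smooth_coframe_on ::
    "'m atlas \<Rightarrow> 'm set \<Rightarrow> ('m \<Rightarrow> 'm tangent \<Rightarrow> 'w::real_normed_vector) \<Rightarrow> bool" where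
  "smooth_coframe_on A U \<theta> \<longleftrightarrow> (\<forall>x\<in>U. coframe A x (\<theta> x)) \<and>
     (\<forall>X\<in>vector_fields A. smooth_map_on A U (\<lambda>x. \<theta> x (X x)))"


section \<open>Lorentzian metrics, time and spin structures\<close>

type_synonym 'm metric = "'m \<Rightarrow> 'm tangent \<Rightarrow> 'm tangent \<Rightarrow> real"

definition minkowski :: "real \<times> (real^9) \<Rightarrow> real \<times> (real^9) \<Rightarrow> real" where
  "minkowski u v = - (fst u * fst v) + snd u \<bullet> snd v"

definition lorentzian_metric :: "'m atlas \<Rightarrow> 'm metric \<Rightarrow> bool" where
  "lorentzian_metric A g \<longleftrightarrow>
     (\<forall>q. \<exists>\<theta>. coframe A q \<theta> \<and>
        (\<forall>X\<in>tangent_space A q. \<forall>Y\<in>tangent_space A q. g q X Y = minkowski (\<theta> X) (\<theta> Y))) \<and>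
     (\<forall>X\<in>vector_fields A. \<forall>Y\<in>vector_fields A. (\<lambda>q. g q (X q) (Y q)) \<in> smooth_functions A)"

definition time_orientation :: "'m atlas \<Rightarrow> 'm metric \<Rightarrow> 'm vector_field \<Rightarrow> bool" where
  "time_orientation A g T \<longleftrightarrow> T \<in> vector_fields A \<and> (\<forall>q. g q (T q) (T q) < 0)"

text \<open>The identity component of \<open>Spin(9,1)\<close>, where \<open>\<gamma>\<close> is the real (Majorana) representation of
  the Clifford algebra.\<close>

definition majorana_rep :: "(real \<times> (real^9) \<Rightarrow> real^32^32) \<Rightarrow> bool" where
  "majorana_rep \<gamma> \<longleftrightarrow> linear \<gamma> \<and> (\<forall>u. \<gamma> u ** \<gamma> u = minkowski u u *\<^sub>R mat 1)"

inductive_set Spin91 :: "(real \<times> (real^9) \<Rightarrow> real^32^32) \<Rightarrow> (real^32^32) set"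
  for \<gamma> where
  "mat 1 \<in> Spin91 \<gamma>"
| "s \<in> Spin91 \<gamma> \<Longrightarrow> minkowski u u = minkowski v v \<Longrightarrow> \<bar>minkowski u u\<bar> = 1 \<Longrightarrow>
     \<gamma> u ** \<gamma> v ** s \<in> Spin91 \<gamma>"

text \<open>A cocycle of spin transition functions \<open>S\<close> that lifts the transition functions of a family \<open>C\<close>
  of local orthonormal coframes.\<close>

definition spin_manifold :: "'m::topological_space atlas \<Rightarrow> 'm metric \<Rightarrow> bool" where
  "spin_manifold A g \<longleftrightarrow> (\<exists>\<gamma> C S. majorana_rep \<gamma> \<and>
     (\<Union>(U, \<theta>)\<in>C. U) = UNIV \<and>
     (\<forall>(U, \<theta>)\<in>C. open U \<and> smooth_coframe_on A U \<theta> \<and>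
        (\<forall>x\<in>U. \<forall>X\<in>tangent_space A x. \<forall>Y\<in>tangent_space A x.
           g x X Y = minkowski (\<theta> x X) (\<theta> x Y))) \<and>
     (\<forall>a\<in>C. \<forall>b\<in>C. continuous_on (fst a \<inter> fst b) (S a b) \<and>
        (\<forall>x\<in>fst a \<inter> fst b. S a b x \<in> Spin91 \<gamma> \<and>
           (\<forall>X\<in>tangent_space A x. \<gamma> (snd a x X) ** S a b x = S a b x ** \<gamma> (snd b x X)))) \<and>
     (\<forall>a\<in>C. \<forall>b\<in>C. \<forall>c\<in>C. \<forall>x\<in>fst a \<inter> fst b \<inter> fst c. S a b x ** S b c x = S a c x))"


section \<open>Connections with skew-symmetric torsion, parallelism and holonomy\<close>

type_synonym 'm connection = "'m vector_field \<Rightarrow> 'm vector_field \<Rightarrow> 'm vector_field"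

definition levi_civita :: "'m atlas \<Rightarrow> 'm metric \<Rightarrow> 'm connection \<Rightarrow> bool" where
  "levi_civita A g nabla \<longleftrightarrow>
     (\<forall>X\<in>vector_fields A. \<forall>Y\<in>vector_fields A. \<forall>Z\<in>vector_fields A. \<forall>f\<in>smooth_functions A.
        nabla X Y \<in> vector_fields A \<and>
        nabla (X + Y) Z = nabla X Z + nabla Y Z \<and>
        nabla (fun_scale f X) Y = fun_scale f (nabla X Y) \<and>
        nabla X (Y + Z) = nabla X Y + nabla X Z \<and>
        nabla X (fun_scale f Y) = fun_scale (\<lambda>q. X q f) Y + fun_scale f (nabla X Y) \<and>
        nabla X Y - nabla Y X = vf_bracket X Y \<and>
        (\<forall>q. X q (\<lambda>x. g x (Y x) (Z x)) = g q (nabla X Y q) (Z q) + g q (Y q) (nabla X Z q)))"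

text \<open>The vector metrically dual to the one-form \<open>\<theta>\<close> at \<open>q\<close>.\<close>

definition sharp :: "'m atlas \<Rightarrow> 'm metric \<Rightarrow> 'm \<Rightarrow> ('m tangent list \<Rightarrow> real) \<Rightarrow> 'm tangent" where
  "sharp A g q \<theta> =
     (THE w. w \<in> tangent_space A q \<and> (\<forall>z\<in>tangent_space A q. g q z w = \<theta> [z]))"

definition torsion_connection ::
    "'m atlas \<Rightarrow> 'm metric \<Rightarrow> 'm dform \<Rightarrow> 'm connection \<Rightarrow> 'm connection" where
  "torsion_connection A g H nabla X Y =
     (\<lambda>q. nabla X Y q + (1/2) *\<^sub>R sharp A g q (\<lambda>zs. H q (zs @ [X q, Y q])))"

text \<open>\<open>X (\<phi>(Y\<^sub>1,\<dots>,Y\<^sub>n)) = \<Sum>\<^sub>i \<phi>(Y\<^sub>1,\<dots>,D\<^sub>X Y\<^sub>i,\<dots>,Y\<^sub>n)\<close>\<close>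

definition parallel_form :: "'m atlas \<Rightarrow> 'm connection \<Rightarrow> 'm dform \<Rightarrow> bool" where
  "parallel_form A D \<phi> \<longleftrightarrow>
     (\<forall>X\<in>vector_fields A. \<forall>Ys. set Ys \<subseteq> vector_fields A \<longrightarrow>
        (\<forall>q. X q (\<lambda>x. \<phi> x (map (\<lambda>Y. Y x) Ys)) =
          (\<Sum>i<length Ys. \<phi> q ((map (\<lambda>Y. Y q) Ys)[i := D X (Ys ! i) q]))))"

definition smooth_curve :: "'m atlas \<Rightarrow> (real \<Rightarrow> 'm) \<Rightarrow> bool" where
  "smooth_curve A c \<longleftrightarrow> (\<forall>f\<in>smooth_functions A. smooth_on UNIV (f \<circ> c))"

definition velocity :: "'m atlas \<Rightarrow> (real \<Rightarrow> 'm) \<Rightarrow> real \<Rightarrow> 'm tangent" where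
  "velocity A c t f = (if f \<in> smooth_functions A then deriv (f \<circ> c) t else 0)"

text \<open>A field \<open>E\<close> of coframes along \<open>c\<close> is parallel if each of its members \<open>\<epsilon>\<close> satisfies
  \<open>(\<epsilon>(W))' = \<epsilon>(D\<^sub>X W)\<close> for all vector fields \<open>W\<close>, where \<open>X\<close> is any vector field that extends
  the velocity of \<open>c\<close> at the given point.\<close>

definition parallel_coframe_along ::
    "'m atlas \<Rightarrow> 'm connection \<Rightarrow> (real \<Rightarrow> 'm) \<Rightarrow>
     (real \<Rightarrow> 'm tangent \<Rightarrow> 'w::real_normed_vector) \<Rightarrow> bool" where
  "parallel_coframe_along A D c E \<longleftrightarrow>
     (\<forall>t\<in>{0..1}. coframe A (c t) (E t)) \<and>
     (\<forall>t\<in>{0..1}. \<forall>X\<in>vector_fields A. \<forall>W\<in>vector_fields A. X (c t) = velocity A c t \<longrightarrow>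
        ((\<lambda>s. E s (W (c s))) has_vector_derivative E t (D X W (c t))) (at t within {0..1}))"

definition transport_step ::
    "'m atlas \<Rightarrow> 'm connection \<Rightarrow> 'm \<times> ('m tangent \<Rightarrow> 'w::real_normed_vector) \<Rightarrow>
     'm \<times> ('m tangent \<Rightarrow> 'w) \<Rightarrow> bool" where
  "transport_step A D a b \<longleftrightarrow>
     (\<exists>c E. smooth_curve A c \<and> parallel_coframe_along A D c E \<and>
            a = (c 0, E 0) \<and> b = (c 1, E 1))"

text \<open>Parallel transport along piecewise smooth curves.\<close>

definition transport ::
    "'m atlas \<Rightarrow> 'm connection \<Rightarrow> 'm \<times> ('m tangent \<Rightarrow> 'w::real_normed_vector) \<Rightarrow>
     'm \<times> ('m tangent \<Rightarrow> 'w) \<Rightarrow> bool" where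
  "transport A D = (transport_step A D)\<^sup>*\<^sup>*"

text \<open>The holonomy group at \<open>p\<close>, as a group of transformations of the model space by means of the
  coframe \<open>e\<close> at \<open>p\<close>.\<close>

definition holonomy_group ::
    "'m atlas \<Rightarrow> 'm connection \<Rightarrow> 'm \<Rightarrow> ('m tangent \<Rightarrow> 'w::real_normed_vector) \<Rightarrow> ('w \<Rightarrow> 'w) set"
  where "holonomy_group A D p e = {h. transport A D (p, e) (p, h \<circ> e)}"


section \<open>Heterotic backgrounds with non-compact holonomy\<close>

text \<open>An adapted coframe takes values in \<^typ>\<open>real \<times> real \<times> 'v\<close>, its components being
  \<open>e\<^sup>-\<close>, \<open>e\<^sup>+\<close> and \<open>(e\<^sup>i)\<close>.\<close>

definition e_minus :: "('t \<Rightarrow> real \<times> real \<times> 'v) \<Rightarrow> 't \<Rightarrow> real" where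
  "e_minus e X = fst (e X)"

definition e_plus :: "('t \<Rightarrow> real \<times> real \<times> 'v) \<Rightarrow> 't \<Rightarrow> real" where
  "e_plus e X = fst (snd (e X))"

definition e_transverse :: "('t \<Rightarrow> real \<times> real \<times> 'v) \<Rightarrow> 't \<Rightarrow> 'v" where
  "e_transverse e X = snd (snd (e X))"

text \<open>\<open>K \<ltimes> \<real>\<^sup>8\<close>: the transformations
  \<open>e\<^sup>- \<mapsto> e\<^sup>-\<close>, \<open>e\<^sup>+ \<mapsto> e\<^sup>+ - w\<^sub>i e\<^sup>i - \<onehalf> |w|\<^sup>2 e\<^sup>-\<close>, \<open>e \<mapsto> k (e + w e\<^sup>-)\<close>.\<close>

definition semidirect ::
    "('v::euclidean_space \<Rightarrow> 'v) set \<Rightarrow> (real \<times> real \<times> 'v \<Rightarrow> real \<times> real \<times> 'v) set" where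
  "semidirect K =
     {(\<lambda>(a, b, v). (a, b - w \<bullet> v - (w \<bullet> w) / 2 * a, k (v + a *\<^sub>R w))) | k w. k \<in> K}"

locale heterotic_background =
  fixes A :: "'m::{t2_space, second_countable_topology} atlas"
    and g :: "'m metric"
    and H :: "'m dform"
    and nabla :: "'m connection"
    and \<kappa> :: "'m dform"
    and K :: "('v::euclidean_space \<Rightarrow> 'v) set"
    and adapted :: "'m \<Rightarrow> ('m tangent \<Rightarrow> real \<times> real \<times> 'v) set"
  assumes oriented: "oriented_smooth_atlas A"
    and simply_connected: "simply_connected (UNIV :: 'm set)"
    and lorentzian: "lorentzian_metric A g"
    and time_oriented: "\<exists>T. time_orientation A g T"
    and spin: "spin_manifold A g"
    and levi_civita: "levi_civita A g nabla"
    and three_form: "diff_form A 3 H"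
    and kappa_form: "diff_form A 1 \<kappa>"
    and kappa_nonzero: "\<And>q. \<kappa> q \<noteq> 0"
    and kappa_null: "\<And>q. \<kappa> q [sharp A g q (\<kappa> q)] = 0"
    and kappa_parallel: "parallel_form A (torsion_connection A g H nabla) \<kappa>"
    and adapted_coframe: "\<And>q e. e \<in> adapted q \<Longrightarrow> coframe A q e"
    and adapted_metric: "\<And>q e X Y. e \<in> adapted q \<Longrightarrow> X \<in> tangent_space A q \<Longrightarrow>
        Y \<in> tangent_space A q \<Longrightarrow>
        g q X Y = e_minus e X * e_plus e Y + e_plus e X * e_minus e Y
                  + e_transverse e X \<bullet> e_transverse e Y"
    and adapted_kappa: "\<And>q e. e \<in> adapted q \<Longrightarrow> one_form (e_minus e) = \<kappa> q"
    and adapted_local: "\<And>q. \<exists>U \<theta>. open U \<and> q \<in> U \<and> smooth_coframe_on A U \<theta> \<and>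
        (\<forall>x\<in>U. \<theta> x \<in> adapted x)"
    and adapted_related: "\<And>q e. e \<in> adapted q \<Longrightarrow> adapted q = (\<lambda>h. h \<circ> e) ` semidirect K"
    and adapted_parallel: "\<And>p q e e'. e \<in> adapted p \<Longrightarrow>
        transport A (torsion_connection A g H nabla) (p, e) (q, e') \<Longrightarrow> e' \<in> adapted q"
    and holonomy: "\<And>p e. e \<in> adapted p \<Longrightarrow>
        holonomy_group A (torsion_connection A g H nabla) p e = semidirect K"


section \<open>The algebra of fundamental forms\<close>

text \<open>The null form \<open>e\<^sup>- \<and> \<alpha>\<close> at a point, for a form \<open>\<alpha>\<close> in the \<open>e\<^sup>i\<close>.\<close>

definition null_form ::
    "('t \<Rightarrow> real \<times> real \<times> 'v::euclidean_space) \<Rightarrow> ('v list \<Rightarrow> real) \<Rightarrow> 't list \<Rightarrow> real" where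
  "null_form e \<alpha> = wedge (one_form (e_minus e)) (pullback (e_transverse e) \<alpha>)"

definition breve ::
    "('t \<Rightarrow> real \<times> real \<times> 'v::euclidean_space) \<Rightarrow> ('t list \<Rightarrow> real) \<Rightarrow> 'v list \<Rightarrow> real" where
  "breve e \<phi> = (THE \<alpha>. \<alpha> \<in> exterior_algebra UNIV \<and> \<phi> = null_form e \<alpha>)"

text \<open>The bracket on null forms.  It does not depend on the choice of the adapted coframe, as
  the contraction is invariant under the orthogonal group.\<close>

definition null_bracket ::
    "('m \<Rightarrow> ('m tangent \<Rightarrow> real \<times> real \<times> 'v::euclidean_space) set) \<Rightarrow>
     'm dform \<Rightarrow> 'm dform \<Rightarrow> 'm dform" where
  "null_bracket adapted \<psi> \<phi> q =
     (let e = (SOME e. e \<in> adapted q)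
      in null_form e (contraction (breve e (\<psi> q)) (breve e (\<phi> q))))"

text \<open>\<open>\<phi>\<close> is the same combination \<open>e\<^sup>- \<and> \<alpha>\<close> of the members of every adapted coframe.  Such a
  form exists precisely for \<open>K\<close>-invariant \<open>\<alpha>\<close>, and it is parallel, because the set of adapted
  coframes is.\<close>

definition represented_by ::
    "('m \<Rightarrow> ('m tangent \<Rightarrow> real \<times> real \<times> 'v::euclidean_space) set) \<Rightarrow>
     'm dform \<Rightarrow> ('v list \<Rightarrow> real) \<Rightarrow> bool" where
  "represented_by adapted \<phi> \<alpha> \<longleftrightarrow> (\<forall>q. \<forall>e\<in>adapted q. \<phi> q = null_form e \<alpha>)"

definition fundamental_forms ::
    "('m \<Rightarrow> ('m tangent \<Rightarrow> real \<times> real \<times> 'v::euclidean_space) set) \<Rightarrow>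
     'm dform \<Rightarrow> ('v list \<Rightarrow> real) set \<Rightarrow> 'm dform set" where
  "fundamental_forms adapted \<kappa> B = insert \<kappa> {\<phi>. \<exists>\<alpha>\<in>B. represented_by adapted \<phi> \<alpha>}"

definition reduced_algebra ::
    "('m \<Rightarrow> ('m tangent \<Rightarrow> real \<times> real \<times> 'v::euclidean_space) set) \<Rightarrow>
     'm dform \<Rightarrow> ('v list \<Rightarrow> real) set \<Rightarrow> 'm dform set" where
  "reduced_algebra adapted \<kappa> B =
     lie_closure (null_bracket adapted) (fundamental_forms adapted \<kappa> B - {\<kappa>})"

end

theory Submission
  imports Defs
begin

text \<open>
  A null form \<open>e\<^sup>- \<and> \<alpha>\<close> is determined by the form \<open>\<alpha>\<close> on the transverse space \<open>\<real>\<^sup>8\<close>, and the bracket of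
  null forms is the contraction of their representatives.  If \<open>\<alpha>\<close> is invariant under \<open>K\<close>, then
  \<open>e\<^sup>- \<and> \<alpha>\<close> is the same for all adapted coframes, since the translations in \<open>K \<ltimes> \<real>\<^sup>8\<close> only add
  multiples of \<open>e\<^sup>-\<close> to the transverse coframe (\<open>null_form_semidirect\<close>).  Hence
  the algebra of the fundamental forms is isomorphic to the algebra that their representatives
  generate under contraction (\<open>reduced_algebra_isomorphic\<close>).

  A two-form is the same as a skew operator, and the contraction of two-forms is the commutator of
  operators up to sign (\<open>contraction_op_form\<close>).  The \<open>K\<close>-invariant two-forms correspond to the skew
  operators that commute with \<open>K\<close>, so five of the seven cases amount to the computation of a Lie
  algebra of operators.  It is all of \<open>so(8)\<close> for the trivial group and the complex linear part
  \<open>u(4)\<close> for \<open>U(1)\<close>.  The operators that commute with \<open>Sp(1)\<close> acting from the left on \<open>\<bbbH>\<^sup>2\<close> are the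
  skew-Hermitian quaternionic matrices acting from the right, an algebra that the spin representation
  identifies with \<open>so(5)\<close>.  The diagonal matrices among them belong to \<open>Sp(1) \<times> Sp(1)\<close>, and the
  scalar ones to \<open>Sp(2)\<close>.

  For \<open>Spin(7)\<close> there is a single form, of even degree, and its contraction with itself is a sum of
  squares of forms of odd degree, which vanish (\<open>single_form_algebra\<close>).

  For \<open>SU(4)\<close>, contraction with the Hermitian form \<open>\<omega>\<close> is the action of the complex structure as a
  derivation.  It multiplies the \<open>(4,0)\<close> form \<open>\<Omega>\<close> by \<open>4\<i>\<close>, so \<open>J = \<omega>/4\<close> rotates \<open>P\<^sub>1 = Re \<Omega>\<close> and
  \<open>P\<^sub>2 = Im \<Omega>\<close>.  The contraction \<open>Z\<close> of \<open>P\<^sub>1\<close> with \<open>P\<^sub>2\<close> is a new form of degree six.  It commutes with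
  \<open>J\<close> because the derivation turns it into squares of \<open>P\<^sub>1\<close> and \<open>P\<^sub>2\<close>; it commutes with \<open>P\<^sub>1\<close> and \<open>P\<^sub>2\<close>
  because their brackets with it have top degree, where the complex structure acts by its trace,
  which is zero, while it rotates these two brackets into each other (\<open>volume_bracket_central\<close>).
  It is not zero, as an evaluation shows, and the four forms are linearly independent.

  The exterior calculus rests on the fact that the interior product is an antiderivation
  (\<open>wedge_Cons\<close>).  It makes the exterior product a recursion on the list of arguments, by which
  alternation, commutativity and the derivation property are proved by induction.
\<close>

section \<open>The exterior product as a recursion\<close>

text \<open>Only the parity of the degree enters the signs of the exterior calculus.  Unlike the degree it
  can be tracked without a case distinction when an interior product kills a form of degree zero,
  which is why \<open>parity_interior\<close> below counts upwards.\<close>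

definition parity :: "nat \<Rightarrow> ('a list \<Rightarrow> 'c::zero) \<Rightarrow> bool" where
  "parity p \<alpha> \<longleftrightarrow> (\<forall>xs. \<alpha> xs \<noteq> 0 \<longrightarrow> even (length xs + p))"

lemma parity_interior: "parity p \<alpha> \<Longrightarrow> parity (Suc p) (interior_product x \<alpha>)"
  by (auto simp: parity_def interior_product_def dest: spec[of _ "x # _"])

lemma parity_one_form: "parity 1 (one_form \<theta>)"
  by (auto simp: parity_def one_form_def split: list.splits)

lemma parity_alt_form: "alt_form S p \<alpha> \<Longrightarrow> parity p \<alpha>"
  by (auto simp: parity_def alt_form_def)

lemma wedge_Nil [simp]: "wedge \<alpha> \<beta> [] = \<alpha> [] * \<beta> []"
  by (simp add: wedge_def)

lemma Pow_lessThan_Suc: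
  "Pow {..<Suc n} = (\<lambda>B. insert 0 (Suc ` B)) ` Pow {..<n} \<union> (\<lambda>B. Suc ` B) ` Pow {..<n}"
  by (simp add: lessThan_Suc_eq_insert_0 Pow_insert image_Pow_surj[symmetric] image_image Un_commute)

text \<open>The interior product is an antiderivation: among the shuffles of \<open>x # xs\<close>, those that give \<open>x\<close>
  to the first factor yield the first summand, and those that give it to the second factor move \<open>x\<close>
  past all arguments of the first one.  The rule turns the exterior product into a recursion on the
  list of arguments, which replaces sums over shuffles in inductive proofs.\<close>

lemma wedge_Cons:
  fixes \<alpha> \<beta> :: "'a list \<Rightarrow> 'c::comm_ring_1"
  assumes "parity p \<alpha>"
  shows "wedge \<alpha> \<beta> (x # xs) =
    wedge (interior_product x \<alpha>) \<beta> xs + (- 1) ^ p * wedge \<alpha> (interior_product x \<beta>) xs"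
proof -
  define n where "n = length xs"
  define inv where "inv m A = {(i, j). i \<in> A \<and> j \<in> {..<m} - A \<and> j < i}" for m and A :: "nat set"
  define t where "t A = (- 1) ^ card (inv (Suc n) A)
          * \<alpha> (nths (x # xs) A) * \<beta> (nths (x # xs) (- A))" for A
  have inj_card: "card (map_prod Suc Suc ` C) = card C" for C
    by (intro card_image inj_on_subset[OF prod.inj_map]) auto
  have inv1: "card (inv (Suc n) (insert 0 (Suc ` B))) = card (inv n B)" for B
  proof -
    have "inv (Suc n) (insert 0 (Suc ` B)) = map_prod Suc Suc ` inv n B"
      by (auto simp: inv_def image_iff lessThan_Suc_eq_insert_0)
    then show ?thesis
      by (simp add: inj_card)
  qed
  \<comment> \<open>The index \<open>0\<close> of \<open>x\<close> now lies in the complement and forms an inversion with every element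
    of \<open>Suc ` B\<close>.\<close>
  have inv2: "card (inv (Suc n) (Suc ` B)) = card (inv n B) + card B" if "B \<subseteq> {..<n}" for B
  proof -
    have fB: "finite B" using that finite_subset by blast
    have "finite (inv n B)"
      by (rule finite_subset[of _ "B \<times> {..<n}"]) (auto simp: inv_def fB)
    moreover have "inv (Suc n) (Suc ` B) = map_prod Suc Suc ` inv n B \<union> (\<lambda>b. (Suc b, 0)) ` B"
      by (auto simp: inv_def image_iff lessThan_Suc_eq_insert_0)
    moreover have "map_prod Suc Suc ` inv n B \<inter> (\<lambda>b. (Suc b, 0)) ` B = {}"
      by auto
    ultimately show ?thesis
      by (simp add: card_Un_disjoint inj_card card_image inj_on_def fB)
  qed
  have n1: "nths (x # xs) (insert 0 (Suc ` B)) = x # nths xs B"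
    "nths (x # xs) (- insert 0 (Suc ` B)) = nths xs (- B)"
    "nths (x # xs) (Suc ` B) = nths xs B"
    "nths (x # xs) (- Suc ` B) = x # nths xs (- B)" for B
  proof -
    have *: "{j. Suc j \<in> Suc ` B} = B" "{j. Suc j \<in> - Suc ` B} = - B" by auto
    show "nths (x # xs) (insert 0 (Suc ` B)) = x # nths xs B"
    "nths (x # xs) (- insert 0 (Suc ` B)) = nths xs (- B)"
    "nths (x # xs) (Suc ` B) = nths xs B"
    "nths (x # xs) (- Suc ` B) = x # nths xs (- B)" 
      using * by (auto simp: nths_Cons)
  qed
  have t1: "t (insert 0 (Suc ` B)) = (- 1) ^ card (inv n B)
      * interior_product x \<alpha> (nths xs B) * \<beta> (nths xs (- B))" for B
    unfolding t_def inv1 n1 interior_product_def ..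
  have t2: "t (Suc ` B) = (- 1) ^ p * ((- 1) ^ card (inv n B)
      * \<alpha> (nths xs B) * interior_product x \<beta> (nths xs (- B)))" if "B \<subseteq> {..<n}" for B
  proof (cases "\<alpha> (nths xs B) = 0")
    case False
    have "{i. i < length xs \<and> i \<in> B} = B" using that by (auto simp: n_def)
    then have "even (card B + p)"
      using assms False unfolding parity_def by (auto simp: length_nths)
    then have "(- 1) ^ card B = ((- 1) ^ p :: 'c)"
      by (auto simp: minus_one_power_iff)
    then show ?thesis
      unfolding t_def inv2[OF that] n1 interior_product_def power_add by (simp add: mult_ac)
  qed (simp add: t_def n1)
  have "wedge \<alpha> \<beta> (x # xs) = sum t (Pow {..<Suc n})"
    unfolding wedge_def t_def inv_def n_def by simp
  also have "\<dots> = sum t ((\<lambda>B. insert 0 (Suc ` B)) ` Pow {..<n}) + sum t ((\<lambda>B. Suc ` B) ` Pow {..<n})"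
    unfolding Pow_lessThan_Suc by (rule sum.union_disjoint) auto
  also have "sum t ((\<lambda>B. insert 0 (Suc ` B)) ` Pow {..<n})
      = (\<Sum>B\<in>Pow {..<n}. t (insert 0 (Suc ` B)))"
    by (rule sum.reindex_cong[OF _ refl refl]) (auto simp: inj_on_def insert_ident)
  also have "\<dots> = wedge (interior_product x \<alpha>) \<beta> xs"
    unfolding wedge_def t1 inv_def n_def ..
  also have "sum t ((\<lambda>B. Suc ` B) ` Pow {..<n}) = (\<Sum>B\<in>Pow {..<n}. t (Suc ` B))"
    by (rule sum.reindex_cong[OF _ refl refl]) (auto simp: inj_on_def inj_image_eq_iff)
  also have "\<dots> = (- 1) ^ p * wedge \<alpha> (interior_product x \<beta>) xs"
    unfolding wedge_def sum_distrib_left n_def[symmetric]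
    by (rule sum.cong[OF refl]) (simp add: t2 inv_def)
  finally show ?thesis .
qed

lemma wedge_zero_left [simp]: "wedge (\<lambda>_. 0) \<beta> = (\<lambda>_. 0)"
  by (simp add: wedge_def fun_eq_iff)

lemma wedge_zero_right [simp]: "wedge \<alpha> (\<lambda>_. 0) = (\<lambda>_. 0)"
  by (simp add: wedge_def fun_eq_iff)

lemma wedge_add_left: "wedge (\<lambda>ys. \<alpha> ys + \<alpha>' ys) \<beta> xs = wedge \<alpha> \<beta> xs + wedge \<alpha>' \<beta> xs"
  by (simp add: wedge_def algebra_simps sum.distrib)

lemma wedge_add_right: "wedge \<alpha> (\<lambda>ys. \<beta> ys + \<beta>' ys) xs = wedge \<alpha> \<beta> xs + wedge \<alpha> \<beta>' xs"
  by (simp add: wedge_def algebra_simps sum.distrib)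

lemma wedge_mult_left: "wedge (\<lambda>ys. c * \<alpha> ys) \<beta> xs = c * wedge \<alpha> \<beta> xs"
  by (simp add: wedge_def sum_distrib_left mult_ac)

lemma wedge_mult_right: "wedge \<alpha> (\<lambda>ys. c * \<beta> ys) xs = c * wedge \<alpha> \<beta> xs"
  by (simp add: wedge_def sum_distrib_left mult_ac)

text \<open>The recursion treats both factors alike up to signs, so the sign of an interchange is found by
  induction on the arguments.\<close>

lemma wedge_commute:
  fixes \<alpha> \<beta> :: "'a list \<Rightarrow> 'c::comm_ring_1"
  assumes "parity p \<alpha>" "parity q \<beta>"
  shows "wedge \<beta> \<alpha> xs = (- 1) ^ (p * q) * wedge \<alpha> \<beta> xs"
  using assms
proof (induction xs arbitrary: p q \<alpha> \<beta>)
  case Nil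
  then show ?case
    by (cases "\<alpha> [] = 0"; cases "\<beta> [] = 0") (auto simp: parity_def mult.commute dest!: spec[of _ "[]"])
next
  case (Cons x xs)
  have "wedge (interior_product x \<beta>) \<alpha> xs = (- 1) ^ (p * Suc q) * wedge \<alpha> (interior_product x \<beta>) xs"
    "wedge \<beta> (interior_product x \<alpha>) xs = (- 1) ^ (Suc p * q) * wedge (interior_product x \<alpha>) \<beta> xs"
    using Cons by (blast intro: parity_interior)+
  then show ?case
    by (simp add: wedge_Cons[OF Cons.prems(1)] wedge_Cons[OF Cons.prems(2)] power_add algebra_simps
        flip: power_mult_distrib)
qed

section \<open>Alternating forms\<close>

lemma alt_form_0_iff: "alt_form UNIV 0 \<alpha> \<longleftrightarrow> (\<forall>xs. xs \<noteq> [] \<longrightarrow> \<alpha> xs = 0)"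
  by (auto simp: alt_form_def) (metis distinct.simps(1))

lemma alt_form_degree: "alt_form UNIV k \<alpha> \<Longrightarrow> length xs \<noteq> k \<Longrightarrow> \<alpha> xs = 0"
  by (simp add: alt_form_def)

lemma alt_form_not_distinct: "alt_form UNIV k \<alpha> \<Longrightarrow> \<not> distinct xs \<Longrightarrow> \<alpha> xs = 0"
  by (simp add: alt_form_def)

lemma alt_form_linear:
  assumes "alt_form UNIV k \<alpha>"
  shows "\<alpha> (xs @ (a *\<^sub>R x + b *\<^sub>R y) # ys) = a *\<^sub>R \<alpha> (xs @ x # ys) + b *\<^sub>R \<alpha> (xs @ y # ys)"
proof (cases "length xs + Suc (length ys) = k")
  case True
  then show ?thesis using assms by (simp add: alt_form_def)
next
  case False
  then show ?thesis using assms by (simp add: alt_form_degree)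
qed

lemmas alt_form_linear_first = alt_form_linear[where xs = "[]", simplified]

lemma alt_form_add_first:
  "alt_form UNIV k \<alpha> \<Longrightarrow> \<alpha> ((x + y) # ys) = \<alpha> (x # ys) + \<alpha> (y # ys)"
  using alt_form_linear_first[of k \<alpha> 1 x 1 y ys] by simp

lemma alt_form_scaleR_first:
  "alt_form UNIV k \<alpha> \<Longrightarrow> \<alpha> ((a *\<^sub>R x) # ys) = a *\<^sub>R \<alpha> (x # ys)"
  using alt_form_linear_first[of k \<alpha> a x 0 x ys] by simp

lemma alt_form_linear_map: "alt_form UNIV k \<alpha> \<Longrightarrow> linear (\<lambda>x. \<alpha> (x # ys))"
  by (intro linearI alt_form_add_first alt_form_scaleR_first)

lemma alt_form_interior:
  assumes "alt_form UNIV k \<alpha>"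
  shows "alt_form UNIV (k - 1) (interior_product v \<alpha>)"
proof -
  have "interior_product v \<alpha> (xs @ (a *\<^sub>R x + b *\<^sub>R y) # ys)
      = a *\<^sub>R interior_product v \<alpha> (xs @ x # ys) + b *\<^sub>R interior_product v \<alpha> (xs @ y # ys)"
    for xs ys x y a b
    using alt_form_linear[OF assms, of "v # xs"] by (simp add: interior_product_def)
  moreover have "interior_product v \<alpha> xs = 0" if "length xs \<noteq> k - 1 \<or> \<not> distinct xs" for xs
    using that alt_form_degree[OF assms, of "v # xs"] alt_form_not_distinct[OF assms, of "v # xs"]
    by (auto simp: interior_product_def)
  ultimately show ?thesis
    by (auto simp: alt_form_def)
qed

lemma interior_alt_form_0: "alt_form UNIV 0 \<alpha> \<Longrightarrow> interior_product x \<alpha> = (\<lambda>_. 0)"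
  by (simp add: alt_form_0_iff interior_product_def fun_eq_iff)

lemma interior_twice:
  "alt_form UNIV k \<alpha> \<Longrightarrow> interior_product x (interior_product x \<alpha>) = (\<lambda>_. 0)"
  by (simp add: interior_product_def fun_eq_iff alt_form_not_distinct)

lemma interior_linear:
  "alt_form UNIV k \<alpha> \<Longrightarrow> interior_product (a *\<^sub>R x + b *\<^sub>R y) \<alpha>
    = (\<lambda>xs. a *\<^sub>R interior_product x \<alpha> xs + b *\<^sub>R interior_product y \<alpha> xs)"
  by (simp add: interior_product_def fun_eq_iff alt_form_linear_first)

text \<open>Polarisation of the vanishing on a repeated argument.\<close>

lemma swap_from_repeated:
  fixes F :: "'a::real_vector list \<Rightarrow> 'b::real_vector"
  assumes lin: "\<And>a b x y ys. F ((a *\<^sub>R x + b *\<^sub>R y) # ys) = a *\<^sub>R F (x # ys) + b *\<^sub>R F (y # ys)"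
    and lin2: "\<And>v a b x y ys.
      F (v # (a *\<^sub>R x + b *\<^sub>R y) # ys) = a *\<^sub>R F (v # x # ys) + b *\<^sub>R F (v # y # ys)"
    and rep: "\<And>x xs. F (x # x # xs) = 0"
  shows "F (x # y # xs) = - F (y # x # xs)"
proof -
  have "0 = F ((x + y) # (x + y) # xs)"
    by (simp add: rep)
  also have "\<dots> = F (x # y # xs) + F (y # x # xs)"
    using lin[of 1 x 1 y "(x + y) # xs"] lin2[of x 1 x 1 y xs] lin2[of y 1 x 1 y xs]
    unfolding scaleR_one by (simp add: rep)
  finally show ?thesis
    by (simp add: eq_neg_iff_add_eq_0)
qed

lemma alt_form_swap:
  assumes "alt_form UNIV k \<alpha>"
  shows "\<alpha> (x # y # xs) = - \<alpha> (y # x # xs)"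
  using alt_form_linear_first[OF assms] alt_form_linear[OF assms, of "[_]"]
  by (intro swap_from_repeated) (auto intro: alt_form_not_distinct[OF assms])

lemma interior_anticommute:
  "alt_form UNIV k \<alpha> \<Longrightarrow> interior_product x (interior_product y \<alpha>)
    = (\<lambda>xs. - interior_product y (interior_product x \<alpha>) xs)"
  unfolding interior_product_def fun_eq_iff using alt_form_swap[of k \<alpha>] by blast

text \<open>Alternation by induction on the degree: a repetition among the later arguments is covered by
  the interior products, and one that involves the first argument is moved to the front by
  polarisation.\<close>

lemma alt_form_SucI:
  fixes F :: "'a::real_vector list \<Rightarrow> 'c::real_vector"
  assumes Nil: "F [] = 0"
    and int: "\<And>x. alt_form UNIV k (interior_product x F)"
    and lin: "\<And>a b x y ys. F ((a *\<^sub>R x + b *\<^sub>R y) # ys) = a *\<^sub>R F (x # ys) + b *\<^sub>R F (y # ys)"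
    and rep: "\<And>x xs. F (x # x # xs) = 0"
  shows "alt_form UNIV (Suc k) F"
proof -
  have lin_Cons: "F (v # xs @ (a *\<^sub>R x + b *\<^sub>R y) # ys) = a *\<^sub>R F (v # xs @ x # ys) + b *\<^sub>R F (v # xs @ y # ys)"
    for v xs a b x y ys
    using alt_form_linear[OF int] by (simp add: interior_product_def)
  have "F (xs @ (a *\<^sub>R x + b *\<^sub>R y) # ys) = a *\<^sub>R F (xs @ x # ys) + b *\<^sub>R F (xs @ y # ys)"
    for xs a b x y ys
    by (cases xs) (simp_all add: lin lin_Cons)
  moreover have "F xs = 0" if "length xs \<noteq> Suc k" for xs
    using that Nil alt_form_degree[OF int] by (cases xs) (auto simp: interior_product_def)
  moreover have "F xs = 0" if "\<not> distinct xs" for xs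
  proof (cases xs)
    case (Cons x ys)
    have nd: "F (z # zs) = 0" if "\<not> distinct zs" for z zs
      using alt_form_not_distinct[OF int that] by (simp add: interior_product_def)
    show ?thesis
    proof (cases "distinct ys")
      case True
      then obtain us vs where ys: "ys = us @ x # vs"
        using \<open>\<not> distinct xs\<close> Cons by (auto dest: split_list)
      show ?thesis
      proof (cases us)
        case Nil
        then show ?thesis by (simp add: Cons ys rep)
      next
        case (Cons u us')
        have "F (x # u # us' @ x # vs) = - F (u # x # us' @ x # vs)"
          using lin lin_Cons[of _ "[]"] rep by (intro swap_from_repeated) auto
        also have "\<dots> = 0"
          by (simp add: nd)
        finally show ?thesis
          by (simp add: \<open>xs = x # ys\<close> ys Cons)
      qed
    qed (simp add: Cons nd)
  qed (use that in simp)
  ultimately show ?thesis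
    by (auto simp: alt_form_def)
qed

lemma alt_form_zero [simp]: "alt_form S k (\<lambda>_. 0)"
  by (simp add: alt_form_def)

lemma alt_form_add:
  "alt_form S k \<alpha> \<Longrightarrow> alt_form S k \<beta> \<Longrightarrow> alt_form S k (\<lambda>xs. \<alpha> xs + \<beta> xs)"
  by (simp add: alt_form_def scaleR_add_right)

lemma alt_form_sum:
  "(\<And>i. i \<in> I \<Longrightarrow> alt_form S k (\<alpha> i)) \<Longrightarrow> alt_form S k (\<lambda>xs. \<Sum>i\<in>I. \<alpha> i xs)"
  by (induction I rule: infinite_finite_induct) (auto intro: alt_form_add)

lemma alt_form_linear_comp:
  assumes "alt_form S k \<alpha>" "linear f"
  shows "alt_form S k (\<lambda>xs. f (\<alpha> xs))"
  using assms by (auto simp: alt_form_def linear_add linear_scale linear_0)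

lemma alt_form_mult:
  "alt_form S k \<alpha> \<Longrightarrow> alt_form S k (\<lambda>xs. (c :: 'c::real_algebra) * \<alpha> xs)"
  by (rule alt_form_linear_comp) (auto intro: linearI simp: distrib_left)

lemma alt_form_one_form:
  assumes "linear f"
  shows "alt_form UNIV 1 (one_form f)"
  using assms
  by (auto simp: alt_form_def one_form_def linear_add linear_scale split: list.splits)

lemma wedge_linear_left:
  fixes \<alpha> :: "'a list \<Rightarrow> 'c::{real_algebra_1, comm_ring_1}"
  shows "wedge (\<lambda>ys. a *\<^sub>R \<alpha> ys + b *\<^sub>R \<alpha>' ys) \<beta> xs = a *\<^sub>R wedge \<alpha> \<beta> xs + b *\<^sub>R wedge \<alpha>' \<beta> xs"
  unfolding wedge_add_left scaleR_conv_of_real wedge_mult_left ..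

lemma wedge_linear_right:
  fixes \<alpha> :: "'a list \<Rightarrow> 'c::{real_algebra_1, comm_ring_1}"
  shows "wedge \<alpha> (\<lambda>ys. a *\<^sub>R \<beta> ys + b *\<^sub>R \<beta>' ys) xs = a *\<^sub>R wedge \<alpha> \<beta> xs + b *\<^sub>R wedge \<alpha> \<beta>' xs"
  unfolding wedge_add_right scaleR_conv_of_real wedge_mult_right ..

text \<open>A double interior product with the same vector kills \<open>\<alpha> \<and> \<beta>\<close>, because the two mixed terms of
  the antiderivation rule cancel.\<close>

lemma alt_form_wedge:
  fixes \<alpha> \<beta> :: "'a::real_vector list \<Rightarrow> 'c::{real_algebra_1, comm_ring_1}"
  assumes "alt_form UNIV p \<alpha>" "alt_form UNIV q \<beta>"
  shows "alt_form UNIV (p + q) (wedge \<alpha> \<beta>)"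
  using assms
proof (induction "p + q" arbitrary: p q \<alpha> \<beta>)
  case 0
  then have \<alpha>: "alt_form UNIV 0 \<alpha>" and \<beta>: "alt_form UNIV 0 \<beta>"
    by auto
  have "wedge \<alpha> \<beta> (x # xs) = 0" for x xs
    by (simp add: wedge_Cons[OF parity_alt_form[OF \<alpha>]] interior_alt_form_0[OF \<alpha>] interior_alt_form_0[OF \<beta>])
  then show ?case
    using 0 by (auto simp: alt_form_0_iff neq_Nil_conv)
next
  case (Suc n)
  note \<alpha> = \<open>alt_form UNIV p \<alpha>\<close> and \<beta> = \<open>alt_form UNIV q \<beta>\<close>
  note wC = wedge_Cons[OF parity_alt_form[OF \<alpha>]]
  have "alt_form UNIV (Suc n) (wedge \<alpha> \<beta>)"
  proof (rule alt_form_SucI)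
    show "wedge \<alpha> \<beta> [] = 0"
      using Suc.hyps(2) alt_form_degree[OF \<alpha>, of "[]"] alt_form_degree[OF \<beta>, of "[]"]
      by (cases p) auto
    fix x
    have 1: "alt_form UNIV n (wedge (interior_product x \<alpha>) \<beta>)"
    proof (cases p)
      case 0
      then show ?thesis using \<alpha> by (simp add: interior_alt_form_0)
    next
      case (Suc p')
      then show ?thesis
        using Suc.hyps(1)[of p' q, OF _ _ \<beta>] alt_form_interior[OF \<alpha>] Suc.hyps(2) by simp
    qed
    have 2: "alt_form UNIV n (wedge \<alpha> (interior_product x \<beta>))"
    proof (cases q)
      case 0
      then show ?thesis using \<beta> by (simp add: interior_alt_form_0)
    next
      case (Suc q')
      then show ?thesis
        using Suc.hyps(1)[of p q', OF _ \<alpha>] alt_form_interior[OF \<beta>] Suc.hyps(2) by simp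
    qed
    have "interior_product x (wedge \<alpha> \<beta>)
        = (\<lambda>xs. wedge (interior_product x \<alpha>) \<beta> xs + (- 1) ^ p * wedge \<alpha> (interior_product x \<beta>) xs)"
      by (simp add: interior_product_def[of x "wedge \<alpha> \<beta>"] fun_eq_iff wC)
    then show "alt_form UNIV n (interior_product x (wedge \<alpha> \<beta>))"
      by (simp only:) (intro alt_form_add alt_form_mult 1 2)
    show "wedge \<alpha> \<beta> (x # x # xs) = 0" for xs
      by (simp add: wC wedge_Cons[OF parity_interior[OF parity_alt_form[OF \<alpha>]]]
        interior_twice[OF \<alpha>] interior_twice[OF \<beta>])
    show "wedge \<alpha> \<beta> ((a *\<^sub>R x + b *\<^sub>R y) # ys) = a *\<^sub>R wedge \<alpha> \<beta> (x # ys) + b *\<^sub>R wedge \<alpha> \<beta> (y # ys)"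
      for a b y ys
      by (simp add: wC interior_linear[OF \<alpha>] interior_linear[OF \<beta>] wedge_linear_left
        wedge_linear_right algebra_simps)
  qed
  then show ?case
    by (simp add: Suc.hyps(2))
qed

lemma alt_form_zero_on_Basis:
  fixes \<alpha> :: "'a::euclidean_space list \<Rightarrow> 'c::real_vector"
  assumes "alt_form UNIV k \<alpha>" "\<And>xs. set xs \<subseteq> Basis \<Longrightarrow> \<alpha> xs = 0"
  shows "\<alpha> xs = 0"
  using assms
proof (induction xs arbitrary: k \<alpha>)
  case (Cons x xs)
  have "\<alpha> (b # xs) = 0" if "b \<in> Basis" for b
    using Cons.IH[OF alt_form_interior[OF Cons.prems(1)], of b] Cons.prems(2) that
    by (simp add: interior_product_def)
  moreover have "\<alpha> (x # xs) = (\<Sum>b\<in>Basis. (x \<bullet> b) *\<^sub>R \<alpha> (b # xs))"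
    using linear_sum[OF alt_form_linear_map[OF Cons.prems(1)], of "\<lambda>b. (x \<bullet> b) *\<^sub>R b" Basis xs]
    by (simp add: euclidean_representation alt_form_scaleR_first[OF Cons.prems(1)])
  ultimately show ?case
    by simp
qed simp

section \<open>The contraction bracket\<close>

lemma sum_fun_apply: "(\<Sum>i\<in>I. f i) x = (\<Sum>i\<in>I. f i x)"
  by (induction I rule: infinite_finite_induct) auto

lemma scaleR_fun_apply: "(r *\<^sub>R f) x = r *\<^sub>R f x"
  by (simp add: scaleR_fun_def)

lemma contraction_apply:
  "contraction \<psi> \<phi> xs = (\<Sum>b\<in>Basis. wedge (interior_product b \<psi>) (interior_product b \<phi>) xs)"
  by (simp add: contraction_def sum_fun_apply)

lemma alt_form_contraction:
  assumes "alt_form UNIV p \<psi>" "alt_form UNIV q \<phi>"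
  shows "alt_form UNIV (p - 1 + (q - 1)) (contraction \<psi> \<phi>)"
proof -
  have "contraction \<psi> \<phi> = (\<lambda>xs. \<Sum>b\<in>Basis. wedge (interior_product b \<psi>) (interior_product b \<phi>) xs)"
    by (simp add: fun_eq_iff contraction_apply)
  then show ?thesis
    by (simp only:) (intro alt_form_sum alt_form_wedge alt_form_interior assms)
qed

lemma interior_product_linear_form:
  "interior_product v (a *\<^sub>R \<psi> + b *\<^sub>R \<psi>')
    = (\<lambda>xs. a *\<^sub>R interior_product v \<psi> xs + b *\<^sub>R interior_product v \<psi>' xs)"
  by (simp add: interior_product_def fun_eq_iff scaleR_fun_def)

lemma contraction_linear_left:
  "contraction (a *\<^sub>R \<psi> + b *\<^sub>R \<psi>') \<phi> = a *\<^sub>R contraction \<psi> \<phi> + b *\<^sub>R contraction \<psi>' \<phi>"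
  unfolding fun_eq_iff plus_fun_apply scaleR_fun_apply contraction_apply interior_product_linear_form
    wedge_linear_left sum.distrib scaleR_sum_right by blast

lemma contraction_linear_right:
  "contraction \<psi> (a *\<^sub>R \<phi> + b *\<^sub>R \<phi>') = a *\<^sub>R contraction \<psi> \<phi> + b *\<^sub>R contraction \<psi> \<phi>'"
  unfolding fun_eq_iff plus_fun_apply scaleR_fun_apply contraction_apply interior_product_linear_form
    wedge_linear_right sum.distrib scaleR_sum_right by blast

text \<open>Each term of the contraction of two forms of even degree is a product of two forms of odd
  degree.\<close>

lemma contraction_commute:
  assumes "parity p \<psi>" "parity q \<phi>" "even p" "even q"
  shows "contraction \<phi> \<psi> = - contraction \<psi> \<phi>"
  using wedge_commute[OF parity_interior[OF assms(1)] parity_interior[OF assms(2)]] assms(3,4)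
  by (simp add: fun_eq_iff contraction_apply sum_negf)

lemma contraction_self:
  assumes "parity p \<psi>" "even p"
  shows "contraction \<psi> \<psi> = 0"
  using contraction_commute[OF assms(1,1,2,2)] by (simp add: fun_eq_iff)

section \<open>Null forms and the choice of the coframe\<close>

lemma wedge_constant_left:
  fixes \<beta> :: "'a list \<Rightarrow> 'c::comm_ring_1"
  shows "wedge (\<lambda>ys. if ys = [] then c else 0) \<beta> xs = c * \<beta> xs"
proof (induction xs arbitrary: \<beta>)
  case (Cons x xs)
  have "parity 0 (\<lambda>ys :: 'a list. if ys = [] then c else 0)"
    by (simp add: parity_def)
  moreover have "interior_product x (\<lambda>ys. if ys = [] then c else 0) = (\<lambda>_. 0)"
    by (simp add: interior_product_def fun_eq_iff)
  ultimately show ?case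
    using wedge_Cons[of 0 "\<lambda>ys. if ys = [] then c else 0" \<beta> x xs] Cons
    by (simp add: interior_product_def)
qed simp

lemma wedge_one_form_Cons:
  "wedge (one_form a) \<beta> (x # xs) = a x * \<beta> xs - wedge (one_form a) (interior_product x \<beta>) xs"
proof -
  have "interior_product x (one_form a) = (\<lambda>ys. if ys = [] then a x else 0)"
    by (auto simp: interior_product_def one_form_def fun_eq_iff split: list.splits)
  then show ?thesis
    using wedge_Cons[OF parity_one_form[of a], of \<beta> x xs] by (simp add: wedge_constant_left)
qed

lemma one_form_Nil [simp]: "one_form a [] = 0"
  by (simp add: one_form_def)

lemma interior_pullback:
  "interior_product x (pullback f \<alpha>) = pullback f (interior_product (f x) \<alpha>)"
  by (simp add: interior_product_def pullback_def fun_eq_iff)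

text \<open>Only the terms of order at most one in \<open>w\<close> survive in an alternating form.\<close>

lemma pullback_shift:
  fixes v :: "'t \<Rightarrow> 'v::real_vector" and \<alpha> :: "'v list \<Rightarrow> real"
  assumes "alt_form UNIV k \<alpha>"
  shows "pullback (\<lambda>x. v x + a x *\<^sub>R w) \<alpha> xs
    = pullback v \<alpha> xs + wedge (one_form a) (pullback v (interior_product w \<alpha>)) xs"
  using assms
proof (induction xs arbitrary: k \<alpha>)
  case Nil
  then show ?case by (simp add: pullback_def)
next
  case (Cons x xs)
  let ?s = "\<lambda>x. v x + a x *\<^sub>R w"
  have swap: "pullback v (interior_product w (interior_product (v x) \<alpha>))
      = (\<lambda>ys. - 1 * pullback v (interior_product (v x) (interior_product w \<alpha>)) ys)"
    by (subst interior_anticommute[OF Cons.prems]) (simp add: pullback_def[abs_def])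
  have twice: "pullback v (interior_product w (interior_product w \<alpha>)) = (\<lambda>_. 0)"
    by (simp add: interior_twice[OF Cons.prems] pullback_def[abs_def])
  have "pullback ?s \<alpha> (x # xs)
      = pullback ?s (interior_product (v x) \<alpha>) xs + a x * pullback ?s (interior_product w \<alpha>) xs"
    using alt_form_linear_first[OF Cons.prems, of 1 "v x" "a x" w]
    by (simp add: pullback_def interior_product_def)
  also have "pullback ?s (interior_product (v x) \<alpha>) xs = pullback v (interior_product (v x) \<alpha>) xs
      - wedge (one_form a) (pullback v (interior_product (v x) (interior_product w \<alpha>))) xs"
    unfolding Cons.IH[OF alt_form_interior[OF Cons.prems]] swap wedge_mult_right by simp
  also have "pullback ?s (interior_product w \<alpha>) xs = pullback v (interior_product w \<alpha>) xs"
    unfolding Cons.IH[OF alt_form_interior[OF Cons.prems]] twice by simp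
  finally show ?case
    by (simp add: wedge_one_form_Cons interior_pullback) (simp add: pullback_def interior_product_def)
qed

text \<open>The term of first order in \<open>w\<close> contains the one-form \<open>a\<close> as a factor, and \<open>a \<and> a = 0\<close>.\<close>

lemma wedge_one_form_shift:
  fixes v :: "'t \<Rightarrow> 'v::real_vector" and \<alpha> :: "'v list \<Rightarrow> real"
  assumes "alt_form UNIV k \<alpha>"
  shows "wedge (one_form a) (pullback (\<lambda>x. v x + a x *\<^sub>R w) \<alpha>) xs
    = wedge (one_form a) (pullback v \<alpha>) xs"
  using assms
proof (induction xs arbitrary: k \<alpha>)
  case (Cons x xs)
  let ?s = "\<lambda>x. v x + a x *\<^sub>R w"
  have "pullback ?s (interior_product (?s x) \<alpha>)
      = (\<lambda>ys. pullback ?s (interior_product (v x) \<alpha>) ys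
              + a x * pullback ?s (interior_product w \<alpha>) ys)"
    using interior_linear[OF Cons.prems, of 1 "v x" "a x" w] by (simp add: pullback_def fun_eq_iff)
  then have "wedge (one_form a) (pullback ?s \<alpha>) (x # xs) = a x * pullback ?s \<alpha> xs
      - wedge (one_form a) (pullback v (interior_product (v x) \<alpha>)) xs
      - a x * wedge (one_form a) (pullback v (interior_product w \<alpha>)) xs"
    using Cons.IH[OF alt_form_interior[OF Cons.prems]]
    by (simp add: wedge_one_form_Cons interior_pullback wedge_add_right wedge_mult_right)
  also have "\<dots> = wedge (one_form a) (pullback v \<alpha>) (x # xs)"
    unfolding pullback_shift[OF Cons.prems]
    by (simp add: wedge_one_form_Cons interior_pullback algebra_simps)
  finally show ?case .
qed simp

text \<open>The translations in \<open>K \<ltimes> \<real>\<^sup>8\<close> shift the transverse coframe by multiples of \<open>e\<^sup>-\<close>, which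
  disappear in the product with \<open>e\<^sup>-\<close>.  Hence the null form of a \<open>K\<close>-invariant form does not depend
  on the adapted coframe.\<close>

lemma null_form_semidirect:
  assumes \<alpha>: "alt_form UNIV k \<alpha>" and inv: "\<And>f. f \<in> K \<Longrightarrow> pullback f \<alpha> = \<alpha>"
    and h: "h \<in> semidirect K"
  shows "null_form (h \<circ> e) \<alpha> = null_form e \<alpha>"
proof -
  obtain f w where f: "f \<in> K"
    and h_def: "h = (\<lambda>(a, b, v). (a, b - w \<bullet> v - (w \<bullet> w) / 2 * a, f (v + a *\<^sub>R w)))"
    using h by (auto simp: semidirect_def)
  have 1: "e_minus (h \<circ> e) = e_minus e"
    by (simp add: h_def e_minus_def fun_eq_iff case_prod_beta)
  have "pullback (e_transverse (h \<circ> e)) \<alpha>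
      = pullback (\<lambda>x. e_transverse e x + e_minus e x *\<^sub>R w) (pullback f \<alpha>)"
    by (simp add: pullback_def h_def e_transverse_def[abs_def] e_minus_def fun_eq_iff case_prod_beta
      comp_def)
  then show ?thesis
    unfolding null_form_def 1 inv[OF f]
    by (intro ext) (simp only: wedge_one_form_shift[OF \<alpha>])
qed

lemma null_form_linear:
  "null_form e (a *\<^sub>R \<alpha> + b *\<^sub>R \<beta>) = a *\<^sub>R null_form e \<alpha> + b *\<^sub>R null_form e \<beta>"
proof -
  have "pullback (e_transverse e) (a *\<^sub>R \<alpha> + b *\<^sub>R \<beta>)
      = (\<lambda>xs. a *\<^sub>R pullback (e_transverse e) \<alpha> xs + b *\<^sub>R pullback (e_transverse e) \<beta> xs)"
    by (simp add: pullback_def fun_eq_iff scaleR_fun_def)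
  then show ?thesis
    unfolding null_form_def
    by (intro ext) (simp only: wedge_linear_right scaleR_fun_apply plus_fun_apply)
qed

text \<open>A representative is recovered by inserting the vector dual to \<open>e\<^sup>-\<close> first and transverse
  vectors afterwards.\<close>

lemma null_form_inject:
  assumes e: "surj e" and eq: "null_form e \<alpha> = null_form e \<beta>"
  shows "\<alpha> = \<beta>"
proof
  fix vs
  define n where "n = inv e (1, 0, 0)"
  define t where "t v = inv e (0, 0, v)" for v
  have n: "e n = (1, 0, 0)" and t: "e (t v) = (0, 0, v)" for v
    by (simp_all add: n_def t_def surj_f_inv_f[OF e])
  \<comment> \<open>Transverse vectors are annihilated by \<open>e\<^sup>-\<close>.\<close>
  have 0: "wedge (one_form (e_minus e)) \<gamma> (map t ws) = 0" for \<gamma> and ws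
    by (induction ws arbitrary: \<gamma>) (simp_all add: wedge_one_form_Cons e_minus_def t)
  have "null_form e \<gamma> (n # map t vs) = \<gamma> vs" for \<gamma>
    by (simp add: null_form_def wedge_one_form_Cons 0)
      (simp add: e_minus_def n pullback_def e_transverse_def t comp_def)
  then show "\<alpha> vs = \<beta> vs"
    using eq by metis
qed

lemma breve_null_form:
  assumes "surj e" "\<alpha> \<in> exterior_algebra UNIV"
  shows "breve e (null_form e \<alpha>) = \<alpha>"
  unfolding breve_def using assms by (auto intro!: the_equality dest: null_form_inject)


section \<open>From forms on spacetime to forms on the transverse space\<close>

lemma alt_form_in_exterior_algebra: "alt_form UNIV k \<alpha> \<Longrightarrow> \<alpha> \<in> exterior_algebra UNIV"
  unfolding exterior_algebra_def by (auto intro: span_base)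

context heterotic_background
begin

text \<open>The coframe is the one in which \<^const>\<open>null_bracket\<close> is computed.  With this choice the map is
  a homomorphism on the whole exterior algebra, so that brackets of invariant forms need not be
  shown to be invariant again.\<close>

definition null_field :: "('v list \<Rightarrow> real) \<Rightarrow> 'm dform" where
  "null_field \<alpha> q = null_form (SOME e. e \<in> adapted q) \<alpha>"

lemma some_adapted: "(SOME e. e \<in> adapted q) \<in> adapted q"
  using adapted_local[of q] by (metis someI)

lemma some_adapted_surj: "surj (SOME e. e \<in> adapted q)"
  using adapted_coframe[OF some_adapted[of q]] unfolding coframe_def bij_betw_def by blast

lemma null_field_linear: "null_field (a *\<^sub>R \<alpha> + b *\<^sub>R \<beta>) = a *\<^sub>R null_field \<alpha> + b *\<^sub>R null_field \<beta>"
  by (simp add: null_field_def fun_eq_iff null_form_linear scaleR_fun_apply)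

lemma null_field_inject: "null_field \<alpha> = null_field \<beta> \<Longrightarrow> \<alpha> = \<beta>"
  by (rule null_form_inject[OF some_adapted_surj], unfold null_field_def[symmetric]) simp

lemma null_bracket_null_field:
  assumes "\<alpha> \<in> exterior_algebra UNIV" "\<beta> \<in> exterior_algebra UNIV"
  shows "null_bracket adapted (null_field \<alpha>) (null_field \<beta>) = null_field (contraction \<alpha> \<beta>)"
  by (simp add: null_bracket_def null_field_def Let_def fun_eq_iff breve_null_form some_adapted_surj assms)

text \<open>Invariance makes the choice of the coframe immaterial, so an invariant form represents exactly
  one form on spacetime.\<close>

lemma represented_by_null_field:
  assumes "\<alpha> \<in> invariant_forms K k"
  shows "represented_by adapted \<phi> \<alpha> \<longleftrightarrow> \<phi> = null_field \<alpha>"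
proof
  assume "represented_by adapted \<phi> \<alpha>"
  then show "\<phi> = null_field \<alpha>"
    using some_adapted by (auto simp: represented_by_def null_field_def)
next
  have \<alpha>: "alt_form UNIV k \<alpha>" "\<And>f. f \<in> K \<Longrightarrow> pullback f \<alpha> = \<alpha>"
    using assms by (auto simp: invariant_forms_def)
  assume \<phi>: "\<phi> = null_field \<alpha>"
  show "represented_by adapted \<phi> \<alpha>"
    unfolding represented_by_def
  proof (intro allI ballI)
    fix q e
    assume "e \<in> adapted q"
    then obtain h where "h \<in> semidirect K" "e = h \<circ> (SOME e. e \<in> adapted q)"
      using adapted_related[OF some_adapted] by blast
    then show "\<phi> q = null_form e \<alpha>"
      using null_form_semidirect[OF \<alpha>, of K h "SOME e. e \<in> adapted q"] by (simp add: \<phi> null_field_def)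
  qed
qed

text \<open>The form \<open>\<kappa>\<close> itself is represented by a constant; removing it therefore removes no other
  fundamental form.\<close>

lemma kappa_not_null_field:
  assumes "alt_form UNIV k \<alpha>" "k > 0"
  shows "null_field \<alpha> \<noteq> \<kappa>"
proof
  assume eq: "null_field \<alpha> = \<kappa>"
  fix q :: 'm
  define e where "e = (SOME e. e \<in> adapted q)"
  have "one_form (e_minus e) = null_form e \<alpha>"
    using adapted_kappa[OF some_adapted[of q]] fun_cong[OF eq, of q]
    by (simp add: e_def null_field_def)
  moreover have "null_form e \<alpha> [x] = 0" for x
    using alt_form_degree[OF assms(1), of "[]"] assms(2)
    by (simp add: null_form_def wedge_one_form_Cons pullback_def)
  ultimately have "one_form (e_minus e) [x] = 0" for x
    by metis
  then have "one_form (e_minus e) = 0"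
    by (simp add: fun_eq_iff one_form_def split: list.splits)
  then show False
    using adapted_kappa[OF some_adapted[of q]] kappa_nonzero[of q] by (simp add: e_def)
qed

text \<open>The passage from null forms on spacetime to their representatives.  It suffices to realise the
  abstract Lie algebra \<open>L\<close> faithfully by forms on the transverse space in such a way that the
  representatives \<open>B\<close> of the fundamental forms lie in its image and generate it.\<close>

lemma reduced_algebra_isomorphic:
  fixes f :: "'l::real_vector \<Rightarrow> 'v list \<Rightarrow> real"
  assumes inv: "\<And>\<alpha>. \<alpha> \<in> B \<Longrightarrow> \<exists>k>0. \<alpha> \<in> invariant_forms K k"
    and L: "subspace L" "\<And>x y. x \<in> L \<Longrightarrow> y \<in> L \<Longrightarrow> br x y \<in> L"
    and f: "linear f" "inj_on f L" "f ` L \<subseteq> exterior_algebra UNIV"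
    and hom: "\<And>x y. x \<in> L \<Longrightarrow> y \<in> L \<Longrightarrow> f (br x y) = contraction (f x) (f y)"
    and B: "B \<subseteq> f ` L"
    and gen: "\<And>V. subspace V \<Longrightarrow> B \<subseteq> V \<Longrightarrow> (\<And>\<alpha> \<beta>. \<alpha> \<in> V \<Longrightarrow> \<beta> \<in> V \<Longrightarrow> contraction \<alpha> \<beta> \<in> V)
      \<Longrightarrow> f ` L \<subseteq> V"
  shows "lie_isomorphic (reduced_algebra adapted \<kappa> B) (null_bracket adapted) L br"
proof -
  define F where "F x = null_field (f x)" for x
  have F_lin: "F (a *\<^sub>R x + b *\<^sub>R y) = a *\<^sub>R F x + b *\<^sub>R F y" for a b x y
    using f(1) by (simp add: F_def linear_add linear_scale null_field_linear)
  have F_inj: "inj_on F L"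
    using f(2) by (auto simp: F_def inj_on_def dest: null_field_inject)
  have ext: "x \<in> L \<Longrightarrow> f x \<in> exterior_algebra UNIV" for x
    using f(3) by blast
  have F_hom: "null_bracket adapted (F x) (F y) = F (br x y)" if "x \<in> L" "y \<in> L" for x y
    using that by (simp add: F_def null_bracket_null_field ext hom)
  have L_lin: "a *\<^sub>R x + b *\<^sub>R y \<in> L" if "x \<in> L" "y \<in> L" for a b x y
    using L(1) that by (simp add: subspace_add subspace_scale)
  have linear_F: "linear F"
    using F_lin[of 1 _ 1] F_lin[of _ _ 0] by (intro linearI) auto
  have fund: "fundamental_forms adapted \<kappa> B - {\<kappa>} = null_field ` B"
  proof -
    have "(\<exists>\<alpha>\<in>B. represented_by adapted \<phi> \<alpha>) \<longleftrightarrow> \<phi> \<in> null_field ` B" for \<phi>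
      using inv represented_by_null_field by blast
    moreover have "\<kappa> \<notin> null_field ` B"
      using inv kappa_not_null_field by (fastforce simp: invariant_forms_def)
    ultimately show ?thesis
      by (auto simp: fundamental_forms_def)
  qed
  have "reduced_algebra adapted \<kappa> B = F ` L"
  proof
    have "subspace (F ` L)"
      using linear_F L(1) by (rule linear_subspace_image)
    moreover have "null_field ` B \<subseteq> F ` L"
      using B by (auto simp: F_def image_iff)
    moreover have "\<forall>x\<in>F ` L. \<forall>y\<in>F ` L. null_bracket adapted x y \<in> F ` L"
      using F_hom L(2) by auto
    ultimately show "reduced_algebra adapted \<kappa> B \<subseteq> F ` L"
      unfolding reduced_algebra_def fund lie_closure_def by blast
  next
    show "F ` L \<subseteq> reduced_algebra adapted \<kappa> B"
      unfolding reduced_algebra_def fund lie_closure_def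
    proof (intro Inter_greatest)
      fix V
      assume "V \<in> {V. subspace V \<and> null_field ` B \<subseteq> V \<and>
        (\<forall>x\<in>V. \<forall>y\<in>V. null_bracket adapted x y \<in> V)}"
      then have V: "subspace V" "null_field ` B \<subseteq> V"
        "\<And>x y. x \<in> V \<Longrightarrow> y \<in> V \<Longrightarrow> null_bracket adapted x y \<in> V"
        by auto
      \<comment> \<open>The representatives of the members of \<open>V\<close> form a subalgebra that contains \<open>B\<close>.\<close>
      have "f ` L \<subseteq> f ` {x \<in> L. F x \<in> V}"
      proof (rule gen)
        have "subspace {x \<in> L. F x \<in> V}"
          using L(1) V(1) linear_F
          by (auto simp: subspace_def linear_0 linear_add linear_scale)
        then show "subspace (f ` {x \<in> L. F x \<in> V})"
          by (rule linear_subspace_image[OF f(1)])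
        show "B \<subseteq> f ` {x \<in> L. F x \<in> V}"
          using B V(2) by (fastforce simp: F_def)
        fix \<alpha> \<beta>
        assume "\<alpha> \<in> f ` {x \<in> L. F x \<in> V}" "\<beta> \<in> f ` {x \<in> L. F x \<in> V}"
        then obtain x y where "x \<in> L" "F x \<in> V" "\<alpha> = f x" "y \<in> L" "F y \<in> V" "\<beta> = f y"
          by auto
        then show "contraction \<alpha> \<beta> \<in> f ` {x \<in> L. F x \<in> V}"
          using V(3)[of "F x" "F y"] L(2) by (auto simp: F_hom simp flip: hom)
      qed
      then show "F ` L \<subseteq> V"
        using f(2) by (fastforce simp: inj_on_def)
    qed
  qed
  moreover have "lie_isomorphic (F ` L) (null_bracket adapted) L br"
    unfolding lie_isomorphic_def
  proof (intro exI[of _ "the_inv_into L F"] conjI ballI)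
    have inv_F: "x \<in> L \<Longrightarrow> the_inv_into L F (F x) = x" for x
      by (rule the_inv_into_f_f[OF F_inj])
    show "linear_on_set (F ` L) (the_inv_into L F)"
      by (auto simp: linear_on_set_def inv_F L_lin simp flip: F_lin)
    show "bij_betw (the_inv_into L F) (F ` L) L"
      by (rule bij_betw_the_inv_into) (simp add: F_inj bij_betw_def)
    show "the_inv_into L F (null_bracket adapted x y) = br (the_inv_into L F x) (the_inv_into L F y)"
      if "x \<in> F ` L" "y \<in> F ` L" for x y
      using that by (auto simp: F_hom inv_F L(2))
  qed
  ultimately show ?thesis
    by simp
qed

end

section \<open>Two-forms as skew operators\<close>

definition op_form :: "('v::real_inner \<Rightarrow> 'v) \<Rightarrow> 'v list \<Rightarrow> real" where
  "op_form S xs = (case xs of [x, y] \<Rightarrow> x \<bullet> S y | _ \<Rightarrow> 0)"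

definition skew :: "('v::real_inner \<Rightarrow> 'v) \<Rightarrow> bool" where
  "skew S \<longleftrightarrow> (\<forall>x y. x \<bullet> S y = - (S x \<bullet> y))"

lemma op_form_simps [simp]:
  "op_form S [x, y] = x \<bullet> S y"
  "length xs \<noteq> 2 \<Longrightarrow> op_form S xs = 0"
  by (auto simp: op_form_def split: list.splits)

lemma interior_op_form: "interior_product b (op_form S) = one_form (\<lambda>x. b \<bullet> S x)"
  by (auto simp: interior_product_def one_form_def op_form_def fun_eq_iff split: list.splits)

lemma op_form_inject: "op_form S = op_form T \<longleftrightarrow> S = T"
proof
  assume "op_form S = op_form T"
  then have "x \<bullet> S y = x \<bullet> T y" for x y
    by (metis op_form_simps(1))
  then show "S = T"
    by (metis ext vector_eq_rdot inner_commute)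
qed simp

lemma list_length_2_iff: "length xs = 2 \<longleftrightarrow> (\<exists>x y. xs = [x, y])"
  by (auto simp: numeral_2_eq_2 length_Suc_conv)

lemma form_2_eqI:
  assumes "alt_form UNIV 2 \<alpha>" "\<And>x y. \<alpha> [x, y] = x \<bullet> S y"
  shows "\<alpha> = op_form S"
proof
  fix xs
  show "\<alpha> xs = op_form S xs"
    using alt_form_degree[OF assms(1)] assms(2) by (cases "length xs = 2") (auto simp: list_length_2_iff)
qed

lemma alt_form_op_form:
  assumes "linear S" "skew S"
  shows "alt_form UNIV 2 (op_form S)"
proof -
  have "x \<bullet> S x = 0" for x
    using assms(2) by (simp add: skew_def) (metis add.inverse_inverse equal_neg_zero inner_commute)
  then have "op_form S xs = 0" if "\<not> distinct xs" for xs
    using that by (cases "length xs = 2") (auto simp: list_length_2_iff)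
  moreover have "op_form S (xs @ (a *\<^sub>R x + b *\<^sub>R y) # ys)
      = a *\<^sub>R op_form S (xs @ x # ys) + b *\<^sub>R op_form S (xs @ y # ys)"
    if len: "length xs + Suc (length ys) = 2" for xs ys x y a b
  proof (cases xs)
    case Nil
    then obtain z where "ys = [z]"
      using len by (cases ys) auto
    then show ?thesis
      by (simp add: Nil inner_add_left)
  next
    case (Cons z zs)
    then have "zs = []" "ys = []"
      using len by auto
    then show ?thesis
      by (simp add: Cons linear_add[OF assms(1)] linear_scale[OF assms(1)] inner_add_right)
  qed
  ultimately show ?thesis
    by (simp add: alt_form_def)
qed

text \<open>Contracting the first indices of \<open>\<langle>x, S y\<rangle>\<close> and \<open>\<langle>x, T y\<rangle>\<close> gives \<open>\<langle>S x, T y\<rangle> - \<langle>S y, T x\<rangle>\<close>, and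
  skewness moves the operators to the second argument.  The order of the factors is opposite to
  that of the commutator, so a Lie algebra has to act by an anti-homomorphism, for instance by minus
  its matrices or by multiplication from the right.\<close>

lemma contraction_op_form:
  fixes S T :: "'v::euclidean_space \<Rightarrow> 'v"
  assumes "linear S" "linear T" "skew S" "skew T"
  shows "contraction (op_form S) (op_form T) = op_form (\<lambda>x. T (S x) - S (T x))"
proof (rule form_2_eqI)
  show "alt_form UNIV 2 (contraction (op_form S) (op_form T))"
    using alt_form_contraction[OF alt_form_op_form[OF assms(1,3)] alt_form_op_form[OF assms(2,4)]]
    by (simp add: numeral_2_eq_2)
  fix x y
  have "contraction (op_form S) (op_form T) [x, y]
      = (\<Sum>b\<in>Basis. (S x \<bullet> b) * (T y \<bullet> b)) - (\<Sum>b\<in>Basis. (S y \<bullet> b) * (T x \<bullet> b))"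
    by (simp add: contraction_apply interior_op_form wedge_one_form_Cons interior_product_def one_form_def
      sum_subtractf inner_commute mult.commute)
  also have "\<dots> = S x \<bullet> T y - S y \<bullet> T x"
    by (simp only: euclidean_inner[symmetric])
  also have "S x \<bullet> T y = - (x \<bullet> S (T y))"
    using assms(3) by (simp add: skew_def)
  also have "S y \<bullet> T x = - (x \<bullet> T (S y))"
    using assms(4) by (metis skew_def inner_commute minus_minus)
  finally show "contraction (op_form S) (op_form T) [x, y] = x \<bullet> (T (S y) - S (T y))"
    by (simp add: inner_diff_right)
qed

lemma alt_form_2_operator:
  fixes \<alpha> :: "'v::euclidean_space list \<Rightarrow> real"
  assumes "alt_form UNIV 2 \<alpha>"
  obtains S where "linear S" "skew S" "\<alpha> = op_form S"
proof
  define S where "S y = (\<Sum>b\<in>Basis. \<alpha> [b, y] *\<^sub>R b)" for y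
  have lin2: "linear (\<lambda>y. \<alpha> [x, y])" for x
    using alt_form_linear_map[OF alt_form_interior[OF assms, of x], of "[]"]
    by (simp add: interior_product_def)
  show "linear S"
    unfolding S_def by (intro linear_compose_sum ballI linear_compose[OF lin2, unfolded comp_def])
      (simp_all add: linear_scale_left linear_scaleR_left)
  have eq: "\<alpha> [x, y] = x \<bullet> S y" for x y
  proof -
    have "\<alpha> [x, y] = (\<Sum>b\<in>Basis. (x \<bullet> b) *\<^sub>R \<alpha> [b, y])"
      using linear_sum[OF alt_form_linear_map[OF assms], of "\<lambda>b. (x \<bullet> b) *\<^sub>R b" Basis "[y]"]
      by (simp add: euclidean_representation alt_form_scaleR_first[OF assms])
    then show ?thesis
      by (simp add: S_def inner_sum_right mult.commute)
  qed
  then show "\<alpha> = op_form S"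
    by (rule form_2_eqI[OF assms])
  show "skew S"
    unfolding skew_def using alt_form_swap[OF assms, of _ _ "[]"] by (metis eq inner_commute)
qed

lemma pullback_op_form:
  assumes "\<And>x y. h x \<bullet> h y = x \<bullet> y" "\<And>x. S (h x) = h (S x)"
  shows "pullback h (op_form S) = op_form S"
  using assms by (auto simp: pullback_def op_form_def fun_eq_iff split: list.splits)

text \<open>For isometries, invariance of a two-form is the same as commuting with its operator.\<close>

lemma commutes_with_isometry:
  assumes "pullback h (op_form S) = op_form S" "\<And>x y. h x \<bullet> h y = x \<bullet> y" "surj h"
  shows "S (h x) = h (S x)"
proof -
  have "h y \<bullet> S (h x) = h y \<bullet> h (S x)" for y
    using fun_cong[OF assms(1), of "[y, x]"] by (simp add: pullback_def assms(2))
  then have "z \<bullet> S (h x) = z \<bullet> h (S x)" for z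
    using assms(3) by (metis surjD)
  then show ?thesis
    by (metis vector_eq_ldot)
qed

text \<open>When the fundamental forms are represented by two-forms that span a Lie algebra of skew
  operators, no further elements are needed for closure.\<close>

lemma (in heterotic_background) operators_isomorphic:
  fixes \<rho> :: "'l::real_vector \<Rightarrow> 'v \<Rightarrow> 'v"
  assumes inv: "B \<subseteq> invariant_forms K 2"
    and L: "subspace L" "\<And>x y. x \<in> L \<Longrightarrow> y \<in> L \<Longrightarrow> br x y \<in> L"
    and lin: "\<And>v. linear (\<lambda>x. \<rho> x v)" "\<And>x. linear (\<rho> x)"
    and skew: "\<And>x. x \<in> L \<Longrightarrow> skew (\<rho> x)"
    and hom: "\<And>x y v. x \<in> L \<Longrightarrow> y \<in> L \<Longrightarrow> \<rho> (br x y) v = \<rho> y (\<rho> x v) - \<rho> x (\<rho> y v)"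
    and inj: "\<And>x. x \<in> L \<Longrightarrow> (\<And>v. \<rho> x v = 0) \<Longrightarrow> x = 0"
    and B: "B \<subseteq> (\<lambda>x. op_form (\<rho> x)) ` L" "(\<lambda>x. op_form (\<rho> x)) ` L \<subseteq> span B"
  shows "lie_isomorphic (reduced_algebra adapted \<kappa> B) (null_bracket adapted) L br"
proof (rule reduced_algebra_isomorphic)
  show "\<exists>k>0. \<alpha> \<in> invariant_forms K k" if "\<alpha> \<in> B" for \<alpha>
    using inv that zero_less_numeral by blast
  show "linear (\<lambda>x. op_form (\<rho> x))"
    by (intro linearI ext) (auto simp: op_form_def linear_add[OF lin(1)] linear_scale[OF lin(1)]
      inner_simps scaleR_fun_apply split: list.splits)
  show "inj_on (\<lambda>x. op_form (\<rho> x)) L"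
  proof (rule inj_onI)
    fix x y
    assume xy: "x \<in> L" "y \<in> L" "op_form (\<rho> x) = op_form (\<rho> y)"
    then have "\<rho> (x - y) v = 0" for v
      by (simp add: linear_diff[OF lin(1)] op_form_inject)
    then show "x = y"
      using inj[of "x - y"] xy L(1) by (simp add: subspace_diff)
  qed
  show "(\<lambda>x. op_form (\<rho> x)) ` L \<subseteq> exterior_algebra UNIV"
    using alt_form_op_form[OF lin(2) skew] alt_form_in_exterior_algebra by blast
  show "op_form (\<rho> (br x y)) = contraction (op_form (\<rho> x)) (op_form (\<rho> y))"
    if "x \<in> L" "y \<in> L" for x y
    by (simp add: contraction_op_form lin(2) skew that op_form_inject) (simp add: fun_eq_iff hom that)
  show "(\<lambda>x. op_form (\<rho> x)) ` L \<subseteq> V" if "subspace V" "B \<subseteq> V" for V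
    using B(2) span_minimal[OF that(2,1)] by blast
qed (use L B in auto)


section \<open>Matrix algebras\<close>

lemma linear_neg_matrix_vector_mult:
  fixes X :: "'a::real_algebra_1^'n^'m"
  shows "linear (\<lambda>v. - (X *v v))" "linear (\<lambda>X. - (X *v (v :: 'a^'n)))"
  by (auto intro!: linearI simp: vec_eq_iff matrix_vector_mult_def distrib_left distrib_right
      sum.distrib scaleR_sum_right)

lemma matrix_vector_mult_minus:
  fixes X :: "'a::ring_1^'n^'m"
  shows "(- X) *v v = - (X *v v)" "X *v (- v) = - (X *v v)"
  by (simp_all add: vec_eq_iff matrix_vector_mult_def sum_negf)

lemma matrix_mult_minus_minus:
  fixes X :: "'a::ring_1^'n^'m"
  shows "(- X) ** (- Y) = X ** Y"
  by (simp add: vec_eq_iff matrix_matrix_mult_def)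

lemma commutator_operator:
  fixes X Y :: "'a::comm_ring_1^'n^'n"
  shows "- (commutator X Y *v v) = - (Y *v - (X *v v)) - - (X *v - (Y *v v))"
  by (simp add: commutator_def matrix_vector_mult_diff_rdistrib matrix_vector_mul_assoc
    matrix_vector_mult_minus)

lemma matrix_operator_inject:
  fixes X :: "'a::comm_ring_1^'n^'n"
  assumes "\<And>v. - (X *v v) = 0"
  shows "X = 0"
  using assms by (simp add: matrix_eq)

lemma so_algebra_iff: "X \<in> so_algebra \<longleftrightarrow> skew (\<lambda>v. - (X *v v))"
proof -
  have t: "x \<bullet> (X *v y) = (transpose X *v x) \<bullet> y" for x y
    by (simp only: transpose_matrix_vector dot_lmul_matrix)
  have "x \<bullet> - (X *v y) = - (- (X *v x) \<bullet> y) \<longleftrightarrow> (transpose X *v x) \<bullet> y = (- X *v x) \<bullet> y" for x y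
    unfolding inner_minus_right inner_minus_left t matrix_vector_mult_minus by linarith
  then have "skew (\<lambda>v. - (X *v v)) \<longleftrightarrow> (\<forall>x y. (transpose X *v x) \<bullet> y = (- X *v x) \<bullet> y)"
    unfolding skew_def by blast
  also have "\<dots> \<longleftrightarrow> transpose X = - X"
    by (metis matrix_eq vector_eq_rdot)
  finally show ?thesis
    by (simp add: so_algebra_def)
qed

lemma subspace_so_algebra: "subspace (so_algebra :: (real^'n^'n) set)"
proof -
  have l: "linear (\<lambda>X :: real^'n^'n. transpose X + X)"
    by (rule linearI) (simp_all add: vec_eq_iff transpose_def algebra_simps)
  have eq: "so_algebra = {X :: real^'n^'n. transpose X + X = 0}"
    by (simp add: so_algebra_def eq_neg_iff_add_eq_0)
  show ?thesis
    unfolding subspace_def eq Ball_def mem_Collect_eq linear_0[OF l] linear_add[OF l] linear_scale[OF l]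
    by simp
qed

lemma commutator_so_algebra: "X \<in> so_algebra \<Longrightarrow> Y \<in> so_algebra \<Longrightarrow> commutator X Y \<in> so_algebra"
  for X Y :: "real^'n^'n"
proof -
  have "transpose (A - B) = transpose A - transpose B" for A B :: "real^'n^'n"
    by (simp add: transpose_def vec_eq_iff)
  then show "X \<in> so_algebra \<Longrightarrow> Y \<in> so_algebra \<Longrightarrow> commutator X Y \<in> so_algebra"
    by (simp add: so_algebra_def commutator_def matrix_transpose_mul matrix_mult_minus_minus)
qed

text \<open>Every two-form is invariant under the trivial group, so the algebra consists of all skew
  operators.\<close>

lemma trivial_holonomy_algebra:
  assumes "heterotic_background A g H nabla \<kappa> {id :: real^'n \<Rightarrow> real^'n} adapted"
  shows "lie_isomorphic (reduced_algebra adapted \<kappa> (invariant_forms {id :: real^'n \<Rightarrow> real^'n} 2))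
    (null_bracket adapted) (so_algebra :: (real^'n^'n) set) commutator"
proof -
  interpret heterotic_background A g H nabla \<kappa> "{id :: real^'n \<Rightarrow> real^'n}" adapted
    by fact
  have inv: "invariant_forms {id :: real^'n \<Rightarrow> real^'n} 2 = {\<alpha>. alt_form UNIV 2 \<alpha>}"
    by (auto simp: invariant_forms_def pullback_def[abs_def])
  show ?thesis
  proof (rule operators_isomorphic[where \<rho> = "\<lambda>X v. - (X *v v)"])
    show "(\<lambda>X. op_form (\<lambda>v. - (X *v v))) ` (so_algebra :: (real^'n^'n) set)
        \<subseteq> span (invariant_forms {id :: real^'n \<Rightarrow> real^'n} 2)"
      by (intro image_subsetI span_base)
        (simp add: inv alt_form_op_form linear_neg_matrix_vector_mult flip: so_algebra_iff)
    show "invariant_forms {id :: real^'n \<Rightarrow> real^'n} 2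
        \<subseteq> (\<lambda>X. op_form (\<lambda>v. - (X *v v))) ` (so_algebra :: (real^'n^'n) set)"
    proof
      fix \<alpha> :: "(real^'n) list \<Rightarrow> real"
      assume "\<alpha> \<in> invariant_forms {id} 2"
      then have "alt_form UNIV 2 \<alpha>"
        by (simp add: inv)
      then obtain S where S: "linear S" "skew S" "\<alpha> = op_form S"
        by (rule alt_form_2_operator)
      have "S = (\<lambda>v. - ((- matrix S) *v v))"
        by (simp add: matrix_vector_mult_minus S(1))
      then show "\<alpha> \<in> (\<lambda>X. op_form (\<lambda>v. - (X *v v))) ` so_algebra"
        using S by (intro image_eqI[of _ _ "- matrix S"]) (simp_all add: so_algebra_iff)
    qed
    show "X = 0" if "\<And>v. - (X *v v) = 0" for X :: "real^'n^'n"
      using that by (rule matrix_operator_inject)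
  qed (assumption | rule order_refl subspace_so_algebra commutator_so_algebra linear_neg_matrix_vector_mult
      commutator_operator so_algebra_iff[THEN iffD1])+
qed

lemma inner_adjoint_matrix:
  fixes X :: "complex^'n^'m"
  shows "x \<bullet> (X *v y) = (adjoint_matrix X *v x) \<bullet> y"
proof -
  have "a \<bullet> (c * b) = (cnj c * a) \<bullet> b" for a b c :: complex
    by (simp add: inner_complex_def algebra_simps)
  then show ?thesis
    unfolding inner_vec_def
    by (simp add: matrix_vector_mult_def adjoint_matrix_def inner_sum_left inner_sum_right)
      (rule sum.swap)
qed

lemma u_algebra_iff: "X \<in> u_algebra \<longleftrightarrow> skew (\<lambda>v. - (X *v v))"
proof -
  have "x \<bullet> - (X *v y) = - (- (X *v x) \<bullet> y) \<longleftrightarrow> (adjoint_matrix X *v x) \<bullet> y = (- X *v x) \<bullet> y"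
    for x y
    unfolding inner_minus_right inner_minus_left inner_adjoint_matrix matrix_vector_mult_minus
    by linarith
  then have "skew (\<lambda>v. - (X *v v)) \<longleftrightarrow> (\<forall>x y. (adjoint_matrix X *v x) \<bullet> y = (- X *v x) \<bullet> y)"
    unfolding skew_def by blast
  also have "\<dots> \<longleftrightarrow> adjoint_matrix X = - X"
    by (metis matrix_eq vector_eq_rdot)
  finally show ?thesis
    by (simp add: u_algebra_def)
qed

lemma subspace_u_algebra: "subspace (u_algebra :: (complex^'n^'n) set)"
proof -
  have l: "linear (\<lambda>X :: complex^'n^'n. adjoint_matrix X + X)"
    by (rule linearI) (simp_all add: vec_eq_iff adjoint_matrix_def algebra_simps)
  have eq: "u_algebra = {X :: complex^'n^'n. adjoint_matrix X + X = 0}"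
    by (simp add: u_algebra_def eq_neg_iff_add_eq_0)
  show ?thesis
    unfolding subspace_def eq Ball_def mem_Collect_eq linear_0[OF l] linear_add[OF l] linear_scale[OF l]
    by simp
qed

lemma adjoint_matrix_mult:
  fixes X :: "complex^'n^'m" and Y :: "complex^'k^'n"
  shows "adjoint_matrix (X ** Y) = adjoint_matrix Y ** adjoint_matrix X"
  by (simp add: adjoint_matrix_def matrix_matrix_mult_def vec_eq_iff mult.commute)

lemma commutator_u_algebra: "X \<in> u_algebra \<Longrightarrow> Y \<in> u_algebra \<Longrightarrow> commutator X Y \<in> u_algebra"
  for X Y :: "complex^'n^'n"
proof -
  have "adjoint_matrix (A - B) = adjoint_matrix A - adjoint_matrix B" for A B :: "complex^'n^'n"
    by (simp add: adjoint_matrix_def vec_eq_iff)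
  then show "X \<in> u_algebra \<Longrightarrow> Y \<in> u_algebra \<Longrightarrow> commutator X Y \<in> u_algebra"
    by (simp add: u_algebra_def commutator_def adjoint_matrix_mult matrix_mult_minus_minus)
qed

lemma vector_scalar_mult_simps:
  fixes v :: "complex^'n"
  shows "(norm c = 1 \<Longrightarrow> (c *s v) \<bullet> (c *s w) = v \<bullet> w)"
    "of_real r *s v = r *\<^sub>R v"
proof -
  assume "norm c = 1"
  then have c: "(Re c)\<^sup>2 + (Im c)\<^sup>2 = 1"
    by (simp add: cmod_power2[symmetric])
  have "(c * a) \<bullet> (c * b) = ((Re c)\<^sup>2 + (Im c)\<^sup>2) * (a \<bullet> b)" for a b
    by (simp add: inner_complex_def algebra_simps power2_eq_square)
  then show "(c *s v) \<bullet> (c *s w) = v \<bullet> w"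
    by (simp add: inner_vec_def c)
qed (simp add: vec_eq_iff complex_eq_iff)

text \<open>A real-linear operator that commutes with the unit scalars commutes with all complex scalars,
  since these are products of a unit and a real number.\<close>

lemma complex_linear_operator:
  fixes S :: "complex^'n \<Rightarrow> complex^'n"
  assumes S: "linear S" and comm: "\<And>c v. norm c = 1 \<Longrightarrow> S (c *s v) = c *s S v"
  obtains X where "S = (*v) X"
proof
  have scale: "S (c *s v) = c *s S v" for c v
  proof (cases "c = 0")
    case False
    have "c *s v = norm c *\<^sub>R (sgn c *s v)" "norm c *\<^sub>R (sgn c *s S v) = c *s S v"
      using False by (auto simp: vec_eq_iff sgn_div_norm)
    then show ?thesis
      using comm[of "sgn c" v] False by (simp add: linear_scale[OF S] norm_sgn)
  qed (simp add: linear_0[OF S])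
  show "S = (*v) (\<chi> i j. S (axis j 1) $ i)"
  proof
    fix v
    have "S v = S (\<Sum>j\<in>UNIV. v $ j *s axis j 1)"
      by (simp add: basis_expansion)
    also have "\<dots> = (\<Sum>j\<in>UNIV. v $ j *s S (axis j 1))"
      by (simp add: linear_sum[OF S] scale)
    also have "\<dots> = (\<chi> i j. S (axis j 1) $ i) *v v"
      by (simp add: vec_eq_iff matrix_vector_mult_def mult.commute)
    finally show "S v = (\<chi> i j. S (axis j 1) $ i) *v v" .
  qed
qed

text \<open>The invariant two-forms correspond to the skew operators that are complex linear, and skewness
  for the real part of the Hermitian product is skew-Hermiticity.\<close>

lemma U1_algebra:
  assumes "heterotic_background A g H nabla \<kappa> U1 adapted"
  shows "lie_isomorphic (reduced_algebra adapted \<kappa> (invariant_forms U1 2))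
    (null_bracket adapted) (u_algebra :: (complex^4^4) set) commutator"
proof -
  interpret heterotic_background A g H nabla \<kappa> U1 adapted
    by fact
  let ?f = "\<lambda>X :: complex^4^4. op_form (\<lambda>v. - (X *v v))"
  show ?thesis
  proof (rule operators_isomorphic[where \<rho> = "\<lambda>X v. - (X *v v)"])
    have "?f X \<in> invariant_forms U1 2" if "X \<in> u_algebra" for X
    proof -
      have "pullback h (?f X) = ?f X" if "h \<in> U1" for h
        using that unfolding U1_def
        by (auto intro!: pullback_op_form simp: vector_scalar_mult_simps(1))
          (simp add: vec_eq_iff matrix_vector_mult_def sum_distrib_left mult_ac)
      then show ?thesis
        using that alt_form_op_form[OF linear_neg_matrix_vector_mult(1)]
        by (simp add: invariant_forms_def u_algebra_iff)
    qed
    then show "?f ` u_algebra \<subseteq> span (invariant_forms U1 2)"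
      by (auto intro: span_base)
    show "invariant_forms U1 2 \<subseteq> ?f ` u_algebra"
    proof
      fix \<alpha>
      assume \<alpha>: "\<alpha> \<in> invariant_forms U1 2"
      then have "alt_form UNIV 2 \<alpha>"
        by (simp add: invariant_forms_def)
      then obtain S where S: "linear S" "skew S" "\<alpha> = op_form S"
        by (rule alt_form_2_operator)
      have "S (c *s v) = c *s S v" if c: "norm c = 1" for c v
      proof (rule commutes_with_isometry[where h = "\<lambda>v. c *s v"])
        show "pullback (\<lambda>v. c *s v) (op_form S) = op_form S"
          using \<alpha> c by (auto simp: invariant_forms_def U1_def S(3))
        have "c *s (inverse c *s v) = v" for v :: "complex^4"
          using c by (cases "c = 0") (auto simp: vec_eq_iff)
        then show "surj (\<lambda>v :: complex^4. c *s v)"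
          by (rule surjI)
      qed (use c in \<open>simp add: vector_scalar_mult_simps(1)\<close>)
      then obtain X where "S = (*v) X"
        using complex_linear_operator[OF S(1)] by blast
      then have "S = (\<lambda>v. - ((- X) *v v))"
        by (simp add: matrix_vector_mult_minus fun_eq_iff)
      then show "\<alpha> \<in> ?f ` u_algebra"
        using S by (intro image_eqI[of _ _ "- X"]) (simp_all add: u_algebra_iff)
    qed
    show "X = 0" if "\<And>v. - (X *v v) = 0" for X :: "complex^4^4"
      using that by (rule matrix_operator_inject)
  qed (assumption | rule order_refl subspace_u_algebra commutator_u_algebra linear_neg_matrix_vector_mult
      commutator_operator u_algebra_iff[THEN iffD1])+
qed

section \<open>Quaternionic operators\<close>

lemma inner_quat: "x \<bullet> y = Re (fst x * cnj (fst y)) + Re (snd x * cnj (snd y))" for x y :: quat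
  by (simp add: inner_prod_def inner_complex_def)

lemma qmult_assoc: "qmult (qmult p q) r = qmult p (qmult q r)"
  by (simp add: qmult_def algebra_simps)

lemma qmult_add: "qmult (p + p') q = qmult p q + qmult p' q" "qmult p (q + q') = qmult p q + qmult p q'"
  by (simp_all add: qmult_def algebra_simps)

lemma qmult_minus [simp]: "qmult (- p) q = - qmult p q" "qmult p (- q) = - qmult p q"
  by (simp_all add: qmult_def algebra_simps)

lemma qmult_diff: "qmult (p - p') q = qmult p q - qmult p' q" "qmult p (q - q') = qmult p q - qmult p q'"
  by (simp_all add: qmult_def algebra_simps)

lemma qmult_scaleR: "qmult (r *\<^sub>R p) q = r *\<^sub>R qmult p q" "qmult p (r *\<^sub>R q) = r *\<^sub>R qmult p q"
  by (simp_all add: qmult_def algebra_simps)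

lemma qmult_1 [simp]: "qmult (1, 0) q = q" "qmult q (1, 0) = q"
  by (simp_all add: qmult_def)

lemma qmult_0 [simp]: "qmult 0 q = 0" "qmult q 0 = 0"
  by (simp_all add: qmult_def zero_prod_def)

lemma qconj_simps [simp]: "qconj (- q) = - qconj q" "qconj (p + q) = qconj p + qconj q"
  "qconj (p - q) = qconj p - qconj q" "qconj (r *\<^sub>R q) = r *\<^sub>R qconj q" "qconj (qconj q) = q" "qconj 0 = 0"
  by (simp_all add: qconj_def zero_prod_def)

lemma qconj_qmult: "qconj (qmult p q) = qmult (qconj q) (qconj p)"
  by (simp add: qconj_def qmult_def algebra_simps)

lemma inner_quat_pair:
  fixes x :: "quat \<times> quat"
  shows "x \<bullet> (a, b) = fst x \<bullet> a + snd x \<bullet> b" "(a, b) \<bullet> x = a \<bullet> fst x + b \<bullet> snd x"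
  by (simp_all only: inner_prod_def[of x] inner_prod_def[of _ x] fst_conv snd_conv)

lemma inner_qmult_right: "x \<bullet> qmult y q = qmult x (qconj q) \<bullet> y"
  by (simp add: inner_quat qmult_def qconj_def algebra_simps)

lemma inner_qmult_left: "x \<bullet> qmult p y = qmult (qconj p) x \<bullet> y"
  by (simp add: inner_quat qmult_def qconj_def algebra_simps)

lemma qmult_qconj: "qmult (qconj q) q = (norm q)\<^sup>2 *\<^sub>R (1, 0)" "qmult q (qconj q) = (norm q)\<^sup>2 *\<^sub>R (1, 0)"
  by (simp_all add: power2_norm_eq_inner inner_quat qmult_def qconj_def complex_eq_iff algebra_simps)

text \<open>Multiplication of the row vector \<open>(x\<^sub>1, x\<^sub>2)\<close> from the right by the quaternionic matrix with rows
  \<open>(p, b)\<close> and \<open>(-b\<^sup>*, q)\<close>.  For imaginary \<open>p\<close> and \<open>q\<close> this is the general skew-Hermitian matrix;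
  it commutes with quaternionic multiplication from the left.\<close>

definition qmat :: "quat \<Rightarrow> quat \<Rightarrow> quat \<Rightarrow> quat \<times> quat \<Rightarrow> quat \<times> quat" where
  "qmat p b q x = (qmult (fst x) p - qmult (snd x) (qconj b), qmult (fst x) b + qmult (snd x) q)"

lemma linear_qmat: "linear (qmat p b q)"
  by (rule linearI) (simp_all add: qmat_def qmult_add qmult_scaleR algebra_simps)

lemma skew_qmat:
  assumes "p \<in> sp1_algebra" "q \<in> sp1_algebra"
  shows "skew (qmat p b q)"
  unfolding skew_def
proof (intro allI)
  fix x y :: "quat \<times> quat"
  show "x \<bullet> qmat p b q y = - (qmat p b q x \<bullet> y)"
    using assms unfolding qmat_def sp1_algebra_def inner_quat_pair inner_diff_right inner_diff_left
      inner_add_right inner_add_left inner_qmult_right by simp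
qed

lemma qmat_commutator:
  assumes "p \<in> sp1_algebra" "q \<in> sp1_algebra" "p' \<in> sp1_algebra" "q' \<in> sp1_algebra"
  shows "qmat p' b' q' (qmat p b q x) - qmat p b q (qmat p' b' q' x)
    = qmat (sp1_bracket p p' - (qmult b (qconj b') - qmult b' (qconj b)))
        (qmult p b' + qmult b q' - qmult p' b - qmult b' q)
        (sp1_bracket q q' - (qmult (qconj b) b' - qmult (qconj b') b)) x"
  using assms by (simp add: qmat_def sp1_algebra_def sp1_bracket_def qmult_add qmult_diff qmult_assoc
    qconj_qmult)

lemma qmat_eq_0:
  assumes "\<And>x. qmat p b q x = 0"
  shows "p = 0 \<and> b = 0 \<and> q = 0"
  using assms[of "((1, 0), 0)"] assms[of "(0, (1, 0))"] by (simp add: qmat_def prod_eq_iff qconj_def)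

lemma subspace_sp1_algebra: "subspace sp1_algebra"
  by (auto simp: subspace_def sp1_algebra_def)

lemma sp1_bracket_sp1_algebra:
  "p \<in> sp1_algebra \<Longrightarrow> q \<in> sp1_algebra \<Longrightarrow> sp1_bracket p q \<in> sp1_algebra"
  by (simp add: sp1_algebra_def sp1_bracket_def qconj_qmult)

lemma qmult_isometry: "norm p = 1 \<Longrightarrow> qmult p x \<bullet> qmult p y = x \<bullet> y"
  by (simp only: inner_qmult_left qmult_assoc[symmetric] qmult_qconj power_one scaleR_one qmult_1)

lemma left_mult_isometry:
  assumes "norm p = 1" "norm q = 1"
  shows "(qmult p (fst x), qmult q (snd x)) \<bullet> (qmult p (fst y), qmult q (snd y)) = x \<bullet> y"
    "surj (\<lambda>x. (qmult p (fst x), qmult q (snd x)))"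
proof -
  show "(qmult p (fst x), qmult q (snd x)) \<bullet> (qmult p (fst y), qmult q (snd y)) = x \<bullet> y"
    by (simp only: inner_prod_def[of x y] inner_quat_pair fst_conv snd_conv qmult_isometry assms)
  show "surj (\<lambda>x. (qmult p (fst x), qmult q (snd x)))"
    by (rule surjI[where f = "\<lambda>x. (qmult (qconj p) (fst x), qmult (qconj q) (snd x))"])
      (simp add: qmult_qconj assms flip: qmult_assoc)
qed

lemma pullback_qmat:
  assumes "norm u = 1"
  shows "pullback (\<lambda>x. (qmult u (fst x), qmult u (snd x))) (op_form (qmat p b q)) = op_form (qmat p b q)"
  by (rule pullback_op_form)
    (simp_all only: left_mult_isometry assms qmat_def qmult_assoc qmult_add qmult_diff fst_conv snd_conv)

text \<open>An operator that commutes with the unit quaternions acting from the left is linear over the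
  quaternions, hence given by the images of the two basis vectors; skewness makes the matrix of these
  images skew-Hermitian.\<close>

lemma Sp1_invariant_operator:
  assumes \<alpha>: "\<alpha> \<in> invariant_forms Sp1 2"
  obtains p b q where "p \<in> sp1_algebra" "q \<in> sp1_algebra" "\<alpha> = op_form (qmat p b q)"
proof -
  have "alt_form UNIV 2 \<alpha>"
    using \<alpha> by (simp add: invariant_forms_def)
  then obtain S where S: "linear S" "skew S" "\<alpha> = op_form S"
    by (rule alt_form_2_operator)
  have Sp1: "(\<lambda>x. (qmult u (fst x), qmult u (snd x))) \<in> Sp1" if "norm u = 1" for u
    using that unfolding Sp1_def by blast
  have unit: "S (qmult u (fst x), qmult u (snd x)) = (qmult u (fst (S x)), qmult u (snd (S x)))"
    if "norm u = 1" for u x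
    using \<alpha> Sp1[OF that] left_mult_isometry[OF that that]
    by (intro commutes_with_isometry[where h = "\<lambda>x. (qmult u (fst x), qmult u (snd x))"])
      (simp_all only: invariant_forms_def S(3) mem_Collect_eq)
  have comm: "S (qmult u (fst x), qmult u (snd x)) = (qmult u (fst (S x)), qmult u (snd (S x)))"
    for u x
  proof (cases "u = 0")
    case False
    have u: "qmult u v = norm u *\<^sub>R qmult (sgn u) v" for v
      using False by (simp add: sgn_div_norm flip: qmult_scaleR)
    show ?thesis
      using unit[of "sgn u" x] False linear_scale[OF S(1), of "norm u"]
      by (simp add: u norm_sgn flip: scaleR_Pair)
  qed (use linear_0[OF S(1)] in \<open>simp add: zero_prod_def qmult_def\<close>)
  obtain p b where pb: "S ((1, 0), 0) = (p, b)"
    by (cases "S ((1, 0), 0)")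
  obtain c q where cq: "S (0, (1, 0)) = (c, q)"
    by (cases "S (0, (1, 0))")
  have S1: "S (u, 0) = (qmult u p, qmult u b)" and S2: "S (0, u) = (qmult u c, qmult u q)" for u
    using comm[of u "((1, 0), 0)"] comm[of u "(0, (1, 0))"] by (simp_all add: pb cq)
  show thesis
  proof
    have *: "(1, 0) \<bullet> qmult v s = qconj s \<bullet> v" for v s
      by (simp add: inner_qmult_right)
    have "qconj p \<bullet> v = - p \<bullet> v" "qconj q \<bullet> v = - q \<bullet> v" "qconj c \<bullet> v = - b \<bullet> v" for v
      using S(2)[unfolded skew_def, rule_format, of "((1, 0), 0)" "(v, 0)"]
        S(2)[unfolded skew_def, rule_format, of "(0, (1, 0))" "(0, v)"]
        S(2)[unfolded skew_def, rule_format, of "((1, 0), 0)" "(0, v)"]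
      by (simp_all only: S1 S2 inner_quat_pair fst_conv snd_conv inner_zero_left inner_zero_right
        add_0 add_0_right * inner_minus_left qmult_1)
    then have eqs: "qconj p = - p" "qconj q = - q" "qconj c = - b"
      by (metis vector_eq_rdot)+
    then show "p \<in> sp1_algebra" "q \<in> sp1_algebra"
      by (simp_all add: sp1_algebra_def)
    have c: "c = - qconj b"
      using eqs(3) by (metis qconj_simps(1,5))
    have "S x = qmat p b q x" for x
      using linear_add[OF S(1), of "(fst x, 0)" "(0, snd x)"] by (simp add: S1 S2 c qmat_def)
    then have "S = qmat p b q"
      by (rule ext)
    then show "\<alpha> = op_form (qmat p b q)"
      by (simp add: S(3))
  qed
qed


text \<open>The forms of the hyper-complex structure belong to the right multiplications by imaginary
  quaternions, which are the scalar matrices among the operators considered here.\<close>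

lemma Sp2_algebra:
  assumes "heterotic_background A g H nabla \<kappa> Sp2 adapted"
  shows "lie_isomorphic
    (reduced_algebra adapted \<kappa> {quaternionic_form qi, quaternionic_form qj, quaternionic_form qk})
    (null_bracket adapted) sp1_algebra sp1_bracket"
proof -
  interpret heterotic_background A g H nabla \<kappa> Sp2 adapted
    by fact
  let ?f = "\<lambda>q. op_form (qmat q 0 q)"
  let ?B = "{quaternionic_form qi, quaternionic_form qj, quaternionic_form qk}"
  have form: "quaternionic_form q = ?f q" for q
    by (auto simp: quaternionic_form_def op_form_def fun_eq_iff qmat_def right_mult_def split: list.splits)
  have units: "qi \<in> sp1_algebra" "qj \<in> sp1_algebra" "qk \<in> sp1_algebra"
    by (auto simp: sp1_algebra_def qconj_def qi_def qj_def qk_def)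
  have eq_0: "q = 0" if "\<And>v. qmat q 0 q v = 0" for q
    using qmat_eq_0 that by blast
  show ?thesis
  proof (rule operators_isomorphic[where \<rho> = "\<lambda>q. qmat q 0 q"])
    have "?f q \<in> invariant_forms Sp2 2" if "q \<in> sp1_algebra" for q
    proof -
      have "pullback h (?f q) = ?f q" if "h \<in> Sp2" for h
      proof (rule pullback_op_form)
        have h: "linear h" "\<And>x. norm (h x) = norm x" "\<And>x q. h (right_mult x q) = right_mult (h x) q"
          using that by (auto simp: Sp2_def)
        then have "orthogonal_transformation h"
          unfolding orthogonal_transformation by blast
        then show "h x \<bullet> h y = x \<bullet> y" for x y
          unfolding orthogonal_transformation_def by blast
        show "qmat q 0 q (h x) = h (qmat q 0 q x)" for x
          using h(3)[of x q] by (simp add: qmat_def right_mult_def)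
      qed
      then show ?thesis
        using that by (simp add: invariant_forms_def alt_form_op_form linear_qmat skew_qmat)
    qed
    then show "?B \<subseteq> invariant_forms Sp2 2"
      using units by (auto simp: form)
    show "?B \<subseteq> ?f ` sp1_algebra"
      using units by (auto simp: form)
    show "?f ` sp1_algebra \<subseteq> span ?B"
    proof
      fix \<alpha>
      assume "\<alpha> \<in> ?f ` sp1_algebra"
      then obtain q where q: "qconj q = - q" "\<alpha> = ?f q"
        by (auto simp: sp1_algebra_def)
      then have "Re (fst q) = 0"
        by (auto simp: qconj_def complex_eq_iff prod_eq_iff)
      then have "q = Im (fst q) *\<^sub>R qi + Re (snd q) *\<^sub>R qj + Im (snd q) *\<^sub>R qk"
        by (simp add: qi_def qj_def qk_def complex_eq_iff prod_eq_iff)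
      then have "\<alpha> = ?f (Im (fst q) *\<^sub>R qi + Re (snd q) *\<^sub>R qj + Im (snd q) *\<^sub>R qk)"
        using q(2) by simp
      also have "\<dots> = Im (fst q) *\<^sub>R ?f qi + Re (snd q) *\<^sub>R ?f qj + Im (snd q) *\<^sub>R ?f qk"
        by (auto simp: fun_eq_iff op_form_def qmat_def scaleR_fun_apply qmult_add qmult_scaleR
          inner_prod_def inner_add_right algebra_simps split: list.splits)
      also have "\<dots> \<in> span ?B"
        unfolding form[symmetric]
        by (intro span_add[of _ ?B] span_scale[of _ ?B] span_base[of _ ?B]) simp_all
      finally show "\<alpha> \<in> span ?B" .
    qed
    show "linear (\<lambda>q. qmat q 0 q v)" for v
      by (rule linearI) (simp_all add: qmat_def qmult_add qmult_scaleR algebra_simps)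
    show "qmat (sp1_bracket p q) 0 (sp1_bracket p q) v = qmat q 0 q (qmat p 0 p v) - qmat p 0 p (qmat q 0 q v)"
      if "p \<in> sp1_algebra" "q \<in> sp1_algebra" for p q v
      using qmat_commutator[OF that(1,1,2,2), of 0 0 v] by simp
  qed (auto simp: subspace_sp1_algebra sp1_bracket_sp1_algebra linear_qmat skew_qmat intro: eq_0)
qed

text \<open>The group contains the diagonal \<open>Sp(1)\<close>, so its invariant operators are among the quaternionic
  matrices; the two summands of \<open>\<bbbH>\<^sup>2\<close> are inequivalent under the whole group, which leaves the diagonal ones.\<close>

lemma Sp1_Sp1_algebra:
  assumes "heterotic_background A g H nabla \<kappa> Sp1_Sp1 adapted"
  shows "lie_isomorphic
    (reduced_algebra adapted \<kappa> (invariant_forms Sp1_Sp1 2)) (null_bracket adapted)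
    (sp1_algebra \<times> sp1_algebra) (sum_bracket sp1_bracket sp1_bracket)"
proof -
  interpret heterotic_background A g H nabla \<kappa> Sp1_Sp1 adapted
    by fact
  let ?f = "\<lambda>x. op_form (qmat (fst x) 0 (snd x))"
  show ?thesis
  proof (rule operators_isomorphic[where \<rho> = "\<lambda>x. qmat (fst x) 0 (snd x)"])
    have "?f x \<in> invariant_forms Sp1_Sp1 2" if x: "x \<in> sp1_algebra \<times> sp1_algebra" for x
    proof -
      have "pullback h (?f x) = ?f x" if h: "h \<in> Sp1_Sp1" for h
      proof -
        obtain u v where "h = (\<lambda>x. (qmult u (fst x), qmult v (snd x)))" "norm u = 1" "norm v = 1"
          using h unfolding Sp1_Sp1_def by blast
        then show ?thesis
          using left_mult_isometry(1)
          by (intro pullback_op_form) (simp_all add: qmat_def qmult_assoc)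
      qed
      then show ?thesis
        using x by (auto simp: invariant_forms_def alt_form_op_form linear_qmat skew_qmat)
    qed
    then show "?f ` (sp1_algebra \<times> sp1_algebra) \<subseteq> span (invariant_forms Sp1_Sp1 2)"
      using span_base by blast
    show "invariant_forms Sp1_Sp1 2 \<subseteq> ?f ` (sp1_algebra \<times> sp1_algebra)"
    proof
      fix \<alpha>
      assume \<alpha>: "\<alpha> \<in> invariant_forms Sp1_Sp1 2"
      moreover have "Sp1 \<subseteq> Sp1_Sp1"
        unfolding Sp1_def Sp1_Sp1_def by blast
      ultimately have "\<alpha> \<in> invariant_forms Sp1 2"
        unfolding invariant_forms_def by blast
      then obtain p b q where S: "p \<in> sp1_algebra" "q \<in> sp1_algebra" "\<alpha> = op_form (qmat p b q)"
        by (rule Sp1_invariant_operator)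
      \<comment> \<open>The element \<open>(1, -1)\<close> of the group separates the two summands and removes the
        off-diagonal entries.\<close>
      let ?h = "\<lambda>x. (qmult (1, 0) (fst x), qmult (- (1, 0)) (snd x))"
      have n: "norm ((1, 0) :: quat) = 1" "norm (- (1, 0) :: quat) = 1"
        by (simp_all add: norm_prod_def)
      have "qmat p b q (?h ((1, 0), 0)) = ?h (qmat p b q ((1, 0), 0))"
      proof (rule commutes_with_isometry)
        show "pullback ?h (op_form (qmat p b q)) = op_form (qmat p b q)"
          using \<alpha> n by (auto simp only: invariant_forms_def Sp1_Sp1_def S(3)) 
      qed (use left_mult_isometry[OF n] in auto)
      then have "b = 0"
        by (simp add: qmat_def qmult_def prod_eq_iff)
      then show "\<alpha> \<in> ?f ` (sp1_algebra \<times> sp1_algebra)"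
        using S by (intro image_eqI[of _ _ "(p, q)"]) auto
    qed
    show "linear (\<lambda>x. qmat (fst x) 0 (snd x) v)" for v
      by (rule linearI) (simp_all add: qmat_def qmult_add qmult_scaleR algebra_simps)
    show "qmat (fst (sum_bracket sp1_bracket sp1_bracket x y)) 0 (snd (sum_bracket sp1_bracket sp1_bracket x y)) v
        = qmat (fst y) 0 (snd y) (qmat (fst x) 0 (snd x) v) - qmat (fst x) 0 (snd x) (qmat (fst y) 0 (snd y) v)"
      if "x \<in> sp1_algebra \<times> sp1_algebra" "y \<in> sp1_algebra \<times> sp1_algebra" for x y v
      using that qmat_commutator[of "fst x" "snd x" "fst y" "snd y" 0 0 v] by (auto simp: sum_bracket_def)
    show "x = 0" if "\<And>v. qmat (fst x) 0 (snd x) v = 0" for x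
      using qmat_eq_0[OF that] by (simp add: prod_eq_iff)
    show "skew (qmat (fst x) 0 (snd x))" if "x \<in> sp1_algebra \<times> sp1_algebra" for x
      using that by (simp add: skew_qmat mem_Times_iff)
    show "sum_bracket sp1_bracket sp1_bracket x y \<in> sp1_algebra \<times> sp1_algebra"
      if "x \<in> sp1_algebra \<times> sp1_algebra" "y \<in> sp1_algebra \<times> sp1_algebra" for x y
      using that by (simp add: sum_bracket_def mem_Times_iff sp1_bracket_sp1_algebra)
  qed (simp_all add: subspace_Times subspace_sp1_algebra linear_qmat)
qed

section \<open>The spinor representation of so(5)\<close>

lemma exhaust_5:
  fixes x :: 5
  shows "x = 1 \<or> x = 2 \<or> x = 3 \<or> x = 4 \<or> x = 5"
proof (induct x)
  case (of_int z)
  then have "0 \<le> z" and "z < 5" by simp_all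
  then have "z = 0 \<or> z = 1 \<or> z = 2 \<or> z = 3 \<or> z = 4" by arith
  then show ?case by auto
qed

lemma UNIV_5: "UNIV = {1, 2, 3, 4, 5 :: 5}"
  using exhaust_5 by auto

lemma sum_5: "sum f (UNIV :: 5 set) = f 1 + f 2 + f 3 + f 4 + f 5"
  unfolding UNIV_5 by (simp add: ac_simps)

text \<open>The isomorphism of \<open>so(5)\<close> with the skew-Hermitian quaternionic matrices of size two is the spin
  representation \<open>X \<mapsto> \<onehalf> \<Sum>\<^sub>a\<^sub><\<^sub>b X\<^sub>a\<^sub>b \<Gamma>\<^sub>a \<Gamma>\<^sub>b\<close>.  Here \<open>\<Gamma>\<^sub>5\<close> is the diagonal matrix with entries \<open>1\<close> and
  \<open>-1\<close>, and \<open>\<Gamma>\<^sub>1, \<dots>, \<Gamma>\<^sub>4\<close> have zero diagonal and the off-diagonal entries \<open>u\<^sup>*\<close> and \<open>u\<close> for \<open>u = 1, i,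
  j, k\<close>.  The three definitions give the diagonal entries \<open>p\<close>, \<open>q\<close> and the upper right entry \<open>b\<close> of
  the image.\<close>

definition so5_p :: "real^5^5 \<Rightarrow> quat" where
  "so5_p X = (Complex 0 ((X$1$2 - X$3$4) / 2), Complex ((X$1$3 + X$2$4) / 2) ((X$1$4 - X$2$3) / 2))"

definition so5_q :: "real^5^5 \<Rightarrow> quat" where
  "so5_q X = (Complex 0 (- (X$1$2 + X$3$4) / 2), Complex ((X$2$4 - X$1$3) / 2) (- (X$1$4 + X$2$3) / 2))"

definition so5_b :: "real^5^5 \<Rightarrow> quat" where
  "so5_b X = (Complex (- X$1$5 / 2) (X$2$5 / 2), Complex (X$3$5 / 2) (X$4$5 / 2))"

lemma so_algebra_entries:
  assumes "X \<in> so_algebra"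
  shows "X $ i $ i = (0::real)" "X $ j $ i = - X $ i $ j"
proof -
  have "transpose X $ i $ j = (- X) $ i $ j" for i j
    using assms by (simp only: so_algebra_def mem_Collect_eq)
  then show *: "X $ j $ i = - X $ i $ j" for i j
    unfolding transpose_def vec_lambda_beta vector_uminus_component .
  show "X $ i $ i = 0"
    using *[of i i] unfolding equal_neg_zero .
qed

lemmas so5_entries =
  so_algebra_entries(1)[of X 1] so_algebra_entries(1)[of X 2] so_algebra_entries(1)[of X 3]
  so_algebra_entries(1)[of X 4] so_algebra_entries(1)[of X 5]
  so_algebra_entries(2)[of X 2 1] so_algebra_entries(2)[of X 3 1] so_algebra_entries(2)[of X 4 1]
  so_algebra_entries(2)[of X 5 1] so_algebra_entries(2)[of X 3 2] so_algebra_entries(2)[of X 4 2]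
  so_algebra_entries(2)[of X 5 2] so_algebra_entries(2)[of X 4 3] so_algebra_entries(2)[of X 5 3]
  so_algebra_entries(2)[of X 5 4] for X :: "real^5^5"

lemma commutator_entry: "commutator X Y $ i $ j = (\<Sum>k\<in>UNIV. X $ i $ k * Y $ k $ j - Y $ i $ k * X $ k $ j)"
  by (simp add: commutator_def matrix_matrix_mult_def sum_subtractf)

text \<open>The right-hand sides are the entries of the commutator of two quaternionic matrices, as in
  \<open>qmat_commutator\<close>.\<close>

lemma so5_commutator:
  assumes X: "X \<in> so_algebra" and Y: "Y \<in> so_algebra"
  shows "so5_p (commutator X Y) = sp1_bracket (so5_p X) (so5_p Y)
      - (qmult (so5_b X) (qconj (so5_b Y)) - qmult (so5_b Y) (qconj (so5_b X)))"
    "so5_b (commutator X Y) = qmult (so5_p X) (so5_b Y) + qmult (so5_b X) (so5_q Y)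
      - qmult (so5_p Y) (so5_b X) - qmult (so5_b Y) (so5_q X)"
    "so5_q (commutator X Y) = sp1_bracket (so5_q X) (so5_q Y)
      - (qmult (qconj (so5_b X)) (so5_b Y) - qmult (qconj (so5_b Y)) (so5_b X))"
proof -
  note [simp] = so5_entries[OF X] so5_entries[OF Y] so5_p_def so5_q_def so5_b_def commutator_entry sum_5
    sp1_bracket_def qmult_def qconj_def complex_eq_iff
  show "so5_p (commutator X Y) = sp1_bracket (so5_p X) (so5_p Y)
      - (qmult (so5_b X) (qconj (so5_b Y)) - qmult (so5_b Y) (qconj (so5_b X)))"
    by simp (simp add: field_simps)
  show "so5_b (commutator X Y) = qmult (so5_p X) (so5_b Y) + qmult (so5_b X) (so5_q Y)
      - qmult (so5_p Y) (so5_b X) - qmult (so5_b Y) (so5_q X)"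
    by simp (simp add: field_simps)
  show "so5_q (commutator X Y) = sp1_bracket (so5_q X) (so5_q Y)
      - (qmult (qconj (so5_b X)) (so5_b Y) - qmult (qconj (so5_b Y)) (so5_b X))"
    by simp (simp add: field_simps)
qed

lemma so5_sp1: "so5_p X \<in> sp1_algebra" "so5_q X \<in> sp1_algebra"
  by (simp_all add: so5_p_def so5_q_def sp1_algebra_def qconj_def complex_eq_iff)

lemma so5_linear:
  "so5_p (X + Y) = so5_p X + so5_p Y" "so5_p (r *\<^sub>R X) = r *\<^sub>R so5_p X"
  "so5_q (X + Y) = so5_q X + so5_q Y" "so5_q (r *\<^sub>R X) = r *\<^sub>R so5_q X"
  "so5_b (X + Y) = so5_b X + so5_b Y" "so5_b (r *\<^sub>R X) = r *\<^sub>R so5_b X"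
  by (simp_all add: so5_p_def so5_q_def so5_b_def complex_eq_iff field_simps)

lemma so5_eq_0:
  assumes X: "X \<in> so_algebra" and "so5_p X = 0" "so5_b X = 0" "so5_q X = 0"
  shows "X = 0"
proof -
  have "X$1$2 = 0" "X$1$3 = 0" "X$1$4 = 0" "X$1$5 = 0" "X$2$3 = 0" "X$2$4 = 0" "X$2$5 = 0"
    "X$3$4 = 0" "X$3$5 = 0" "X$4$5 = 0"
    using assms(2-) by (auto simp: so5_p_def so5_q_def so5_b_def complex_eq_iff zero_prod_def)
  then have "\<forall>i\<in>{1, 2, 3, 4, 5}. \<forall>j\<in>{1, 2, 3, 4, 5}. X $ i $ j = 0"
    by (simp add: so5_entries[OF X])
  then show ?thesis
    unfolding UNIV_5[symmetric] by (simp add: vec_eq_iff)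
qed

text \<open>The inverse of the spin representation, obtained by solving the three defining equations for
  the entries above the diagonal.\<close>

definition so5_matrix :: "quat \<Rightarrow> quat \<Rightarrow> quat \<Rightarrow> real^5^5" where
  "so5_matrix p b q = (let
     A = (\<chi> i j.
       if i = 1 then
         if j = 2 then Im (fst p) - Im (fst q)
         else if j = 3 then Re (snd p) - Re (snd q)
         else if j = 4 then Im (snd p) - Im (snd q)
         else if j = 5 then - 2 * Re (fst b) else 0
       else if i = 2 then
         if j = 3 then - Im (snd p) - Im (snd q)
         else if j = 4 then Re (snd p) + Re (snd q)
         else if j = 5 then 2 * Im (fst b) else 0
       else if i = 3 then
         if j = 4 then - Im (fst p) - Im (fst q)
         else if j = 5 then 2 * Re (snd b) else 0
       else if i = 4 \<and> j = 5 then 2 * Im (snd b) else 0)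
     in A - transpose A)"

lemma so5_matrix:
  assumes "p \<in> sp1_algebra" "q \<in> sp1_algebra"
  shows "so5_matrix p b q \<in> so_algebra" "so5_p (so5_matrix p b q) = p"
    "so5_b (so5_matrix p b q) = b" "so5_q (so5_matrix p b q) = q"
proof -
  have "transpose (A - transpose A) = - (A - transpose A)" for A :: "real^5^5"
    by (simp add: vec_eq_iff transpose_def)
  then show "so5_matrix p b q \<in> so_algebra"
    by (simp add: so5_matrix_def so_algebra_def Let_def)
  have re: "Re (fst p) = 0" "Re (fst q) = 0"
    using assms by (auto simp: sp1_algebra_def qconj_def complex_eq_iff prod_eq_iff)
  show "so5_p (so5_matrix p b q) = p" "so5_b (so5_matrix p b q) = b" "so5_q (so5_matrix p b q) = q"
    by (simp_all add: so5_matrix_def Let_def so5_p_def so5_b_def so5_q_def transpose_def prod_eq_iff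
      complex_eq_iff re)
qed

text \<open>The operators that commute with the diagonal \<open>Sp(1)\<close> form the algebra \<open>sp(2)\<close>, which is
  isomorphic to \<open>so(5)\<close>.\<close>

lemma Sp1_algebra:
  assumes "heterotic_background A g H nabla \<kappa> Sp1 adapted"
  shows "lie_isomorphic
    (reduced_algebra adapted \<kappa> (invariant_forms Sp1 2)) (null_bracket adapted)
    (so_algebra :: (real^5^5) set) commutator"
proof -
  interpret heterotic_background A g H nabla \<kappa> Sp1 adapted
    by fact
  let ?r = "\<lambda>X. qmat (so5_p X) (so5_b X) (so5_q X)"
  show ?thesis
  proof (rule operators_isomorphic[where \<rho> = ?r])
    have "pullback h (op_form (?r X)) = op_form (?r X)" if h: "h \<in> Sp1" for h X
    proof -
      obtain u where "h = (\<lambda>x. (qmult u (fst x), qmult u (snd x)))" "norm u = 1"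
        using h unfolding Sp1_def by blast
      then show ?thesis
        by (simp only: pullback_qmat)
    qed
    then have "op_form (?r X) \<in> invariant_forms Sp1 2" for X
      by (simp add: invariant_forms_def alt_form_op_form linear_qmat skew_qmat so5_sp1)
    then show "(\<lambda>X. op_form (?r X)) ` so_algebra \<subseteq> span (invariant_forms Sp1 2)"
      using span_base by blast
    show "invariant_forms Sp1 2 \<subseteq> (\<lambda>X. op_form (?r X)) ` so_algebra"
    proof
      fix \<alpha>
      assume "\<alpha> \<in> invariant_forms Sp1 2"
      then obtain p b q where S: "p \<in> sp1_algebra" "q \<in> sp1_algebra" "\<alpha> = op_form (qmat p b q)"
        by (rule Sp1_invariant_operator)
      then show "\<alpha> \<in> (\<lambda>X. op_form (?r X)) ` so_algebra"
        by (intro image_eqI[of _ _ "so5_matrix p b q"]) (simp_all only: so5_matrix)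
    qed
    show "linear (\<lambda>X. ?r X v)" for v
      by (rule linearI) (simp_all add: qmat_def so5_linear qmult_add qmult_scaleR algebra_simps)
    show "?r (commutator X Y) v = ?r Y (?r X v) - ?r X (?r Y v)"
      if "X \<in> so_algebra" "Y \<in> so_algebra" for X Y v
      unfolding qmat_commutator[OF so5_sp1 so5_sp1] so5_commutator[OF that] ..
    show "X = 0" if "X \<in> so_algebra" "\<And>v. ?r X v = 0" for X
      using qmat_eq_0[OF that(2)] so5_eq_0[OF that(1)] by blast
  qed (simp_all only: subspace_so_algebra commutator_so_algebra linear_qmat skew_qmat so5_sp1 order_refl)
qed

section \<open>Operators acting as derivations\<close>

text \<open>The sum over all arguments of \<open>\<phi>\<close> with \<open>S\<close> applied to one of them, as a recursion that fits
  that of the exterior product.\<close>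

fun derivation :: "('v \<Rightarrow> 'v) \<Rightarrow> ('v list \<Rightarrow> 'c::comm_ring_1) \<Rightarrow> 'v list \<Rightarrow> 'c" where
  "derivation S \<phi> [] = 0"
| "derivation S \<phi> (x # xs) = \<phi> (S x # xs) + derivation S (interior_product x \<phi>) xs"

lemma derivation_add: "derivation S (\<lambda>ys. \<phi> ys + \<psi> ys) xs = derivation S \<phi> xs + derivation S \<psi> xs"
  by (induction xs arbitrary: \<phi> \<psi>) (simp_all add: interior_product_def[abs_def])

lemma derivation_mult: "derivation S (\<lambda>ys. c * \<phi> ys) xs = c * derivation S \<phi> xs"
  by (induction xs arbitrary: \<phi>) (simp_all add: interior_product_def[abs_def] distrib_left)

lemma derivation_sum: "derivation S (\<lambda>ys. \<Sum>i\<in>I. \<phi> i ys) xs = (\<Sum>i\<in>I. derivation S (\<phi> i) xs)"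
proof (induction I rule: infinite_finite_induct)
  case empty
  show ?case
    using derivation_mult[of S 0 "\<lambda>_. 0" xs] by simp
next
  case (infinite I)
  then show ?case
    using derivation_mult[of S 0 "\<lambda>_. 0" xs] by simp
qed (simp_all add: derivation_add)

lemma interior_derivation:
  "interior_product x (derivation S \<phi>)
    = (\<lambda>ys. interior_product (S x) \<phi> ys + derivation S (interior_product x \<phi>) ys)"
  by (simp add: fun_eq_iff interior_product_def[of x "derivation S \<phi>"]) (simp add: interior_product_def)

lemma derivation_eq_0:
  assumes "\<And>ys x zs. xs = ys @ x # zs \<Longrightarrow> \<phi> (ys @ S x # zs) = 0"
  shows "derivation S \<phi> xs = 0"
  using assms
proof (induction xs arbitrary: \<phi>)
  case (Cons x xs)
  have "\<phi> (S x # xs) = 0"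
    using Cons.prems[of "[]"] by simp
  moreover have "derivation S (interior_product x \<phi>) xs = 0"
    using Cons.prems[of "x # _"] by (intro Cons.IH) (simp add: interior_product_def)
  ultimately show ?case
    by simp
qed simp

lemma parity_derivation:
  assumes "parity p \<phi>"
  shows "parity p (derivation S \<phi>)"
  unfolding parity_def
proof
  fix xs
  show "derivation S \<phi> xs \<noteq> 0 \<longrightarrow> even (length xs + p)"
    using assms
  proof (induction xs arbitrary: p \<phi>)
    case (Cons x xs)
    show ?case
      using Cons.IH[OF parity_interior[OF Cons.prems], of x] Cons.prems
      by (cases "\<phi> (S x # xs) = 0") (auto simp: parity_def)
  qed simp
qed

lemma derivation_wedge:
  assumes "parity p \<alpha>"
  shows "derivation S (wedge \<alpha> \<beta>) xs = wedge (derivation S \<alpha>) \<beta> xs + wedge \<alpha> (derivation S \<beta>) xs"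
  using assms
proof (induction xs arbitrary: p \<alpha> \<beta>)
  case (Cons x xs)
  note w = wedge_Cons[OF Cons.prems]
  have i: "interior_product x (wedge \<alpha> \<beta>)
      = (\<lambda>ys. wedge (interior_product x \<alpha>) \<beta> ys + (- 1) ^ p * wedge \<alpha> (interior_product x \<beta>) ys)"
    by (simp add: fun_eq_iff interior_product_def[of x "wedge \<alpha> \<beta>"] w)
  show ?case
    unfolding derivation.simps i w wedge_Cons[OF parity_derivation[OF Cons.prems]]
      derivation_add derivation_mult Cons.IH[OF Cons.prems] Cons.IH[OF parity_interior[OF Cons.prems]]
      interior_derivation wedge_add_left wedge_add_right
    by (simp add: algebra_simps)
qed simp

text \<open>The contraction with a two-form raises its index and is therefore the infinitesimal action of
  its operator.\<close>

lemma contraction_op_form_derivation: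
  fixes \<phi> :: "'v::euclidean_space list \<Rightarrow> real"
  assumes "alt_form UNIV k \<phi>"
  shows "contraction (op_form S) \<phi> xs = derivation S \<phi> xs"
  using assms
proof (induction xs arbitrary: k \<phi>)
  case Nil
  show ?case
    by (simp add: contraction_apply interior_op_form)
next
  case (Cons x xs)
  have sw: "wedge (one_form (\<lambda>y. b \<bullet> S y)) (interior_product x (interior_product b \<phi>)) xs
      = - wedge (one_form (\<lambda>y. b \<bullet> S y)) (interior_product b (interior_product x \<phi>)) xs" for b
    using wedge_mult_right[of _ "- 1" "interior_product b (interior_product x \<phi>)"]
    by (simp add: interior_anticommute[OF Cons.prems, of x b])
  have "contraction (op_form S) \<phi> (x # xs)
      = (\<Sum>b\<in>Basis. (S x \<bullet> b) * \<phi> (b # xs)) + contraction (op_form S) (interior_product x \<phi>) xs"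
    by (simp add: contraction_apply interior_op_form wedge_one_form_Cons sw sum.distrib)
      (simp add: interior_product_def inner_commute)
  also have "(\<Sum>b\<in>Basis. (S x \<bullet> b) * \<phi> (b # xs)) = \<phi> (S x # xs)"
    using linear_sum[OF alt_form_linear_map[OF Cons.prems], of "\<lambda>b. (S x \<bullet> b) *\<^sub>R b" Basis xs]
    by (simp add: euclidean_representation alt_form_scaleR_first[OF Cons.prems])
  also have "contraction (op_form S) (interior_product x \<phi>) xs = derivation S (interior_product x \<phi>) xs"
    using Cons.IH[OF alt_form_interior[OF Cons.prems]] .
  finally show ?case
    by simp
qed

text \<open>The tensor \<open>\<Sum>\<^sub>b b \<otimes> b\<close> is invariant under the orthogonal group, hence annihilated by its Lie
  algebra.\<close>

lemma skew_trace_zero: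
  fixes B :: "'v::euclidean_space \<Rightarrow> 'v \<Rightarrow> real"
  assumes "bilinear B" "skew S"
  shows "(\<Sum>b\<in>Basis. B (S b) b + B b (S b)) = 0"
proof -
  have B: "linear (B x)" "linear (\<lambda>x. B x y)" for x y
    using assms(1) by (simp_all add: bilinear_def)
  have "B (S b) b = (\<Sum>c\<in>Basis. (S b \<bullet> c) * B c b)" for b
    using linear_sum[OF B(2), of "\<lambda>c. (S b \<bullet> c) *\<^sub>R c" Basis b]
    by (simp add: euclidean_representation linear_scale[OF B(2)])
  then have "(\<Sum>b\<in>Basis. B (S b) b) = (\<Sum>b\<in>Basis. \<Sum>c\<in>Basis. (S b \<bullet> c) * B c b)"
    by simp
  also have "\<dots> = (\<Sum>b\<in>Basis. \<Sum>c\<in>Basis. (S c \<bullet> b) * B b c)"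
    by (rule sum.swap)
  also have "\<dots> = (\<Sum>b\<in>Basis. \<Sum>c\<in>Basis. - ((S b \<bullet> c) * B b c))"
  proof -
    have "(S c \<bullet> b) * B b c = - ((S b \<bullet> c) * B b c)" for b c
      using assms(2) unfolding skew_def by (metis inner_commute mult_minus_left)
    then show ?thesis
      by (simp only:)
  qed
  also have "\<dots> = - (\<Sum>b\<in>Basis. B b (S b))"
  proof -
    have "B b (S b) = (\<Sum>c\<in>Basis. (S b \<bullet> c) * B b c)" for b
      using linear_sum[OF B(1), of b "\<lambda>c. (S b \<bullet> c) *\<^sub>R c" Basis]
      by (simp add: euclidean_representation linear_scale[OF B(1)])
    then show ?thesis
      by (simp add: sum_negf)
  qed
  finally show ?thesis
    by (simp add: sum.distrib)
qed

text \<open>An instance of the Jacobi identity.  The operator acts as a derivation on exterior products, and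
  the terms in which it hits the contracted index cancel because the metric is invariant.\<close>

lemma contraction_derivation:
  fixes \<phi> \<psi> :: "'v::euclidean_space list \<Rightarrow> real"
  assumes S: "linear S" "skew S" and \<phi>: "alt_form UNIV p \<phi>" and \<psi>: "alt_form UNIV q \<psi>"
  shows "contraction (op_form S) (contraction \<phi> \<psi>)
    = contraction (contraction (op_form S) \<phi>) \<psi> + contraction \<phi> (contraction (op_form S) \<psi>)"
proof
  fix xs
  let ?i = interior_product
  have D: "contraction (op_form S) \<phi> = derivation S \<phi>" "contraction (op_form S) \<psi> = derivation S \<psi>"
    using contraction_op_form_derivation \<phi> \<psi> by blast+
  have i: "derivation S (?i b \<theta>) = (\<lambda>ys. ?i b (derivation S \<theta>) ys + - 1 * ?i (S b) \<theta> ys)"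
    for b and \<theta> :: "'v list \<Rightarrow> real"
    by (simp add: interior_derivation)
  have "bilinear (\<lambda>u v. wedge (?i u \<phi>) (?i v \<psi>) xs)"
    unfolding bilinear_def
    using interior_linear[OF \<phi>, of 1 _ 1] interior_linear[OF \<psi>, of 1 _ 1]
      interior_linear[OF \<phi>, of _ _ 0] interior_linear[OF \<psi>, of _ _ 0]
    by (auto intro!: linearI simp: wedge_add_left wedge_add_right wedge_mult_left wedge_mult_right)
  note trace = skew_trace_zero[OF this S(2)]
  have "contraction (op_form S) (contraction \<phi> \<psi>) xs
      = derivation S (\<lambda>xs. \<Sum>b\<in>Basis. wedge (?i b \<phi>) (?i b \<psi>) xs) xs"
    using contraction_op_form_derivation[OF alt_form_contraction[OF \<phi> \<psi>]]
    by (simp add: contraction_apply[of \<phi> \<psi>, abs_def])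
  also have "\<dots> = (\<Sum>b\<in>Basis. wedge (?i b (derivation S \<phi>)) (?i b \<psi>) xs)
      + (\<Sum>b\<in>Basis. wedge (?i b \<phi>) (?i b (derivation S \<psi>)) xs)
      - (\<Sum>b\<in>Basis. wedge (?i (S b) \<phi>) (?i b \<psi>) xs + wedge (?i b \<phi>) (?i (S b) \<psi>) xs)"
    unfolding derivation_sum derivation_wedge[OF parity_interior[OF parity_alt_form[OF \<phi>]]] i
      wedge_add_left wedge_add_right wedge_mult_left wedge_mult_right
    by (simp add: sum.distrib sum_subtractf sum_negf)
  finally show "contraction (op_form S) (contraction \<phi> \<psi>) xs
      = (contraction (contraction (op_form S) \<phi>) \<psi> + contraction \<phi> (contraction (op_form S) \<psi>)) xs"
    unfolding trace by (simp add: contraction_apply D)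
qed


section \<open>The Hermitian form and the holomorphic volume form\<close>

abbreviation (input) im_mult :: "complex^'n \<Rightarrow> complex^'n" where
  "im_mult v \<equiv> \<i> *s v"

lemma hermitian_form_op_form: "hermitian_form = op_form im_mult"
  by (auto simp: hermitian_form_def op_form_def fun_eq_iff split: list.splits)

lemma linear_im_mult: "linear im_mult"
  by (rule linearI) (simp_all add: vec_eq_iff distrib_left)

lemma skew_im_mult: "skew im_mult"
  by (simp add: skew_def inner_vec_def inner_complex_def sum_negf[symmetric] algebra_simps)

text \<open>Forms are alternating over the reals throughout, so complex linearity is a separate property.\<close>

definition complex_multilinear :: "((complex^'n) list \<Rightarrow> complex) \<Rightarrow> bool" where
  "complex_multilinear F \<longleftrightarrow> (\<forall>xs c x ys. F (xs @ (c *s x) # ys) = c * F (xs @ x # ys))"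

lemma complex_multilinear_interior:
  "complex_multilinear F \<Longrightarrow> complex_multilinear (interior_product v F)"
  unfolding complex_multilinear_def interior_product_def by (metis append_Cons)

lemma complex_multilinear_first: "complex_multilinear F \<Longrightarrow> F ((c *s x) # ys) = c * F (x # ys)"
  unfolding complex_multilinear_def by (metis append_Nil)

lemma complex_multilinear_interior_mult:
  "complex_multilinear F \<Longrightarrow> interior_product (c *s x) F = (\<lambda>ys. c * interior_product x F ys)"
  by (simp add: interior_product_def fun_eq_iff complex_multilinear_first)

lemma complex_multilinear_wedge:
  assumes "parity p \<alpha>" "complex_multilinear \<alpha>" "complex_multilinear \<beta>"
  shows "complex_multilinear (wedge \<alpha> \<beta>)"
proof -
  have "wedge \<alpha> \<beta> (xs @ (c *s x) # ys) = c * wedge \<alpha> \<beta> (xs @ x # ys)" for xs c x ys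
    using assms
  proof (induction xs arbitrary: p \<alpha> \<beta>)
    case Nil
    then show ?case
      by (simp add: wedge_Cons complex_multilinear_interior_mult wedge_mult_left wedge_mult_right
        algebra_simps)
  next
    case (Cons y xs)
    show ?case
      using Cons.IH[OF parity_interior[OF Cons.prems(1)] complex_multilinear_interior[OF Cons.prems(2)]
          Cons.prems(3)]
        Cons.IH[OF Cons.prems(1,2) complex_multilinear_interior[OF Cons.prems(3)]]
      by (simp add: wedge_Cons[OF Cons.prems(1)] algebra_simps)
  qed
  then show ?thesis
    by (simp add: complex_multilinear_def)
qed

text \<open>On a holomorphic form the complex structure acts by multiplication with \<open>\<i>\<close> in each argument.\<close>

lemma derivation_complex_multilinear:
  assumes "complex_multilinear F" "linear g"
  shows "derivation im_mult (\<lambda>ys. g (F ys)) xs = real (length xs) * g (\<i> * F xs)"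
  using assms(1)
proof (induction xs arbitrary: F)
  case (Cons x xs)
  show ?case
    using Cons.IH[OF complex_multilinear_interior[OF Cons.prems], of x]
    by (simp add: complex_multilinear_first[OF Cons.prems] interior_product_def[abs_def] algebra_simps)
qed simp

lemma complex_multilinear_dz: "complex_multilinear (dz k)"
proof -
  have "dz k (xs @ (c *s x) # ys) = c * dz k (xs @ x # ys)" for xs c x ys
    by (cases xs; cases ys) (auto simp: dz_def one_form_def split: list.splits)
  then show ?thesis
    by (simp add: complex_multilinear_def)
qed

lemma parity_dz: "parity 1 (dz k)"
  by (simp only: dz_def parity_one_form)

lemma alt_form_dz: "alt_form UNIV 1 (dz k)"
  unfolding dz_def by (intro alt_form_one_form linearI) simp_all

lemma complex_multilinear_volume: "complex_multilinear holomorphic_volume"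
  unfolding holomorphic_volume_def
  by (intro complex_multilinear_wedge[OF parity_dz] complex_multilinear_dz)

lemma alt_form_volume: "alt_form UNIV 4 holomorphic_volume"
proof -
  have "alt_form UNIV (1 + (1 + (1 + 1))) holomorphic_volume"
    unfolding holomorphic_volume_def by (intro alt_form_wedge alt_form_dz)
  then show ?thesis
    by (simp add: eval_nat_numeral)
qed

lemma holomorphic_volume_expand:
  "holomorphic_volume [a, b, c, d] =
     a$1 * (b$2 * (c$3 * d$4 - d$3 * c$4) - c$2 * (b$3 * d$4 - d$3 * b$4) + d$2 * (b$3 * c$4 - c$3 * b$4))
   - b$1 * (a$2 * (c$3 * d$4 - d$3 * c$4) - c$2 * (a$3 * d$4 - d$3 * a$4) + d$2 * (a$3 * c$4 - c$3 * a$4))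
   + c$1 * (a$2 * (b$3 * d$4 - d$3 * b$4) - b$2 * (a$3 * d$4 - d$3 * a$4) + d$2 * (a$3 * b$4 - b$3 * a$4))
   - d$1 * (a$2 * (b$3 * c$4 - c$3 * b$4) - b$2 * (a$3 * c$4 - c$3 * a$4) + c$2 * (a$3 * b$4 - b$3 * a$4))"
  unfolding holomorphic_volume_def dz_def
  by (simp add: wedge_one_form_Cons interior_product_def) (simp add: one_form_def algebra_simps)

lemma det_4:
  "det (A::'a::comm_ring_1^4^4) =
     A$1$1 * (A$2$2 * (A$3$3 * A$4$4 - A$3$4 * A$4$3) - A$2$3 * (A$3$2 * A$4$4 - A$3$4 * A$4$2)
       + A$2$4 * (A$3$2 * A$4$3 - A$3$3 * A$4$2))
   - A$1$2 * (A$2$1 * (A$3$3 * A$4$4 - A$3$4 * A$4$3) - A$2$3 * (A$3$1 * A$4$4 - A$3$4 * A$4$1)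
       + A$2$4 * (A$3$1 * A$4$3 - A$3$3 * A$4$1))
   + A$1$3 * (A$2$1 * (A$3$2 * A$4$4 - A$3$4 * A$4$2) - A$2$2 * (A$3$1 * A$4$4 - A$3$4 * A$4$1)
       + A$2$4 * (A$3$1 * A$4$2 - A$3$2 * A$4$1))
   - A$1$4 * (A$2$1 * (A$3$2 * A$4$3 - A$3$3 * A$4$2) - A$2$2 * (A$3$1 * A$4$3 - A$3$3 * A$4$1)
       + A$2$3 * (A$3$1 * A$4$2 - A$3$2 * A$4$1))"
proof -
  have f1: "finite {2::4, 3, 4}" "1 \<notin> {2::4, 3, 4}"
    and f2: "finite {3::4, 4}" "2 \<notin> {3::4, 4}"
    and f3: "finite {4::4}" "3 \<notin> {4::4}"
    by auto
  show ?thesis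
    unfolding det_def UNIV_4
    unfolding sum_over_permutations_insert[OF f1]
    unfolding sum_over_permutations_insert[OF f2]
    unfolding sum_over_permutations_insert[OF f3]
    unfolding permutes_sing
    by (simp add: sign_swap_id permutation_swap_id permutation_compose sign_compose sign_id swap_id_eq)
      (simp add: algebra_simps)
qed

lemma holomorphic_volume_det:
  "holomorphic_volume [a, b, c, d]
    = det (\<chi> i j. (if j = 1 then a else if j = 2 then b else if j = 3 then c else d) $ i)"
  unfolding holomorphic_volume_expand det_4 by (simp add: algebra_simps)

lemma list_length_4E:
  assumes "length xs = 4"
  obtains a b c d where "xs = [a, b, c, d]"
  using assms by (auto simp: eval_nat_numeral length_Suc_conv)

lemma pullback_volume: "pullback ((*v) U) holomorphic_volume = (\<lambda>xs. det U * holomorphic_volume xs)"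
proof
  fix xs :: "(complex^4) list"
  show "pullback ((*v) U) holomorphic_volume xs = det U * holomorphic_volume xs"
  proof (cases "length xs = 4")
    case True
    then obtain a b c d where xs: "xs = [a, b, c, d]"
      by (rule list_length_4E)
    let ?M = "\<lambda>a b c d. \<chi> i (j::4). (if j = 1 then a else if j = 2 then b else if j = 3 then c else d) $ i"
    have "?M (U *v a) (U *v b) (U *v c) (U *v d) = U ** ?M a b c d"
      by (simp add: vec_eq_iff matrix_matrix_mult_def matrix_vector_mult_def)
    then show ?thesis
      by (simp add: xs pullback_def holomorphic_volume_det det_mul)
  next
    case False
    then show ?thesis
      by (simp add: pullback_def alt_form_degree[OF alt_form_volume])
  qed
qed

lemma Basis_complex_vec: "Basis = (\<lambda>(k, u). axis k u) ` (UNIV \<times> {1, \<i>})"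
  by (auto simp: Basis_vec_def Basis_complex_def image_iff)

lemma sum_Basis_complex_vec:
  "(\<Sum>b\<in>Basis. f b) = (\<Sum>k\<in>UNIV. f (axis k 1) + f (axis k \<i>))" for f :: "complex^'n \<Rightarrow> 'b::ab_group_add"
proof -
  have "inj_on (\<lambda>(k :: 'n, u). axis k u) (UNIV \<times> {1, \<i>})"
    by (auto simp: inj_on_def axis_eq_axis)
  then have "(\<Sum>b\<in>Basis. f b) = (\<Sum>(k :: 'n, u)\<in>UNIV \<times> {1, \<i>}. f (axis k u))"
    unfolding Basis_complex_vec by (subst sum.reindex) (auto simp: case_prod_beta)
  also have "\<dots> = (\<Sum>k\<in>UNIV. \<Sum>u\<in>{1, \<i>}. f (axis k u))"
    by (simp only: sum.cartesian_product)
  finally show ?thesis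
    by (simp add: complex_eq_iff)
qed

text \<open>On forms of top degree an operator acts by its trace, and the trace of the complex structure
  vanishes: it maps every basis vector to another one up to a sign, which then occurs twice.\<close>

lemma hermitian_contraction_top_form:
  fixes F :: "(complex^4) list \<Rightarrow> real"
  assumes F: "alt_form UNIV 8 F"
  shows "contraction hermitian_form F = 0"
proof
  fix xs
  have alt: "alt_form UNIV 8 (contraction hermitian_form F)"
    using alt_form_contraction[OF alt_form_op_form[OF linear_im_mult skew_im_mult] F]
    by (simp add: hermitian_form_op_form)
  have "contraction hermitian_form F xs = 0" if xs: "set xs \<subseteq> Basis" for xs
  proof (cases "length xs = 8 \<and> distinct xs")
    case True
    have "card (set xs) = DIM(complex^4)"
      using True by (simp add: distinct_card)
    then have set: "set xs = Basis"
      using xs by (intro card_subset_eq) simp_all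
    have "F (ys @ im_mult x # zs) = 0" if xs_eq: "xs = ys @ x # zs" for ys x zs
    proof -
      obtain k u where x: "x = axis k u" "u = 1 \<or> u = \<i>"
        using xs xs_eq by (auto simp: Basis_complex_vec)
      define c :: "complex^4" where "c = axis k (if u = 1 then \<i> else 1)"
      have "c \<in> set xs" "c \<noteq> x"
        using x unfolding set by (auto simp: c_def Basis_complex_vec axis_eq_axis complex_eq_iff)
      then have "\<not> distinct (ys @ c # zs)"
        by (auto simp: xs_eq)
      then have "F (ys @ c # zs) = 0"
        by (rule alt_form_not_distinct[OF F])
      moreover have "im_mult x = (if u = 1 then 1 else - 1) *\<^sub>R c + 0 *\<^sub>R c"
        using x by (auto simp: c_def vec_eq_iff axis_def complex_eq_iff)
      ultimately show ?thesis
        using alt_form_linear[OF F, of ys _ c 0 c zs] by simp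
    qed
    then show ?thesis
      unfolding hermitian_form_op_form contraction_op_form_derivation[OF F] by (rule derivation_eq_0)
  next
    case False
    then show ?thesis
      using alt_form_degree[OF alt, of xs] alt_form_not_distinct[OF alt, of xs] by blast
  qed
  then show "contraction hermitian_form F xs = 0 xs"
    using alt_form_zero_on_Basis[OF alt] by simp
qed

abbreviation (input) Re_volume :: "(complex^4) list \<Rightarrow> real" where
  "Re_volume \<equiv> Re \<circ> holomorphic_volume"

abbreviation (input) Im_volume :: "(complex^4) list \<Rightarrow> real" where
  "Im_volume \<equiv> Im \<circ> holomorphic_volume"

lemma alt_form_Re_Im_volume: "alt_form UNIV 4 Re_volume" "alt_form UNIV 4 Im_volume"
  unfolding comp_def
  by (intro alt_form_linear_comp[OF alt_form_volume] linearI; simp)+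

lemma alt_form_hermitian: "alt_form UNIV 2 hermitian_form"
  unfolding hermitian_form_op_form by (rule alt_form_op_form[OF linear_im_mult skew_im_mult])

lemma hermitian_contraction_volume:
  "contraction hermitian_form Re_volume = (- 4) *\<^sub>R Im_volume"
  "contraction hermitian_form Im_volume = 4 *\<^sub>R Re_volume"
proof -
  have "linear Re" "linear Im"
    by (simp_all add: linearI)
  then have "derivation im_mult Re_volume xs = real (length xs) * Re (\<i> * holomorphic_volume xs)"
    "derivation im_mult Im_volume xs = real (length xs) * Im (\<i> * holomorphic_volume xs)" for xs
    using derivation_complex_multilinear[OF complex_multilinear_volume] unfolding comp_def by blast+
  then show "contraction hermitian_form Re_volume = (- 4) *\<^sub>R Im_volume"
    "contraction hermitian_form Im_volume = 4 *\<^sub>R Re_volume"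
    unfolding fun_eq_iff hermitian_form_op_form
      contraction_op_form_derivation[OF alt_form_Re_Im_volume(1)]
      contraction_op_form_derivation[OF alt_form_Re_Im_volume(2)]
    using alt_form_degree[OF alt_form_volume] by (auto simp: scaleR_fun_apply)
qed

text \<open>The central generator: the bracket of the two parts of the holomorphic volume form has degree six
  and is not among the fundamental forms.\<close>

definition volume_bracket :: "(complex^4) list \<Rightarrow> real" where
  "volume_bracket = contraction Re_volume Im_volume"

lemma alt_form_volume_bracket: "alt_form UNIV 6 volume_bracket"
  using alt_form_contraction[OF alt_form_Re_Im_volume] by (simp add: volume_bracket_def)

lemma contraction_scaleR:
  "contraction (r *\<^sub>R \<psi>) \<phi> = r *\<^sub>R contraction \<psi> \<phi>" "contraction \<psi> (r *\<^sub>R \<phi>) = r *\<^sub>R contraction \<psi> \<phi>"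
  using contraction_linear_left[of r \<psi> 0 \<psi>] contraction_linear_right[of \<psi> r \<phi> 0 \<phi>] by simp_all

lemma parity_SU4_forms:
  "parity 2 hermitian_form" "parity 4 Re_volume" "parity 4 Im_volume" "parity 6 volume_bracket"
  by (rule parity_alt_form, fact alt_form_hermitian alt_form_Re_Im_volume alt_form_volume_bracket)+

lemma hermitian_contraction_derivation:
  "alt_form UNIV p \<phi> \<Longrightarrow> alt_form UNIV q \<psi> \<Longrightarrow> contraction hermitian_form (contraction \<phi> \<psi>)
    = contraction (contraction hermitian_form \<phi>) \<psi> + contraction \<phi> (contraction hermitian_form \<psi>)"
  unfolding hermitian_form_op_form by (rule contraction_derivation[OF linear_im_mult skew_im_mult])

lemma hermitian_volume_bracket: "contraction hermitian_form volume_bracket = 0"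
  unfolding volume_bracket_def hermitian_contraction_derivation[OF alt_form_Re_Im_volume]
    hermitian_contraction_volume contraction_scaleR
    contraction_self[OF parity_SU4_forms(2)] contraction_self[OF parity_SU4_forms(3)]
  by (simp add: contraction_self[OF parity_SU4_forms(2)] contraction_self[OF parity_SU4_forms(3)])

text \<open>The bracket of \<open>\<phi> = Re \<Omega>, Im \<Omega>\<close> with the form of degree six has top degree and is annihilated by
  the complex structure.  The latter acts as a derivation that kills the form of degree six and
  rotates the two parts of \<open>\<Omega>\<close> into each other, so the bracket with the other part vanishes.\<close>

lemma volume_bracket_central:
  "contraction Re_volume volume_bracket = 0" "contraction Im_volume volume_bracket = 0"
proof -
  have top: "alt_form UNIV 8 (contraction \<phi> volume_bracket)" if "alt_form UNIV 4 \<phi>" for \<phi>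
    using alt_form_contraction[OF that alt_form_volume_bracket] by simp
  have 0: "contraction \<phi> 0 = 0" for \<phi> :: "(complex^4) list \<Rightarrow> real"
    using contraction_scaleR(2)[of \<phi> 0 0] by simp
  have "contraction (contraction hermitian_form \<phi>) volume_bracket = 0" if \<phi>: "alt_form UNIV 4 \<phi>" for \<phi>
    using hermitian_contraction_derivation[OF \<phi> alt_form_volume_bracket]
      hermitian_contraction_top_form[OF top[OF \<phi>]]
    by (simp add: hermitian_volume_bracket 0)
  from this[OF alt_form_Re_Im_volume(1)] this[OF alt_form_Re_Im_volume(2)]
  have "(- 4) *\<^sub>R contraction Im_volume volume_bracket = 0" "4 *\<^sub>R contraction Re_volume volume_bracket = 0"
    unfolding hermitian_contraction_volume contraction_scaleR .
  then show "contraction Re_volume volume_bracket = 0" "contraction Im_volume volume_bracket = 0"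
    by (auto simp only: scaleR_eq_0_iff)
qed

lemma wedge_eq_0_on_sublists:
  assumes "\<And>ys. set ys \<subseteq> set xs \<Longrightarrow> \<alpha> ys = 0"
  shows "wedge \<alpha> \<beta> xs = 0"
  unfolding wedge_def using assms by (intro sum.neutral) (simp add: set_nths_subset)

definition volume_3 :: "(complex^4) list \<Rightarrow> complex" where
  "volume_3 = wedge (dz 1) (wedge (dz 2) (dz 3))"

lemma volume_3_expand:
  "volume_3 [a, b, c] = a$1 * (b$2 * c$3 - c$2 * b$3) - b$1 * (a$2 * c$3 - c$2 * a$3)
    + c$1 * (a$2 * b$3 - b$2 * a$3)"
  unfolding volume_3_def dz_def
  by (simp add: wedge_one_form_Cons interior_product_def) (simp add: one_form_def algebra_simps)

lemma alt_form_volume_3: "alt_form UNIV 3 volume_3"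
proof -
  have "alt_form UNIV (1 + (1 + 1)) volume_3"
    unfolding volume_3_def by (intro alt_form_wedge alt_form_dz)
  then show ?thesis
    by (simp add: eval_nat_numeral)
qed

lemma list_length_3E:
  assumes "length xs = 3"
  obtains a b c where "xs = [a, b, c]"
  using assms by (auto simp: eval_nat_numeral length_Suc_conv)

lemma interior_volume_axis_4: "holomorphic_volume (axis 4 u # xs) = - u * volume_3 xs"
proof (cases "length xs = 3")
  case True
  then obtain a b c where "xs = [a, b, c]"
    by (rule list_length_3E)
  then show ?thesis
    by (simp add: holomorphic_volume_expand volume_3_expand axis_def algebra_simps)
next
  case False
  then show ?thesis
    by (simp add: alt_form_degree[OF alt_form_volume] alt_form_degree[OF alt_form_volume_3])
qed

lemma volume_zero_on_hyperplane:
  assumes "\<And>x. x \<in> set xs \<Longrightarrow> x $ 4 = 0"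
  shows "holomorphic_volume xs = 0"
proof (cases "length xs = 4")
  case True
  then obtain a b c d where "xs = [a, b, c, d]"
    by (rule list_length_4E)
  then show ?thesis
    using assms by (simp add: holomorphic_volume_expand)
qed (simp add: alt_form_degree[OF alt_form_volume])

text \<open>A real basis of the hyperplane \<open>z\<^sub>4 = 0\<close>, on which the form of degree six is evaluated to show
  that it does not vanish: only the contractions with the two remaining basis vectors contribute,
  and both give the product of the real and imaginary parts of the volume form of the hyperplane.\<close>

definition real_basis_3 :: "(complex^4) list" where
  "real_basis_3 = [axis 1 1, axis 2 1, axis 3 1, axis 1 \<i>, axis 2 \<i>, axis 3 \<i>]"

lemma wedge_Re_Im_volume_3: "wedge (Re \<circ> volume_3) (Im \<circ> volume_3) real_basis_3 \<noteq> 0"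
proof -
  have p: "parity 3 (Re \<circ> volume_3)"
    using parity_alt_form[OF alt_form_volume_3] by (simp add: parity_def) (metis zero_complex.sel(1))
  note p4 = parity_interior[OF p] note p5 = parity_interior[OF p4] note p6 = parity_interior[OF p5]
  note p7 = parity_interior[OF p6]
  have d: "length xs \<noteq> 3 \<Longrightarrow> volume_3 xs = 0" for xs
    by (rule alt_form_degree[OF alt_form_volume_3])
  \<comment> \<open>The recursion for the exterior product stops after three arguments of the first factor.\<close>
  have p8: "interior_product a (interior_product b (interior_product c (interior_product e (Re \<circ> volume_3)))) = (\<lambda>_. 0)"
    for a b c e
    by (simp add: interior_product_def fun_eq_iff d)
  show ?thesis
    unfolding real_basis_3_def
    by (simp add: wedge_Cons[OF p] wedge_Cons[OF p4] wedge_Cons[OF p5] wedge_Cons[OF p6] p8)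
      (simp add: interior_product_def d volume_3_expand axis_def)
qed

lemma volume_bracket_real_basis_3:
  "volume_bracket real_basis_3 = 2 * wedge (Re \<circ> volume_3) (Im \<circ> volume_3) real_basis_3"
proof -
  let ?w = "\<lambda>b. wedge (interior_product b Re_volume) (interior_product b Im_volume) real_basis_3"
  have z: "?w (axis k u) = 0" if "k \<noteq> 4" for k u
  proof (rule wedge_eq_0_on_sublists)
    fix ys
    assume "set ys \<subseteq> set real_basis_3"
    then have "x $ 4 = 0" if "x \<in> set (axis k u # ys)" for x
      using that \<open>k \<noteq> 4\<close> by (auto simp: real_basis_3_def axis_def)
    then have "holomorphic_volume (axis k u # ys) = 0"
      by (rule volume_zero_on_hyperplane)
    then show "interior_product (axis k u) Re_volume ys = 0"
      by (simp add: interior_product_def)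
  qed
  have p: "parity 3 (Re \<circ> volume_3)" "parity 3 (Im \<circ> volume_3)"
    using parity_alt_form[OF alt_form_volume_3] by (auto simp: parity_def complex_eq_iff)
  have i: "interior_product (axis 4 1) Re_volume = (\<lambda>ys. - 1 * (Re \<circ> volume_3) ys)"
    "interior_product (axis 4 1) Im_volume = (\<lambda>ys. - 1 * (Im \<circ> volume_3) ys)"
    "interior_product (axis 4 \<i>) Re_volume = Im \<circ> volume_3"
    "interior_product (axis 4 \<i>) Im_volume = (\<lambda>ys. - 1 * (Re \<circ> volume_3) ys)"
    by (simp_all add: interior_product_def fun_eq_iff interior_volume_axis_4)
  have "?w (axis 4 1) = wedge (Re \<circ> volume_3) (Im \<circ> volume_3) real_basis_3"
    unfolding i wedge_mult_left wedge_mult_right by (simp add: comp_def)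
  moreover have "?w (axis 4 \<i>) = wedge (Re \<circ> volume_3) (Im \<circ> volume_3) real_basis_3"
    unfolding i wedge_mult_left wedge_mult_right using wedge_commute[OF p, of real_basis_3] by (simp add: comp_def)
  ultimately show ?thesis
    unfolding volume_bracket_def contraction_apply sum_Basis_complex_vec sum_4
    by (simp only: z[of 1] z[of 2] z[of 3]) (simp add: z)
qed

lemma SU4_invariant:
  assumes "h \<in> SU4"
  shows "pullback h hermitian_form = hermitian_form"
    "pullback h Re_volume = Re_volume" "pullback h Im_volume = Im_volume"
proof -
  obtain U where h: "h = (*v) U" and U: "U ** adjoint_matrix U = mat 1" "det U = 1"
    using assms by (auto simp: SU4_def)
  then have "adjoint_matrix U ** U = mat 1"
    by (simp add: matrix_left_right_inverse)
  then have "h x \<bullet> h y = x \<bullet> y" for x y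
    by (simp add: h inner_adjoint_matrix matrix_vector_mul_assoc)
  moreover have "im_mult (h x) = h (im_mult x)" for x
    by (simp add: h vec_eq_iff matrix_vector_mult_def sum_distrib_left mult_ac)
  ultimately show "pullback h hermitian_form = hermitian_form"
    unfolding hermitian_form_op_form by (rule pullback_op_form)
  have "pullback h holomorphic_volume = holomorphic_volume"
    by (simp add: h pullback_volume U(2))
  then show "pullback h Re_volume = Re_volume" "pullback h Im_volume = Im_volume"
    by (auto simp: pullback_def fun_eq_iff)
qed

text \<open>The factor \<open>1/4\<close> is due to the four arguments of \<open>\<Omega>\<close>: the Hermitian form rotates the two parts
  of \<open>\<Omega>\<close> with weight four, the generator \<open>J\<close> with weight one.\<close>

definition e2hat_form :: "real^4 \<Rightarrow> (complex^4) list \<Rightarrow> real" where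
  "e2hat_form x = (x$1 / 4) *\<^sub>R hermitian_form + (x$2 *\<^sub>R Re_volume + (x$3 *\<^sub>R Im_volume + x$4 *\<^sub>R volume_bracket))"

lemma e2hat_form_bracket: "e2hat_form (e2hat_bracket x y) = contraction (e2hat_form x) (e2hat_form y)"
proof -
  have c: "contraction Re_volume hermitian_form = 4 *\<^sub>R Im_volume"
    "contraction Im_volume hermitian_form = (- 4) *\<^sub>R Re_volume"
    "contraction volume_bracket hermitian_form = 0"
    "contraction Im_volume Re_volume = - volume_bracket"
    "contraction volume_bracket Re_volume = 0"
    "contraction volume_bracket Im_volume = 0"
    using contraction_commute[OF parity_SU4_forms(1,2)] contraction_commute[OF parity_SU4_forms(1,3)]
      contraction_commute[OF parity_SU4_forms(1,4)] contraction_commute[OF parity_SU4_forms(2,3)]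
      contraction_commute[OF parity_SU4_forms(2,4)] contraction_commute[OF parity_SU4_forms(3,4)]
    by (simp_all add: hermitian_contraction_volume hermitian_volume_bracket volume_bracket_central
      volume_bracket_def[symmetric])
  have add: "contraction (\<psi> + \<psi>') \<phi> = contraction \<psi> \<phi> + contraction \<psi>' \<phi>"
    "contraction \<phi> (\<psi> + \<psi>') = contraction \<phi> \<psi> + contraction \<phi> \<psi>'" for \<phi> \<psi> \<psi>' :: "(complex^4) list \<Rightarrow> real"
    using contraction_linear_left[of 1 \<psi> 1 \<psi>' \<phi>] contraction_linear_right[of \<phi> 1 \<psi> 1 \<psi>'] by simp_all
  have self: "contraction hermitian_form hermitian_form = 0" "contraction Re_volume Re_volume = 0"
    "contraction Im_volume Im_volume = 0" "contraction volume_bracket volume_bracket = 0"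
    by (simp_all add: contraction_self[OF parity_SU4_forms(1)] contraction_self[OF parity_SU4_forms(2)]
      contraction_self[OF parity_SU4_forms(3)] contraction_self[OF parity_SU4_forms(4)])
  have e: "e2hat_bracket x y $ 1 = 0" "e2hat_bracket x y $ 2 = x$1 * y$3 - x$3 * y$1"
    "e2hat_bracket x y $ 3 = x$2 * y$1 - x$1 * y$2" "e2hat_bracket x y $ 4 = x$2 * y$3 - x$3 * y$2"
    by (simp_all add: e2hat_bracket_def vector_def)
  show ?thesis
    unfolding e2hat_form_def e add contraction_scaleR c self hermitian_contraction_volume
      hermitian_volume_bracket volume_bracket_central volume_bracket_def[symmetric]
    by (rule ext) (simp add: scaleR_fun_apply field_simps)
qed

lemma e2hat_form_eq_0:
  assumes "e2hat_form x = 0"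
  shows "x = 0"
proof -
  have ev: "(x$1 / 4) * hermitian_form xs + (x$2 * Re (holomorphic_volume xs)
      + (x$3 * Im (holomorphic_volume xs) + x$4 * volume_bracket xs)) = 0" for xs
    using fun_cong[OF assms, of xs] by (simp add: e2hat_form_def scaleR_fun_apply)
  note d = alt_form_degree[OF alt_form_hermitian] alt_form_degree[OF alt_form_volume]
    alt_form_degree[OF alt_form_volume_bracket]
  have "volume_bracket real_basis_3 \<noteq> 0"
    using wedge_Re_Im_volume_3 by (simp add: volume_bracket_real_basis_3)
  then have "x$4 = 0"
    using ev[of real_basis_3] by (simp add: d real_basis_3_def)
  moreover have "x$2 = 0" "x$3 = 0"
    using ev[of "[axis 1 1, axis 2 1, axis 3 1, axis 4 1]"]
      ev[of "[axis 1 \<i>, axis 2 1, axis 3 1, axis 4 1]"]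
    by (simp_all add: d holomorphic_volume_expand axis_def)
  moreover have "x$1 = 0"
    using ev[of "[axis 1 \<i>, axis 1 1]"]
    by (simp add: d hermitian_form_def inner_vec_def sum_4 axis_def)
  ultimately show ?thesis
    by (simp add: vec_eq_iff forall_4)
qed

text \<open>The fundamental forms generate the algebra because the central element is the bracket of two of
  them.\<close>

lemma SU4_algebra:
  assumes "heterotic_background A g H nabla \<kappa> SU4 adapted"
  shows "lie_isomorphic (reduced_algebra adapted \<kappa> {hermitian_form, Re_volume, Im_volume})
    (null_bracket adapted) UNIV e2hat_bracket"
proof -
  interpret heterotic_background A g H nabla \<kappa> SU4 adapted
    by fact
  have lin: "linear e2hat_form"
    by (rule linearI) (simp_all add: e2hat_form_def fun_eq_iff scaleR_fun_apply field_simps)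
  have gens: "e2hat_form (axis 1 4) = hermitian_form" "e2hat_form (axis 2 1) = Re_volume"
    "e2hat_form (axis 3 1) = Im_volume"
    by (simp_all add: e2hat_form_def axis_def)
  show ?thesis
  proof (rule reduced_algebra_isomorphic)
    show "\<exists>k>0. \<alpha> \<in> invariant_forms SU4 k" if "\<alpha> \<in> {hermitian_form, Re_volume, Im_volume}" for \<alpha>
    proof -
      have "hermitian_form \<in> invariant_forms SU4 2" "Re_volume \<in> invariant_forms SU4 4"
        "Im_volume \<in> invariant_forms SU4 4"
        by (simp_all add: invariant_forms_def SU4_invariant alt_form_hermitian alt_form_Re_Im_volume)
      then show ?thesis
        using that zero_less_numeral by blast
    qed
    show "linear e2hat_form"
      by (fact lin)
    show "inj e2hat_form"
      unfolding linear_injective_0[OF lin] using e2hat_form_eq_0 by blast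
    show "range e2hat_form \<subseteq> exterior_algebra UNIV"
      unfolding exterior_algebra_def e2hat_form_def
      using alt_form_hermitian alt_form_Re_Im_volume alt_form_volume_bracket
      by (intro image_subsetI span_add span_scale span_base) blast+
    show "e2hat_form (e2hat_bracket x y) = contraction (e2hat_form x) (e2hat_form y)" for x y
      by (rule e2hat_form_bracket)
    show "{hermitian_form, Re_volume, Im_volume} \<subseteq> range e2hat_form"
      using gens by (metis empty_subsetI insert_subset rangeI)
    show "range e2hat_form \<subseteq> V"
      if V: "subspace V" "{hermitian_form, Re_volume, Im_volume} \<subseteq> V"
        "\<And>\<alpha> \<beta>. \<alpha> \<in> V \<Longrightarrow> \<beta> \<in> V \<Longrightarrow> contraction \<alpha> \<beta> \<in> V" for V
    proof -
      have "volume_bracket \<in> V"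
        using V(2,3) by (simp add: volume_bracket_def)
      then show ?thesis
        unfolding e2hat_form_def using V(1,2)
        by (intro image_subsetI) (simp add: subspace_add subspace_scale)
    qed
  qed simp_all
qed


section \<open>A single form of even degree\<close>

text \<open>The bracket of a form of even degree with itself vanishes, so such a form spans a closed
  algebra.\<close>

lemma single_form_algebra:
  assumes "\<Phi> \<in> invariant_forms K k" "even k" "k > 0" "\<Phi> \<noteq> 0"
    and "heterotic_background A g H nabla \<kappa> K adapted"
  shows "lie_isomorphic (reduced_algebra adapted \<kappa> {\<Phi>}) (null_bracket adapted) (UNIV :: real set) (\<lambda>x y. 0)"
proof -
  interpret heterotic_background A g H nabla \<kappa> K adapted
    by fact
  have \<Phi>: "alt_form UNIV k \<Phi>"
    using assms(1) by (simp add: invariant_forms_def)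
  have self: "contraction \<Phi> \<Phi> = 0"
    by (rule contraction_self[OF parity_alt_form[OF \<Phi>] assms(2)])
  have scale: "contraction (r *\<^sub>R \<psi>) (s *\<^sub>R \<psi>) = (r * s) *\<^sub>R contraction \<psi> \<psi>" for r s and \<psi> :: "'a list \<Rightarrow> real"
    using contraction_linear_left[of r \<psi> 0 \<psi>] contraction_linear_right[of _ s \<psi> 0 \<psi>] by simp
  show ?thesis
  proof (rule reduced_algebra_isomorphic[where f = "\<lambda>r. r *\<^sub>R \<Phi>"])
    show "\<exists>k>0. \<alpha> \<in> invariant_forms K k" if "\<alpha> \<in> {\<Phi>}" for \<alpha>
      using assms(1,3) that by blast
    show "inj (\<lambda>r. r *\<^sub>R \<Phi>)"
      using assms(4) by (simp add: inj_on_def)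
    show "range (\<lambda>r. r *\<^sub>R \<Phi>) \<subseteq> exterior_algebra UNIV"
      unfolding exterior_algebra_def using \<Phi> by (intro image_subsetI span_scale span_base) blast
    show "{\<Phi>} \<subseteq> range (\<lambda>r. r *\<^sub>R \<Phi>)"
      by (auto simp: image_iff intro: exI[of _ 1])
    show "0 *\<^sub>R \<Phi> = contraction (r *\<^sub>R \<Phi>) (s *\<^sub>R \<Phi>)" for r s
      by (simp add: scale self)
    show "range (\<lambda>r. r *\<^sub>R \<Phi>) \<subseteq> V" if "subspace V" "{\<Phi>} \<subseteq> V" for V
      using that by (auto intro: subspace_scale)
  qed (auto intro!: linearI simp: scaleR_add_left)
qed


section \<open>The Lie algebras of the fundamental forms\<close>

theorem theorem5p3:
  fixes A :: "'m::{t2_space, second_countable_topology} atlas"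
    and g :: "'m metric" and H \<kappa> :: "'m dform" and nabla :: "'m connection"
  shows
    "(\<forall>\<gamma> \<Phi> adapted. spinor_module \<gamma> \<and> \<Phi> \<in> invariant_forms (Spin7 \<gamma>) 4 \<and> \<Phi> \<noteq> 0 \<and>
        heterotic_background A g H nabla \<kappa> (Spin7 \<gamma>) adapted \<longrightarrow>
        lie_isomorphic (reduced_algebra adapted \<kappa> {\<Phi>}) (null_bracket adapted)
          (UNIV :: real set) (\<lambda>x y. 0)) \<and>
     (\<forall>adapted. heterotic_background A g H nabla \<kappa> SU4 adapted \<longrightarrow>
        lie_isomorphic
          (reduced_algebra adapted \<kappa>
             {hermitian_form, Re \<circ> holomorphic_volume, Im \<circ> holomorphic_volume})
          (null_bracket adapted)
          UNIV e2hat_bracket) \<and>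
     (\<forall>adapted. heterotic_background A g H nabla \<kappa> Sp2 adapted \<longrightarrow>
        lie_isomorphic
          (reduced_algebra adapted \<kappa>
             {quaternionic_form qi, quaternionic_form qj, quaternionic_form qk})
          (null_bracket adapted)
          sp1_algebra sp1_bracket) \<and>
     (\<forall>adapted. heterotic_background A g H nabla \<kappa> Sp1_Sp1 adapted \<longrightarrow>
        lie_isomorphic
          (reduced_algebra adapted \<kappa> (invariant_forms Sp1_Sp1 2)) (null_bracket adapted)
          (sp1_algebra \<times> sp1_algebra) (sum_bracket sp1_bracket sp1_bracket)) \<and>
     (\<forall>adapted. heterotic_background A g H nabla \<kappa> Sp1 adapted \<longrightarrow>
        lie_isomorphic
          (reduced_algebra adapted \<kappa> (invariant_forms Sp1 2)) (null_bracket adapted)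
          (so_algebra :: (real^5^5) set) commutator) \<and>
     (\<forall>adapted. heterotic_background A g H nabla \<kappa> U1 adapted \<longrightarrow>
        lie_isomorphic
          (reduced_algebra adapted \<kappa> (invariant_forms U1 2)) (null_bracket adapted)
          (u_algebra :: (complex^4^4) set) commutator) \<and>
     (\<forall>adapted. heterotic_background A g H nabla \<kappa> ({id} :: (real^8 \<Rightarrow> real^8) set) adapted \<longrightarrow>
        lie_isomorphic
          (reduced_algebra adapted \<kappa> (invariant_forms {id :: real^8 \<Rightarrow> real^8} 2))
          (null_bracket adapted)
          (so_algebra :: (real^8^8) set) commutator)"
proof (intro conjI allI impI, goal_cases)
  case (1 \<gamma> \<Phi> adapted)
  then have "\<Phi> \<in> invariant_forms (Spin7 \<gamma>) 4" "\<Phi> \<noteq> 0"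
    "heterotic_background A g H nabla \<kappa> (Spin7 \<gamma>) adapted"
    by simp_all
  then show ?case
    by (intro single_form_algebra[of \<Phi> "Spin7 \<gamma>" 4 A g H nabla]) simp_all
next
  case (2 adapted)
  then show ?case
    by (rule SU4_algebra)
next
  case (3 adapted)
  then show ?case
    by (rule Sp2_algebra)
next
  case (4 adapted)
  then show ?case
    by (rule Sp1_Sp1_algebra)
next
  case (5 adapted)
  then show ?case
    by (rule Sp1_algebra)
next
  case (6 adapted)
  then show ?case
    by (rule U1_algebra)
next
  case (7 adapted)
  then show ?case
    by (rule trivial_holonomy_algebra)
qed

end
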